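(* The triple $(V,Y,\mathbf 1)$ described in the context is a $\frac{\mathbb Z}{2}$-graded meromorphic open-string vertex algebra.
   Context: **The space $V$.** $\mathbb N=\{0,1,2,\dots\}$, $\mathbb Z_+=\{1,2,\dots\}$. Let $\mathfrak h$ be a finite-dimensional complex vector space with a nondegenerate symmetric bilinear form $(\cdot,\cdot)$; let $\mathfrak h^{\mathcal B},\mathfrak h^{\mathcal F}$ be two copies of $\mathfrak h$, mutually orthogonal in $\mathfrak h^{\mathcal B}\oplus\mathfrak h^{\mathcal F}$. Put $|a|=0$ for $a\in\mathfrak h^{\mathcal B}$ and $|a|=1$ for $a\in\mathfrak h^{\mathcal F}$. Let $\widehat{\mathfrak h}_{\mathbb Z/2}=(\mathfrak h^{\mathcal B}\otimes\mathbb C[t,t^{-1}])\oplus(\mathfrak h^{\mathcal F}\otimes t^{1/2}\mathbb C[t,t^{-1}])\oplus\mathbb C\mathbf k_{\mathcal B}\oplus\mathbb C\mathbf k_{\mathcal F}$. Its tensor algebra is $\mathbb Z_2$-graded by declaring $a\otimes t^{k+|a|/2}$ to have parity $|a|$ and $\mathbf k_{\mathcal B},\mathbf k_{\mathcal F}$ to be even, and $[u,v]=uv-(-1)^{|u||v|}vu$ is the $\mathbb Z_2$-graded commutator. Let $N$ be the quotient of the tensor algebra by the two-sided ideal generated by: $[\mathbf k_{\mathcal B},\mathbf k_{\mathcal F}]$; $[a\otimes t^{k+|a|/2},\mathbf k_{\mathcal B}]$ and $[a\otimes t^{k+|a|/2},\mathbf k_{\mathcal F}]$ ($a\in\mathfrak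 h^{\mathcal B}\cup\mathfrak h^{\mathcal F}$, $k\in\mathbb Z$); $[a\otimes t^k,b\otimes t^0]$ ($a,b\in\mathfrak h^{\mathcal B}$, $k\in\mathbb Z\setminus\{0\}$); $[a\otimes t^{k+1/2},b\otimes t^0]$ ($a\in\mathfrak h^{\mathcal F},b\in\mathfrak h^{\mathcal B},k\in\mathbb Z$); $[a\otimes t^m,b\otimes t^n]-m(a,b)\delta_{m+n,0}\mathbf k_{\mathcal B}$ ($a,b\in\mathfrak h^{\mathcal B}$, $m\in\mathbb Z_+,n\in-\mathbb Z_+$); $[a\otimes t^{m+1/2},b\otimes t^{n+1/2}]-(a,b)\delta_{m+n+1,0}\mathbf k_{\mathcal F}$ ($a,b\in\mathfrak h^{\mathcal F}$, $m\in\mathbb N,n\in-\mathbb Z_+$); $[a\otimes t^m,b\otimes t^{n+1/2}]$ ($a\in\mathfrak h^{\mathcal B},b\in\mathfrak h^{\mathcal F}$, with $m\in\mathbb Z_+,n\in-\mathbb Z_+$, or $m\in-\mathbb Z_+,n\in\mathbb N$). (No relations are imposed among positive modes, among negative modes, or among zero modes.) Fix $\ell_{\mathcal B},\ell_{\mathcal F}\in\mathbb C^\times$. The subalgebra $N_{\ge0}$ generated by $\mathfrak h^{\mathcal B}\otimes t^n$, $\mathfrak h^{\mathcal F}\otimes t^{n+1/2}$ ($n\ge0$), $\mathbf k_{\mathcal B},\mathbf k_{\mathcal F}$ acts on $\mathbb C\mathbf 1$ with all $a\otimes t^{n+|a|/2}$, $n\ge 0$, acting as $0$, $\mathbf k_{\mathcal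 B}$ as $\ell_{\mathcal B}$, $\mathbf k_{\mathcal F}$ as $\ell_{\mathcal F}$. Let $V=N\otimes_{N_{\ge0}}\mathbb C\mathbf 1$, and let $a(m+|a|/2)$ denote the action of $a\otimes t^{m+|a|/2}$ on $V$. As a vector space $V$ is the tensor algebra of $\bigl(\mathfrak h^{\mathcal B}\otimes t^{-1}\mathbb C[t^{-1}]\bigr)\oplus\bigl(\mathfrak h^{\mathcal F}\otimes t^{-1/2}\mathbb C[t^{-1}]\bigr)$: it is spanned by the vectors $a_1(-m_1+|a_1|/2)\cdots a_r(-m_r+|a_r|/2)\mathbf 1$ with $r\in\mathbb N$, $a_i\in\mathfrak h^{\mathcal B}\cup\mathfrak h^{\mathcal F}$, $m_i\in\mathbb Z_+$. Such a vector has weight $\sum_i(m_i-|a_i|/2)$, which makes $V=\coprod_{n\in\frac{\mathbb Z}{2}}V_{(n)}$. **The vertex operator map.** For $a\in\mathfrak h^{\mathcal B}\cup\mathfrak h^{\mathcal F}$, $a(x)=\sum_{n\in\mathbb Z}a(n+|a|/2)x^{-n-1}$ and $a^{(m)}(x)=\frac1{m!}\frac{d^m}{dx^m}a(x)$. The normal-ordered product $:a_1(k_1+|a_1|/2)\cdots a_r(k_r+|a_r|/2):$ is obtained by rearranging the factors so that all negative modes come first, then all positive modes, then all zero modes, keeping the original relative order inside each of these three groups, and multiplying by the sign of the permutation this induces on the fermionic factors (those with $a_i\in\mathfrak h^{\mathcal F}$). It is extended coefficientwise to products of series. Define $Y(\mathbf 1,x)=1_V$ and, linearly, for $a_i\in\mathfrak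 h^{\mathcal B}\cup\mathfrak h^{\mathcal F}$, $m_i\in\mathbb Z_+$, $$Y(a_1(-m_1+|a_1|/2)\cdots a_r(-m_r+|a_r|/2)\mathbf 1,x)=\,:a_1^{(m_1-1)}(x)\cdots a_r^{(m_r-1)}(x):.$$ **Definition.** A $\frac{\mathbb Z}{2}$-graded meromorphic open-string vertex algebra is a $\frac{\mathbb Z}2$-graded vector space $V=\coprod_{n\in\frac{\mathbb Z}2}V_{(n)}$ with a linear map $Y:V\otimes V\to V[[x,x^{-1}]]$, $u\otimes v\mapsto Y(u,x)v$, and $\mathbf 1\in V$ such that, with $V'=\coprod_n V_{(n)}^*$ the graded dual: (1) $V_{(n)}=0$ for $n$ sufficiently negative; and with $\mathbf d v=nv$ for $v\in V_{(n)}$, $[\mathbf d,Y(v,x)]=x\frac{d}{dx}Y(v,x)+Y(\mathbf dv,x)$ for all $v\in V$. (2) $Y(\mathbf 1,x)=1_V$; and for $u\in V$, $Y(u,x)\mathbf 1\in V[[x]]$ with $\lim_{x\to0}Y(u,x)\mathbf 1=u$. (3) With $D_Vv=\lim_{x\to0}\frac{d}{dx}Y(v,x)\mathbf 1$, one has $\frac{d}{dx}Y(v,x)=Y(D_Vv,x)=[D_V,Y(v,x)]$ for all $v\in V$. (4) Rationality: for $u_1,\dots,u_n,v\in V$, $v'\in V'$, the series $\langle v',Y(u_1,z_1)\cdots Y(u_n,z_n)v\rangle$ converges absolutely when $|z_1|>\cdots>|z_n|>0$ to a rational function in $z_1,\dots,z_n$ with the only possible poles at $z_i=0$ and $z_i=z_j$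 ($i\ne j$); and for $u_1,u_2,v\in V$, $v'\in V'$, the series $\langle v',Y(Y(u_1,z_1-z_2)u_2,z_2)v\rangle$ converges absolutely when $|z_2|>|z_1-z_2|>0$ to a rational function with the only possible poles at $z_1=0$, $z_2=0$, $z_1=z_2$. (5) Associativity: for $u_1,u_2,v\in V$, $v'\in V'$, $\langle v',Y(u_1,z_1)Y(u_2,z_2)v\rangle=\langle v',Y(Y(u_1,z_1-z_2)u_2,z_2)v\rangle$ when $|z_1|>|z_2|>|z_1-z_2|>0$. *)

theory Defs
  imports
    "HOL-Analysis.Analysis"
    "HOL-Library.Poly_Mapping"
    "HOL-Algebra.Algebra"
    "HOL-Algebra.Algebraic_Closure_Type"
begin

section \<open>Graded meromorphic open-string vertex algebras\<close>

abbreviation complex_ring :: "complex ring" where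
  "complex_ring \<equiv> ring_of_type_algebra"

text \<open>
  Complex vector spaces are \<open>HOL-Algebra\<close> modules over \<^term>\<open>complex_ring\<close>. A formal series in
  \<open>V[[x, x\<^sup>-\<^sup>1]]\<close> is the function sending \<open>p\<close> to the coefficient of \<open>x\<close> to the power \<open>p\<close>; accordingly
  a vertex operator map is a function \<open>Y\<close> with \<open>Y u p v\<close> the coefficient of \<open>x\<close> to the power \<open>p\<close>
  in \<open>Y(u, x) v\<close>.
\<close>

definition fderiv :: "(complex, 'v, 'z) module_scheme \<Rightarrow> (int \<Rightarrow> 'v) \<Rightarrow> int \<Rightarrow> 'v" where
  "fderiv V f = (\<lambda>p. of_int (p + 1) \<odot>\<^bsub>V\<^esub> f (p + 1))"

definition half_ints :: "rat set" where
  "half_ints = {n. 2 * n \<in> \<int>}"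

definition is_decomposition ::
  "(complex, 'v, 'z) module_scheme \<Rightarrow> (rat \<Rightarrow> 'v set) \<Rightarrow> 'v \<Rightarrow> (rat \<Rightarrow> 'v) \<Rightarrow> bool" where
  "is_decomposition V G v f \<longleftrightarrow>
     (\<forall>n\<in>half_ints. f n \<in> G n) \<and> (\<forall>n. n \<notin> half_ints \<longrightarrow> f n = \<zero>\<^bsub>V\<^esub>) \<and>
     finite {n. f n \<noteq> \<zero>\<^bsub>V\<^esub>} \<and> v = finsum V f {n. f n \<noteq> \<zero>\<^bsub>V\<^esub>}"

text \<open>The operator \<open>\<^bold>d\<close>, acting on \<open>G n\<close> as multiplication by \<open>n\<close>.\<close>

definition weight_op ::
  "(complex, 'v, 'z) module_scheme \<Rightarrow> (rat \<Rightarrow> 'v set) \<Rightarrow> 'v \<Rightarrow> 'v" where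
  "weight_op V G v =
     (let f = (THE f. is_decomposition V G v f)
      in finsum V (\<lambda>n. of_rat n \<odot>\<^bsub>V\<^esub> f n) {n. f n \<noteq> \<zero>\<^bsub>V\<^esub>})"

text \<open>The limit at \<open>x = 0\<close> of the derivative of \<open>Y(v, x)\<one>\<close> is taken as the constant coefficient.\<close>

definition D_op ::
  "(complex, 'v, 'z) module_scheme \<Rightarrow> ('v \<Rightarrow> int \<Rightarrow> 'v \<Rightarrow> 'v) \<Rightarrow> 'v \<Rightarrow> 'v \<Rightarrow> 'v" where
  "D_op V Y vac v = fderiv V (\<lambda>p. Y v p vac) 0"

definition graded_dual ::
  "(complex, 'v, 'z) module_scheme \<Rightarrow> (rat \<Rightarrow> 'v set) \<Rightarrow> ('v \<Rightarrow> complex) set" where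
  "graded_dual V G =
     {\<phi>. (\<forall>u\<in>carrier V. \<forall>v\<in>carrier V. \<phi> (u \<oplus>\<^bsub>V\<^esub> v) = \<phi> u + \<phi> v) \<and>
         (\<forall>c. \<forall>v\<in>carrier V. \<phi> (c \<odot>\<^bsub>V\<^esub> v) = c * \<phi> v) \<and>
         finite {n \<in> half_ints. \<exists>v\<in>G n. \<phi> v \<noteq> 0}}"

text \<open>Complex polynomials in \<open>n\<close> variables, as functions of the list of the variables.\<close>

inductive polyfun :: "nat \<Rightarrow> (complex list \<Rightarrow> complex) \<Rightarrow> bool" for n where
  const: "polyfun n (\<lambda>zs. c)"
| var: "i < n \<Longrightarrow> polyfun n (\<lambda>zs. zs ! i)"
| add: "polyfun n p \<Longrightarrow> polyfun n q \<Longrightarrow> polyfun n (\<lambda>zs. p zs + q zs)"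
| mult: "polyfun n p \<Longrightarrow> polyfun n q \<Longrightarrow> polyfun n (\<lambda>zs. p zs * q zs)"

text \<open>
  The series with terms \<open>t zs i\<close>, \<open>i \<in> A\<close>, converges absolutely on the region \<open>R\<close> of \<open>n\<close>-tuples
  to a single rational function \<open>P / Q\<close> whose only possible poles are at \<open>z\<^sub>i = 0\<close> and
  \<open>z\<^sub>i = z\<^sub>j\<close>.
\<close>

definition converges_to_rational ::
  "nat \<Rightarrow> (complex list \<Rightarrow> bool) \<Rightarrow> 'i set \<Rightarrow> (complex list \<Rightarrow> 'i \<Rightarrow> complex) \<Rightarrow> bool" where
  "converges_to_rational n R A t \<longleftrightarrow>
     (\<exists>P Q. polyfun n P \<and> polyfun n Q \<and>
        (\<forall>zs. length zs = n \<and> 0 \<notin> set zs \<and> distinct zs \<longrightarrow> Q zs \<noteq> 0) \<and>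
        (\<forall>zs. length zs = n \<and> R zs \<longrightarrow>
           (\<lambda>i. norm (t zs i)) summable_on A \<and> (t zs has_sum (P zs / Q zs)) A))"

text \<open>
  Terms of \<open>\<langle>\<phi>, Y(u\<^sub>1, z\<^sub>1) \<cdots> Y(u\<^sub>n, z\<^sub>n) v\<rangle>\<close>, indexed by the exponents of \<open>z\<^sub>1, \<dots>, z\<^sub>n\<close>, and of
  \<open>\<langle>\<phi>, Y(Y(u\<^sub>1, z\<^sub>1 - z\<^sub>2) u\<^sub>2, z\<^sub>2) v\<rangle>\<close>, indexed by the exponents of \<open>z\<^sub>1 - z\<^sub>2\<close> and \<open>z\<^sub>2\<close>.
\<close>

definition product_term ::
  "('v \<Rightarrow> int \<Rightarrow> 'v \<Rightarrow> 'v) \<Rightarrow> ('v \<Rightarrow> complex) \<Rightarrow> 'v list \<Rightarrow> 'v \<Rightarrow> complex list \<Rightarrow> int list \<Rightarrow> complex"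
where
  "product_term Y \<phi> us v zs ks =
     \<phi> (foldr (\<lambda>(u, k) w. Y u k w) (zip us ks) v) * (\<Prod>i<length us. (zs ! i) powi (ks ! i))"

definition iterate_term ::
  "('v \<Rightarrow> int \<Rightarrow> 'v \<Rightarrow> 'v) \<Rightarrow> ('v \<Rightarrow> complex) \<Rightarrow> 'v \<Rightarrow> 'v \<Rightarrow> 'v \<Rightarrow> complex \<Rightarrow> complex \<Rightarrow> int \<times> int \<Rightarrow> complex"
where
  "iterate_term Y \<phi> u1 u2 v z1 z2 =
     (\<lambda>(k, l). \<phi> (Y (Y u1 k u2) l v) * (z1 - z2) powi k * z2 powi l)"

locale graded_mosva = module complex_ring V
  for V :: "(complex, 'v, 'z) module_scheme" (structure) +
  fixes G :: "rat \<Rightarrow> 'v set" and Y :: "'v \<Rightarrow> int \<Rightarrow> 'v \<Rightarrow> 'v" and vac :: 'v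
  assumes G_submodule: "n \<in> half_ints \<Longrightarrow> submodule (G n) complex_ring V"
    and G_direct_sum: "v \<in> carrier V \<Longrightarrow> \<exists>!f. is_decomposition V G v f"
    and vac_closed: "vac \<in> carrier V"
    and Y_closed: "u \<in> carrier V \<Longrightarrow> v \<in> carrier V \<Longrightarrow> Y u p v \<in> carrier V"
    and Y_add_left: "u \<in> carrier V \<Longrightarrow> u' \<in> carrier V \<Longrightarrow> v \<in> carrier V \<Longrightarrow>
      Y (u \<oplus> u') p v = Y u p v \<oplus> Y u' p v"
    and Y_smult_left: "u \<in> carrier V \<Longrightarrow> v \<in> carrier V \<Longrightarrow> Y (c \<odot> u) p v = c \<odot> Y u p v"
    and Y_add_right: "u \<in> carrier V \<Longrightarrow> v \<in> carrier V \<Longrightarrow> v' \<in> carrier V \<Longrightarrow>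
      Y u p (v \<oplus> v') = Y u p v \<oplus> Y u p v'"
    and Y_smult_right: "u \<in> carrier V \<Longrightarrow> v \<in> carrier V \<Longrightarrow> Y u p (c \<odot> v) = c \<odot> Y u p v"
    and lower_bounded: "\<exists>N. \<forall>n\<in>half_ints. n < N \<longrightarrow> G n = {\<zero>}"
    and d_commutator: "u \<in> carrier V \<Longrightarrow> v \<in> carrier V \<Longrightarrow>
      weight_op V G (Y u p v) \<ominus> Y u p (weight_op V G v) =
        of_int p \<odot> Y u p v \<oplus> Y (weight_op V G u) p v"
    and vacuum: "v \<in> carrier V \<Longrightarrow> Y vac p v = (if p = 0 then v else \<zero>)"
    and creation: "u \<in> carrier V \<Longrightarrow> p < 0 \<Longrightarrow> Y u p vac = \<zero>"
      "u \<in> carrier V \<Longrightarrow> Y u 0 vac = u"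
    and D_derivative: "u \<in> carrier V \<Longrightarrow> v \<in> carrier V \<Longrightarrow>
      fderiv V (\<lambda>p. Y u p v) p = Y (D_op V Y vac u) p v"
    and D_commutator: "u \<in> carrier V \<Longrightarrow> v \<in> carrier V \<Longrightarrow>
      fderiv V (\<lambda>p. Y u p v) p = D_op V Y vac (Y u p v) \<ominus> Y u p (D_op V Y vac v)"
    and product_rational: "set us \<subseteq> carrier V \<Longrightarrow> v \<in> carrier V \<Longrightarrow> \<phi> \<in> graded_dual V G \<Longrightarrow>
      converges_to_rational (length us)
        (\<lambda>zs. sorted_wrt (\<lambda>z w. norm z > norm w) zs \<and> (\<forall>z\<in>set zs. norm z > 0))
        {ks. length ks = length us} (product_term Y \<phi> us v)"
    and iterate_rational: "u1 \<in> carrier V \<Longrightarrow> u2 \<in> carrier V \<Longrightarrow> v \<in> carrier V \<Longrightarrow>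
      \<phi> \<in> graded_dual V G \<Longrightarrow>
      converges_to_rational 2
        (\<lambda>zs. norm (zs ! 1) > norm (zs ! 0 - zs ! 1) \<and> norm (zs ! 0 - zs ! 1) > 0)
        UNIV (\<lambda>zs. iterate_term Y \<phi> u1 u2 v (zs ! 0) (zs ! 1))"
    and associativity: "u1 \<in> carrier V \<Longrightarrow> u2 \<in> carrier V \<Longrightarrow> v \<in> carrier V \<Longrightarrow>
      \<phi> \<in> graded_dual V G \<Longrightarrow>
      norm z1 > norm z2 \<Longrightarrow> norm z2 > norm (z1 - z2) \<Longrightarrow> norm (z1 - z2) > 0 \<Longrightarrow>
      infsum (product_term Y \<phi> [u1, u2] v [z1, z2]) {ks. length ks = 2} =
        infsum (iterate_term Y \<phi> u1 u2 v z1 z2) UNIV"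


section \<open>Tensor algebras\<close>

text \<open>
  Finitely supported functions on the free monoid of words over \<open>'w\<close> form, with the convolution
  product of \<open>Poly_Mapping\<close>, the free complex algebra on the set \<open>'w\<close>. The tensor algebra of a vector
  space \<open>'w\<close> is its quotient by the linearity relations between the generators.
\<close>

datatype 'w word = Word (letters: "'w list")

instantiation word :: (type) monoid_add
begin

definition zero_word :: "'a word" where "0 = Word []"

definition plus_word :: "'a word \<Rightarrow> 'a word \<Rightarrow> 'a word" where
  "u + v = Word (letters u @ letters v)"

instance
  by standard (simp_all add: zero_word_def plus_word_def)

end

type_synonym 'w free_algebra = "'w word \<Rightarrow>\<^sub>0 complex"

definition free_gen :: "'w \<Rightarrow> 'w free_algebra" where
  "free_gen w = Poly_Mapping.single (Word [w]) 1"

definition free_scalar :: "complex \<Rightarrow> 'w free_algebra" where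
  "free_scalar c = Poly_Mapping.single 0 c"

definition tensor_ideal :: "(complex \<Rightarrow> 'w \<Rightarrow> 'w) \<Rightarrow> ('w :: ab_group_add) free_algebra set" where
  "tensor_ideal sc = genideal ring_of_type_algebra
     ({free_gen (x + y) - free_gen x - free_gen y | x y. True} \<union>
      {free_gen (sc c x) - free_scalar c * free_gen x | c x. True})"

definition tensor_algebra ::
  "(complex \<Rightarrow> 'w \<Rightarrow> 'w) \<Rightarrow> ('w :: ab_group_add) free_algebra set ring" where
  "tensor_algebra sc = ring_of_type_algebra Quot tensor_ideal sc"

definition tensor_gen ::
  "(complex \<Rightarrow> 'w \<Rightarrow> 'w) \<Rightarrow> 'w \<Rightarrow> ('w :: ab_group_add) free_algebra set" where
  "tensor_gen sc w = tensor_ideal sc +>\<^bsub>ring_of_type_algebra\<^esub> free_gen w"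

definition tensor_scalar ::
  "(complex \<Rightarrow> 'w \<Rightarrow> 'w) \<Rightarrow> complex \<Rightarrow> ('w :: ab_group_add) free_algebra set" where
  "tensor_scalar sc c = tensor_ideal sc +>\<^bsub>ring_of_type_algebra\<^esub> free_scalar c"


section \<open>The algebra \<open>N\<close>, the module \<open>V\<close> and its vertex operator map\<close>

datatype species = Bos | Fer

text \<open>
  An element of the big space is a triple \<open>(f, x, y)\<close>, standing for
  \<open>\<Sum> f (s, k) \<otimes> t\<^bsup>k + |s|/2\<^esup> + x \<^bold>k\<^sub>B + y \<^bold>k\<^sub>F\<close>, where \<open>|Bos| = 0\<close> and \<open>|Fer| = 1\<close>, and \<open>f (s, k)\<close>
  is taken in the copy of the base space of species \<open>s\<close>.
\<close>

type_synonym 'h hhat = "((species \<times> int) \<Rightarrow>\<^sub>0 'h) \<times> complex \<times> complex"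

definition hhat_scale :: "(complex \<Rightarrow> 'h \<Rightarrow> 'h) \<Rightarrow> complex \<Rightarrow> ('h :: ab_group_add) hhat \<Rightarrow> 'h hhat" where
  "hhat_scale sc c = (\<lambda>(f, x, y). (Poly_Mapping.map (sc c) f, c * x, c * y))"

locale bilinear_form_space = finite_dimensional_vector_space scale Basis
  for scale :: "complex \<Rightarrow> 'h :: ab_group_add \<Rightarrow> 'h" and Basis :: "'h set" +
  fixes form :: "'h \<Rightarrow> 'h \<Rightarrow> complex" and lB lF :: complex
  assumes form_linear: "Vector_Spaces.linear scale (*) (form a)"
    and form_sym: "form a b = form b a"
    and form_nondegenerate: "(\<And>b. form a b = 0) \<Longrightarrow> a = 0"
    and lB_nonzero: "lB \<noteq> 0"
    and lF_nonzero: "lF \<noteq> 0"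
begin

definition T :: "'h hhat free_algebra set ring" where
  "T = tensor_algebra (hhat_scale scale)"

definition t_mode :: "species \<Rightarrow> 'h \<Rightarrow> int \<Rightarrow> 'h hhat free_algebra set" where
  "t_mode s a k = tensor_gen (hhat_scale scale) (Poly_Mapping.single (s, k) a, 0, 0)"

definition t_kB :: "'h hhat free_algebra set" where
  "t_kB = tensor_gen (hhat_scale scale) (0, 1, 0)"

definition t_kF :: "'h hhat free_algebra set" where
  "t_kF = tensor_gen (hhat_scale scale) (0, 0, 1)"

definition t_scalar :: "complex \<Rightarrow> 'h hhat free_algebra set" where
  "t_scalar c = tensor_scalar (hhat_scale scale) c"

text \<open>The graded commutator of \<open>u\<close> and \<open>v\<close>; the flags say whether \<open>u\<close>, respectively \<open>v\<close>, is odd.\<close>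

definition gcomm ::
  "bool \<Rightarrow> bool \<Rightarrow> 'h hhat free_algebra set \<Rightarrow> 'h hhat free_algebra set \<Rightarrow> 'h hhat free_algebra set"
where
  "gcomm odd_u odd_v u v =
     (if odd_u \<and> odd_v then u \<otimes>\<^bsub>T\<^esub> v \<oplus>\<^bsub>T\<^esub> v \<otimes>\<^bsub>T\<^esub> u else u \<otimes>\<^bsub>T\<^esub> v \<ominus>\<^bsub>T\<^esub> v \<otimes>\<^bsub>T\<^esub> u)"

inductive_set N_relations :: "'h hhat free_algebra set set" where
  kB_kF: "gcomm False False t_kB t_kF \<in> N_relations"
| mode_kB: "gcomm (s = Fer) False (t_mode s a k) t_kB \<in> N_relations"
| mode_kF: "gcomm (s = Fer) False (t_mode s a k) t_kF \<in> N_relations"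
| B_zero: "k \<noteq> 0 \<Longrightarrow> gcomm False False (t_mode Bos a k) (t_mode Bos b 0) \<in> N_relations"
| F_zero: "gcomm True False (t_mode Fer a k) (t_mode Bos b 0) \<in> N_relations"
| B_B: "m > 0 \<Longrightarrow> n < 0 \<Longrightarrow>
    gcomm False False (t_mode Bos a m) (t_mode Bos b n)
      \<ominus>\<^bsub>T\<^esub> t_scalar (of_int m * form a b * (if m + n = 0 then 1 else 0)) \<otimes>\<^bsub>T\<^esub> t_kB \<in> N_relations"
| F_F: "m \<ge> 0 \<Longrightarrow> n < 0 \<Longrightarrow>
    gcomm True True (t_mode Fer a m) (t_mode Fer b n)
      \<ominus>\<^bsub>T\<^esub> t_scalar (form a b * (if m + n + 1 = 0 then 1 else 0)) \<otimes>\<^bsub>T\<^esub> t_kF \<in> N_relations"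
| B_F: "(m > 0 \<and> n < 0) \<or> (m < 0 \<and> n \<ge> 0) \<Longrightarrow>
    gcomm False True (t_mode Bos a m) (t_mode Fer b n) \<in> N_relations"

definition N_ideal :: "'h hhat free_algebra set set" where
  "N_ideal = genideal T N_relations"

definition N :: "'h hhat free_algebra set set ring" where
  "N = T Quot N_ideal"

definition n_mode :: "species \<Rightarrow> 'h \<Rightarrow> int \<Rightarrow> 'h hhat free_algebra set set" where
  "n_mode s a k = N_ideal +>\<^bsub>T\<^esub> t_mode s a k"

definition n_kB :: "'h hhat free_algebra set set" where
  "n_kB = N_ideal +>\<^bsub>T\<^esub> t_kB"

definition n_kF :: "'h hhat free_algebra set set" where
  "n_kF = N_ideal +>\<^bsub>T\<^esub> t_kF"

definition n_scalar :: "complex \<Rightarrow> 'h hhat free_algebra set set" where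
  "n_scalar c = N_ideal +>\<^bsub>T\<^esub> t_scalar c"

text \<open>
  \<open>vac_action h c\<close> says that \<open>h\<close> lies in the subalgebra \<open>N\<^sub>\<ge>\<^sub>0\<close> and acts as the scalar \<open>c\<close> on \<open>\<complex>\<one>\<close>:
  the domain of this relation is the subalgebra generated by the nonnegative modes and the two
  central elements.
\<close>

inductive vac_action :: "'h hhat free_algebra set set \<Rightarrow> complex \<Rightarrow> bool" where
  mode: "n \<ge> 0 \<Longrightarrow> vac_action (n_mode s a n) 0"
| kB: "vac_action n_kB lB"
| kF: "vac_action n_kF lF"
| scalar: "vac_action (n_scalar c) c"
| add: "vac_action g c \<Longrightarrow> vac_action h d \<Longrightarrow> vac_action (g \<oplus>\<^bsub>N\<^esub> h) (c + d)"
| mult: "vac_action g c \<Longrightarrow> vac_action h d \<Longrightarrow> vac_action (g \<otimes>\<^bsub>N\<^esub> h) (c * d)"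

text \<open>
  The kernel of \<open>N = N \<otimes>\<^sub>\<complex> \<complex>\<one> \<rightarrow> N \<otimes>\<^bsub>N\<^sub>\<ge>\<^sub>0\<^esub> \<complex>\<one>\<close>: the additive span of all \<open>y h \<otimes> \<one> - y \<otimes> h \<one>\<close>
  with \<open>h \<in> N\<^sub>\<ge>\<^sub>0\<close>.
\<close>

definition V_kernel :: "'h hhat free_algebra set set set" where
  "V_kernel = generate (add_monoid N)
     {y \<otimes>\<^bsub>N\<^esub> h \<ominus>\<^bsub>N\<^esub> y \<otimes>\<^bsub>N\<^esub> n_scalar c | y h c. y \<in> carrier N \<and> vac_action h c}"

definition N_act ::
  "'h hhat free_algebra set set \<Rightarrow> 'h hhat free_algebra set set set \<Rightarrow> 'h hhat free_algebra set set set"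
where
  "N_act y v = (\<Union>x\<in>v. V_kernel +>\<^bsub>N\<^esub> (y \<otimes>\<^bsub>N\<^esub> x))"

text \<open>The fields \<open>mult\<close> and \<open>one\<close> of the record play no role in a module.\<close>

definition V :: "(complex, 'h hhat free_algebra set set set) module" where
  "V = \<lparr>carrier = a_rcosets\<^bsub>N\<^esub> V_kernel, monoid.mult = undefined, one = undefined,
        ring.zero = V_kernel, ring.add = set_add N, smult = (\<lambda>c. N_act (n_scalar c))\<rparr>"

definition vac :: "'h hhat free_algebra set set set" where
  "vac = V_kernel +>\<^bsub>N\<^esub> \<one>\<^bsub>N\<^esub>"

text \<open>\<open>mode_op (s, a, k)\<close> is the operator \<open>a(k + |a|/2)\<close> on \<open>V\<close> for \<open>a\<close> in the copy of species \<open>s\<close>.\<close>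

fun mode_op ::
  "species \<times> 'h \<times> int \<Rightarrow> 'h hhat free_algebra set set set \<Rightarrow> 'h hhat free_algebra set set set" where
  "mode_op (s, a, k) = N_act (n_mode s a k)"

text \<open>
  The list of the \<open>(s\<^sub>i, a\<^sub>i, m\<^sub>i)\<close>, all \<open>m\<^sub>i > 0\<close>, stands for the spanning vector
  \<open>a\<^sub>1(-m\<^sub>1 + |a\<^sub>1|/2) \<cdots> a\<^sub>r(-m\<^sub>r + |a\<^sub>r|/2)\<one>\<close>.
\<close>

definition spanning_words :: "(species \<times> 'h \<times> nat) list set" where
  "spanning_words = {ws. \<forall>(s, a, m)\<in>set ws. m > 0}"

definition word_vec :: "(species \<times> 'h \<times> nat) list \<Rightarrow> 'h hhat free_algebra set set set" where
  "word_vec ws = foldr (\<lambda>(s, a, m). mode_op (s, a, - int m)) ws vac"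

definition word_weight :: "(species \<times> 'h \<times> nat) list \<Rightarrow> rat" where
  "word_weight ws = (\<Sum>(s, a, m)\<leftarrow>ws. of_nat m - (if s = Fer then 1 / 2 else 0))"

definition V_grade :: "rat \<Rightarrow> 'h hhat free_algebra set set set set" where
  "V_grade n = generate (add_monoid V)
     {c \<odot>\<^bsub>V\<^esub> word_vec ws | c ws. ws \<in> spanning_words \<and> word_weight ws = n}"

text \<open>
  Negative modes come first, then positive modes, then zero modes; the mode \<open>(Fer, a, 0)\<close>, that is
  \<open>a(1/2)\<close>, is positive. \<^const>\<open>sort_key\<close> is stable, so the order inside each group is kept.
  The sign of the induced permutation of the fermionic factors is computed from its inversions.
\<close>

fun mode_rank :: "species \<times> 'h \<times> int \<Rightarrow> nat" where
  "mode_rank (s, a, k) = (if k < 0 then 0 else if s = Bos \<and> k = 0 then 2 else 1)"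

definition normal_sign :: "(species \<times> 'h \<times> int) list \<Rightarrow> complex" where
  "normal_sign ms = (- 1) ^ card {(i, j). i < j \<and> j < length ms \<and>
     fst (ms ! i) = Fer \<and> fst (ms ! j) = Fer \<and> mode_rank (ms ! i) > mode_rank (ms ! j)}"

definition normal_ordered ::
  "(species \<times> 'h \<times> int) list \<Rightarrow> 'h hhat free_algebra set set set \<Rightarrow> 'h hhat free_algebra set set set"
where
  "normal_ordered ms v = normal_sign ms \<odot>\<^bsub>V\<^esub> foldr mode_op (sort_key mode_rank ms) v"

text \<open>
  Coefficients of \<open>:a\<^sub>1\<^bsup>(m\<^sub>1 - 1)\<^esup>(x) \<cdots> a\<^sub>r\<^bsup>(m\<^sub>r - 1)\<^esup>(x):\<close>. Since
  \<open>(1/j!) (d/dx)\<^sup>j x\<^sup>e = (e gchoose j) x\<^bsup>e - j\<^esup>\<close>, the mode \<open>a(n + |a|/2)\<close> occurs in \<open>a\<^bsup>(m - 1)\<^esup>(x)\<close>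
  with coefficient \<open>(-n - 1) gchoose (m - 1)\<close> and exponent \<open>-n - m\<close>. On a given vector only finitely
  many terms contribute to each power of \<open>x\<close>, and the sum ranges over these.
\<close>

definition field_product_term ::
  "(species \<times> 'h \<times> nat) list \<Rightarrow> 'h hhat free_algebra set set set \<Rightarrow> int list \<Rightarrow>
    'h hhat free_algebra set set set"
where
  "field_product_term ws v ns =
     (\<Prod>i<length ws. of_int (- (ns ! i) - 1) gchoose (snd (snd (ws ! i)) - 1)) \<odot>\<^bsub>V\<^esub>
       normal_ordered (map2 (\<lambda>(s, a, m) n. (s, a, n)) ws ns) v"

definition field_product ::
  "(species \<times> 'h \<times> nat) list \<Rightarrow> int \<Rightarrow> 'h hhat free_algebra set set set \<Rightarrow>
    'h hhat free_algebra set set set"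
where
  "field_product ws p v = finsum V (field_product_term ws v)
     {ns. length ns = length ws \<and> (\<Sum>i<length ws. - (ns ! i) - int (snd (snd (ws ! i)))) = p \<and>
          field_product_term ws v ns \<noteq> \<zero>\<^bsub>V\<^esub>}"

text \<open>
  \<open>Y(u, x)v\<close> is the map linear in \<open>u\<close> with the prescribed values on the spanning vectors; these
  conditions determine it for all \<open>u\<close> and \<open>v\<close> in \<open>V\<close>.
\<close>

definition is_vertex_map ::
  "('h hhat free_algebra set set set \<Rightarrow> int \<Rightarrow>
    'h hhat free_algebra set set set \<Rightarrow> 'h hhat free_algebra set set set) \<Rightarrow> bool"
where
  "is_vertex_map Y \<longleftrightarrow>
     (\<forall>p. \<forall>v\<in>carrier V.
        (\<forall>u\<in>carrier V. Y u p v \<in> carrier V) \<and>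
        (\<forall>u\<in>carrier V. \<forall>u'\<in>carrier V. Y (u \<oplus>\<^bsub>V\<^esub> u') p v = Y u p v \<oplus>\<^bsub>V\<^esub> Y u' p v) \<and>
        (\<forall>c. \<forall>u\<in>carrier V. Y (c \<odot>\<^bsub>V\<^esub> u) p v = c \<odot>\<^bsub>V\<^esub> Y u p v) \<and>
        (\<forall>ws\<in>spanning_words. Y (word_vec ws) p v = field_product ws p v))"

definition vertex_map ::
  "'h hhat free_algebra set set set \<Rightarrow> int \<Rightarrow>
    'h hhat free_algebra set set set \<Rightarrow> 'h hhat free_algebra set set set"
where
  "vertex_map = (SOME Y. is_vertex_map Y)"

end

end

(*
  The algebra N acts on the free vector space on words in letters a(-m+|a|/2): negative modes prepend a
  letter, nonnegative modes act as superderivations killing the empty word, zero modes by 0. The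
  nonnegative modes supercommute in this representation although N does not force them to.
  Comparing kernels identifies V with the span of the words over a basis of h, so that two vectors
  of V are equal as soon as their images are, and everything can be computed on words.

  On words the normally ordered product obeys
    :a(x) A: = a^-(x) :A: + (sign) :A: a^+(x),
  with a^-, a^+ the negative and nonnegative parts of the field, from which the bracket formulas for
  d and D follow by induction. For a matrix coefficient of a product of such fields, the negative
  part of the first letter contributes finitely many modes because the functional is bounded; the
  nonnegative part is moved to the right through the other fields, where it finally contributes
  finitely many modes as well, and each letter it passes yields a contraction, a multiple of
  (z_i - z_j)^(-k), times a shorter product. Induction on the number of letters gives absolute
  convergence and rationality. Taylor expansion about z_2 shows that the iterate satisfies the same
  recursion in its own region, so product and iterate converge to the same rational function.
*)

theory Submission
  imports Defs
begin

section \<open>Linear maps on spaces of words\<close>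

text \<open>The axioms sum over exponents of the variables, but signs and contractions live on
  individual modes. All limits are therefore proved over lists of modes and collected by exponent
  only afterwards; unordered summation permits this regrouping, and over the complex numbers it
  amounts to absolute convergence. The induction runs because the functionals form a class closed
  under composition with modes (\<open>bounded_linfun\<close>): a negative mode at the far left is
  absorbed into the functional, a nonnegative one at the far right into the vector. Each limit lemma
  yields a function \<open>f\<close> fixed before the points are chosen, so product and iterate
  receive the same \<open>f\<close> inside a single induction, without analytic continuation. A word
  remembers its letters, whereas V is linear in them. Hence creation expands letters in a basis, the
  field of a word is insensitive to this expansion, and the identification with V holds on
  \<open>basis_span\<close>.\<close>

type_synonym 'h letter = "species \<times> 'h \<times> nat"

text \<open>
  The letter \<open>(s, a, j)\<close> stands for the mode \<open>a(-j - 1 + |a|/2)\<close> with \<open>a\<close> in the copy of species \<open>s\<close>.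
  The words are not linear in \<open>a\<close>; \<open>V\<close> corresponds to the words over a basis, see \<open>create\<close> and
  \<open>basis_span\<close>.
\<close>

type_synonym 'h fock = "'h letter list \<Rightarrow>\<^sub>0 complex"

definition smul :: "complex \<Rightarrow> ('a \<Rightarrow>\<^sub>0 complex) \<Rightarrow> 'a \<Rightarrow>\<^sub>0 complex" where
  "smul c m = Poly_Mapping.map ((*) c) m"

lemma lookup_smul [simp]: "Poly_Mapping.lookup (smul c m) w = c * Poly_Mapping.lookup m w"
  by (simp add: smul_def Poly_Mapping.map.rep_eq when_def)

interpretation smul: Modules.module "smul :: complex \<Rightarrow> ('a \<Rightarrow>\<^sub>0 complex) \<Rightarrow> _"
  by standard (auto intro!: poly_mapping_eqI simp: lookup_add algebra_simps)

abbreviation bv :: "'a \<Rightarrow> 'a \<Rightarrow>\<^sub>0 complex" where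
  "bv w \<equiv> Poly_Mapping.single w 1"

lemma smul_single: "smul c (Poly_Mapping.single w d) = Poly_Mapping.single w (c * d)"
  by (rule poly_mapping_eqI) (simp add: lookup_single when_def)

definition linmap :: "(('a \<Rightarrow>\<^sub>0 complex) \<Rightarrow> 'b \<Rightarrow>\<^sub>0 complex) \<Rightarrow> bool" where
  "linmap f \<longleftrightarrow> (\<forall>x y. f (x + y) = f x + f y) \<and> (\<forall>c x. f (smul c x) = smul c (f x))"

definition linfun :: "(('a \<Rightarrow>\<^sub>0 complex) \<Rightarrow> complex) \<Rightarrow> bool" where
  "linfun f \<longleftrightarrow> (\<forall>x y. f (x + y) = f x + f y) \<and> (\<forall>c x. f (smul c x) = c * f x)"

lemma linmap_add: "linmap f \<Longrightarrow> f (x + y) = f x + f y"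
  and linmap_smul: "linmap f \<Longrightarrow> f (smul c x) = smul c (f x)"
  by (simp_all add: linmap_def)

lemma linmap_zero: "linmap f \<Longrightarrow> f 0 = 0"
  using linmap_smul[of f 0 0] by simp

lemma linmap_minus: "linmap f \<Longrightarrow> f (- x) = - f x"
  using linmap_smul[of f "-1" x] by simp

lemma linmap_diff: "linmap f \<Longrightarrow> f (x - y) = f x - f y"
  using linmap_add[of f x "- y"] linmap_minus[of f y] by simp

lemma linmap_sum: "linmap f \<Longrightarrow> f (sum g S) = (\<Sum>x\<in>S. f (g x))"
  by (induct S rule: infinite_finite_induct) (auto simp: linmap_zero linmap_add)

lemma linfun_add: "linfun f \<Longrightarrow> f (x + y) = f x + f y"
  and linfun_smul: "linfun f \<Longrightarrow> f (smul c x) = c * f x"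
  by (simp_all add: linfun_def)

lemma linfun_zero: "linfun f \<Longrightarrow> f 0 = 0"
  using linfun_smul[of f 0 0] by simp

lemma linfun_sum: "linfun f \<Longrightarrow> f (sum g S) = (\<Sum>x\<in>S. f (g x))"
  by (induct S rule: infinite_finite_induct) (auto simp: linfun_zero linfun_add)

lemma linfun_comp: "linfun \<phi> \<Longrightarrow> linmap f \<Longrightarrow> linfun (\<lambda>m. \<phi> (f m))"
  by (simp add: linfun_def linmap_def)

named_theorems linmap_intros

lemma linmap_id [linmap_intros]: "linmap (\<lambda>m. m)"
  and linmap_const_zero [linmap_intros]: "linmap (\<lambda>m. 0)"
  and linmap_plusI [linmap_intros]: "linmap f \<Longrightarrow> linmap g \<Longrightarrow> linmap (\<lambda>m. f m + g m)"
  and linmap_minusI [linmap_intros]: "linmap f \<Longrightarrow> linmap g \<Longrightarrow> linmap (\<lambda>m. f m - g m)"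
  and linmap_smulI [linmap_intros]: "linmap f \<Longrightarrow> linmap (\<lambda>m. smul c (f m))"
  by (auto simp: linmap_def smul.scale_right_distrib smul.scale_right_diff_distrib mult.commute)

lemma linmap_sumI [linmap_intros]: "(\<And>i. i \<in> S \<Longrightarrow> linmap (f i)) \<Longrightarrow> linmap (\<lambda>m. \<Sum>i\<in>S. f i m)"
  by (induct S rule: infinite_finite_induct) (auto intro!: linmap_intros)

lemma linmap_ifI [linmap_intros]: "linmap f \<Longrightarrow> linmap g \<Longrightarrow> linmap (\<lambda>m. if P then f m else g m)"
  by (cases P) simp_all

lemma linmap_comp: "linmap g \<Longrightarrow> linmap f \<Longrightarrow> linmap (\<lambda>m. g (f m))"
  by (simp add: linmap_def)

definition lin :: "('a \<Rightarrow> 'b \<Rightarrow>\<^sub>0 complex) \<Rightarrow> ('a \<Rightarrow>\<^sub>0 complex) \<Rightarrow> 'b \<Rightarrow>\<^sub>0 complex" where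
  "lin f m = (\<Sum>w\<in>Poly_Mapping.keys m. smul (Poly_Mapping.lookup m w) (f w))"

lemma lin_superset:
  "finite S \<Longrightarrow> Poly_Mapping.keys m \<subseteq> S \<Longrightarrow> lin f m = (\<Sum>w\<in>S. smul (Poly_Mapping.lookup m w) (f w))"
  unfolding lin_def by (rule sum.mono_neutral_left) (auto simp: in_keys_iff)

lemma keys_smul: "Poly_Mapping.keys (smul c m) \<subseteq> Poly_Mapping.keys m"
  by (auto simp: in_keys_iff)

lemma linmap_lin: "linmap (lin f)"
  unfolding linmap_def
proof (intro conjI allI)
  fix x y :: "'a \<Rightarrow>\<^sub>0 complex" and c
  let ?S = "Poly_Mapping.keys x \<union> Poly_Mapping.keys y"
  have "lin f (x + y) = (\<Sum>w\<in>?S. smul (Poly_Mapping.lookup (x + y) w) (f w))"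
    by (rule lin_superset) (use Poly_Mapping.keys_add[of x y] in auto)
  then show "lin f (x + y) = lin f x + lin f y"
    by (simp add: lin_superset[of ?S x] lin_superset[of ?S y] lookup_add smul.scale_left_distrib sum.distrib)
  show "lin f (smul c x) = smul c (lin f x)"
    by (subst lin_superset[OF finite_keys keys_smul]) (simp add: lin_def smul.scale_sum_right)
qed

lemma lin_zero [simp]: "lin f 0 = 0"
  by (simp add: lin_def)

lemma linmap_linI [linmap_intros]: "linmap f \<Longrightarrow> linmap (\<lambda>m. lin g (f m))"
  by (rule linmap_comp[OF linmap_lin])

lemma lin_bv [simp]: "lin f (bv w) = f w"
  by (simp add: lin_def)

lemma bv_expansion: "m = (\<Sum>w\<in>Poly_Mapping.keys m. smul (Poly_Mapping.lookup m w) (bv w))"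
  by (rule poly_mapping_eqI) (auto simp: lookup_sum lookup_single when_def in_keys_iff if_distrib cong: if_cong)

lemma linmap_expand: "linmap f \<Longrightarrow> f m = (\<Sum>w\<in>Poly_Mapping.keys m. smul (Poly_Mapping.lookup m w) (f (bv w)))"
  by (rule trans[OF arg_cong[OF bv_expansion[of m], of f]]) (simp add: linmap_sum linmap_smul)

lemma linfun_expand: "linfun f \<Longrightarrow> f m = (\<Sum>w\<in>Poly_Mapping.keys m. Poly_Mapping.lookup m w * f (bv w))"
  by (rule trans[OF arg_cong[OF bv_expansion[of m], of f]]) (simp add: linfun_sum linfun_smul)

lemma linmap_eqI:
  assumes "linmap f" "linmap g" "\<And>w. w \<in> Poly_Mapping.keys m \<Longrightarrow> f (bv w) = g (bv w)"
  shows "f m = g m"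
  by (rule trans[OF linmap_expand[OF assms(1)] trans[OF _ linmap_expand[OF assms(2), symmetric]]]) (simp add: assms(3) cong: sum.cong)

lemma linfun_eq_zeroI:
  assumes "linfun f" "\<And>w. w \<in> Poly_Mapping.keys m \<Longrightarrow> f (bv w) = 0"
  shows "f m = 0"
  by (rule trans[OF linfun_expand[OF assms(1)]]) (simp add: assms(2) cong: sum.cong)

definition prepend :: "'l \<Rightarrow> ('l list \<Rightarrow>\<^sub>0 complex) \<Rightarrow> 'l list \<Rightarrow>\<^sub>0 complex" where
  "prepend l = lin (\<lambda>w. bv (l # w))"

lemma prepend_bv [simp]: "prepend l (bv w) = bv (l # w)"
  by (simp add: prepend_def)

lemma linmap_prepend [linmap_intros]: "linmap f \<Longrightarrow> linmap (\<lambda>m. prepend l (f m))"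
  unfolding prepend_def by (intro linmap_intros)

text \<open>Induction on words in linear form: the step is stated for an arbitrary vector
  \<open>x\<close>, so that commutation rules for \<open>prepend\<close> apply as they stand,
  without descending to single words.\<close>

lemma linmap_list_eqI:
  assumes "linmap f" "linmap g" "f (bv []) = g (bv [])"
    and step: "\<And>l x. f x = g x \<Longrightarrow> f (prepend l x) = g (prepend l x)"
  shows "f m = g m"
proof (rule linmap_eqI[OF assms(1,2)])
  fix w
  show "f (bv w) = g (bv w)"
    by (induct w) (use assms(3) step[of "bv _"] in simp_all)
qed

definition ksign :: "species \<Rightarrow> species \<Rightarrow> complex" where
  "ksign s t = (if s = Fer \<and> t = Fer then - 1 else 1)"

text \<open>The Koszul sign for carrying an object of species \<open>s\<close> past a whole list.
  The second component is polymorphic because the list may consist of letters or of modes.\<close>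

definition ksigns :: "species \<Rightarrow> (species \<times> 'x) list \<Rightarrow> complex" where
  "ksigns s ws = (\<Prod>x\<leftarrow>ws. ksign s (fst x))"

lemma ksigns_simps [simp]: "ksigns s [] = 1" "ksigns s (x # ws) = ksign s (fst x) * ksigns s ws"
  "ksigns s (ws @ vs) = ksigns s ws * ksigns s vs"
  by (simp_all add: ksigns_def)

lemma ksign_sq [simp]: "ksign s t * ksign s t = 1" "ksign s t * (ksign s t * c) = c"
  by (auto simp: ksign_def)

lemma ksign_commute: "ksign s t = ksign t s"
  by (auto simp: ksign_def)

section \<open>The Fock representation\<close>

context bilinear_form_space
begin

text \<open>
  The scalar by which the supercommutator of \<open>a(n + |a|/2)\<close> with the letter \<open>(t, b, j)\<close> acts.
\<close>

definition pairing :: "species \<Rightarrow> 'h \<Rightarrow> nat \<Rightarrow> species \<Rightarrow> 'h \<Rightarrow> nat \<Rightarrow> complex" where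
  "pairing s a n t b j = (if s \<noteq> t then 0 else
     case s of Bos \<Rightarrow> (if n = Suc j then of_nat n * form a b * lB else 0)
             | Fer \<Rightarrow> (if n = j then form a b * lF else 0))"

text \<open>Putting the letter \<open>(s, a, j)\<close> itself in front would not be additive in
  \<open>a\<close>, and the linearity relations of the tensor algebra would fail; the basis
  expansion repairs this.\<close>

definition create :: "species \<Rightarrow> 'h \<Rightarrow> nat \<Rightarrow> 'h fock \<Rightarrow> 'h fock" where
  "create s a j m = (\<Sum>b\<in>Basis. smul (representation Basis a b) (prepend (s, b, j) m))"

fun annih_word :: "species \<Rightarrow> 'h \<Rightarrow> nat \<Rightarrow> 'h letter list \<Rightarrow> 'h fock" where
  "annih_word s a n [] = 0"
| "annih_word s a n ((t, b, j) # w) = smul (pairing s a n t b j) (bv w) + smul (ksign s t) (prepend (t, b, j) (annih_word s a n w))"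

definition annih :: "species \<Rightarrow> 'h \<Rightarrow> nat \<Rightarrow> 'h fock \<Rightarrow> 'h fock" where
  "annih s a n = lin (annih_word s a n)"

definition fmode :: "species \<Rightarrow> 'h \<Rightarrow> int \<Rightarrow> 'h fock \<Rightarrow> 'h fock" where
  "fmode s a k = (if k < 0 then create s a (nat (- k - 1)) else annih s a (nat k))"

lemma linmap_create [linmap_intros]: "linmap f \<Longrightarrow> linmap (\<lambda>m. create s a j (f m))"
  unfolding create_def by (intro linmap_intros)

lemma linmap_annih [linmap_intros]: "linmap f \<Longrightarrow> linmap (\<lambda>m. annih s a n (f m))"
  unfolding annih_def by (intro linmap_intros)

lemma linmap_fmode [linmap_intros]: "linmap f \<Longrightarrow> linmap (\<lambda>m. fmode s a k (f m))"
  unfolding fmode_def by (cases "k < 0") (auto intro: linmap_intros)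

lemmas linmap_create' = linmap_create[OF linmap_id] and linmap_annih' = linmap_annih[OF linmap_id] and linmap_fmode' = linmap_fmode[OF linmap_id]
  and linmap_prepend' = linmap_prepend[OF linmap_id]

lemma form_add: "form a (x + y) = form a x + form a y" "form (x + y) a = form x a + form y a"
  and form_scale: "form a (scale c x) = c * form a x" "form (scale c x) a = c * form x a"
  using form_linear[of a] by (auto simp: Vector_Spaces.linear_def Modules.module_hom_iff form_sym[of _ a])

lemma form_sum: "form a (sum f S) = (\<Sum>x\<in>S. form a (f x))"
proof -
  have "form a 0 = 0" using form_scale(1)[of a 0 0] by simp
  then show ?thesis by (induct S rule: infinite_finite_induct) (auto simp: form_add)
qed

lemma rep_add: "representation Basis (a + b) x = representation Basis a x + representation Basis b x"
  and rep_scale: "representation Basis (scale c a) x = c * representation Basis a x"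
  by (simp_all add: representation_add representation_scale independent_Basis span_Basis)

lemma rep_sum: "(\<Sum>b\<in>Basis. scale (representation Basis a b) b) = a"
  by (rule sum_representation_eq) (auto simp: independent_Basis span_Basis finite_Basis)

lemma rep_Basis: "b \<in> Basis \<Longrightarrow> representation Basis b x = (if x = b then 1 else 0)"
  by (simp add: representation_basis independent_Basis)

lemma form_rep: "(\<Sum>c\<in>Basis. representation Basis b c * form a c) = form a b"
  using arg_cong[OF rep_sum[of b], of "form a"] by (simp add: form_sum form_scale)

lemma pairing_add: "pairing s (a + a') n t b j = pairing s a n t b j + pairing s a' n t b j"
  and pairing_scale: "pairing s (scale c a) n t b j = c * pairing s a n t b j"
  by (auto simp: pairing_def form_add form_scale algebra_simps split: species.split)

text \<open>Contracting with the basis expansion of \<open>b\<close> is contracting with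
  \<open>b\<close>. This is why \<open>annih_create\<close> has the same shape as
  \<open>annih_prepend\<close>.\<close>

lemma pairing_rep: "(\<Sum>c\<in>Basis. representation Basis b c * pairing s a n t c j) = pairing s a n t b j"
proof -
  have "(\<Sum>c\<in>Basis. representation Basis b c * (k * form a c * l)) = k * form a b * l" for k l
    by (simp flip: form_rep[of b a] add: sum_distrib_left sum_distrib_right algebra_simps)
  from this[of "of_nat n" lB] this[of 1 lF] show ?thesis
    by (cases s; cases t) (auto simp: pairing_def)
qed

lemma pairing_ksign: "s = t \<or> pairing s a n t b j = 0"
  by (auto simp: pairing_def)

lemma create_add: "create s (a + b) j m = create s a j m + create s b j m"
  by (simp add: create_def rep_add smul.scale_left_distrib sum.distrib)

lemma create_scale: "create s (scale c a) j m = smul c (create s a j m)"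
  by (simp add: create_def rep_scale smul.scale_sum_right)

lemma create_Basis: "b \<in> Basis \<Longrightarrow> create s b j m = prepend (s, b, j) m"
proof -
  assume b: "b \<in> Basis"
  then have "create s b j m = (\<Sum>x\<in>Basis. if x = b then prepend (s, x, j) m else 0)"
    unfolding create_def by (intro sum.cong) (auto simp: rep_Basis)
  then show ?thesis using b by (simp add: finite_Basis)
qed

lemma annih_word_add: "annih_word s (a + b) n w = annih_word s a n w + annih_word s b n w"
  by (induct w) (auto simp: pairing_add smul.scale_left_distrib smul.scale_right_distrib linmap_add[OF linmap_prepend'] algebra_simps)

lemma annih_word_scale: "annih_word s (scale c a) n w = smul c (annih_word s a n w)"
  by (induct w) (auto simp: pairing_scale smul.scale_right_distrib linmap_smul[OF linmap_prepend'] mult.commute)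

lemma annih_add: "annih s (a + b) n m = annih s a n m + annih s b n m"
  by (rule linmap_eqI[where m=m]) (auto intro!: linmap_intros simp: annih_def annih_word_add)

lemma annih_scale: "annih s (scale c a) n m = smul c (annih s a n m)"
  by (rule linmap_eqI[where m=m]) (auto intro!: linmap_intros simp: annih_def annih_word_scale)

lemma fmode_add: "fmode s (a + b) k m = fmode s a k m + fmode s b k m"
  and fmode_scale: "fmode s (scale c a) k m = smul c (fmode s a k m)"
  by (simp_all add: fmode_def create_add annih_add create_scale annih_scale)

lemma fmode_zero: "fmode s 0 k m = 0"
  using fmode_scale[of s 0 0 k m] by simp

lemma annih_prepend: "annih s a n (prepend (t, b, j) m) = smul (pairing s a n t b j) m + smul (ksign s t) (prepend (t, b, j) (annih s a n m))"
  by (rule linmap_eqI[where m=m]) (auto intro!: linmap_intros simp: annih_def)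

lemma annih_Nil [simp]: "annih s a n (bv []) = 0"
  by (simp add: annih_def)

lemma annih_create: "annih s a n (create t b j m) = smul (pairing s a n t b j) m + smul (ksign s t) (create t b j (annih s a n m))"
proof -
  have "annih s a n (create t b j m) = (\<Sum>c\<in>Basis. smul (representation Basis b c * pairing s a n t c j) m)
     + smul (ksign s t) (create t b j (annih s a n m))"
    by (simp add: create_def linmap_sum[OF linmap_annih'] linmap_smul[OF linmap_annih'] annih_prepend smul.scale_right_distrib
        sum.distrib smul.scale_sum_right mult.commute)
  then show ?thesis by (simp add: pairing_rep flip: smul.scale_sum_left)
qed

text \<open>Two superderivations: passing both through a letter yields the same two contraction
  terms in either order. Their signs agree because a nonzero pairing forces equal species, which is
  what the facts 1 to 3 express.\<close>

lemma annih_annih: "annih s a n (annih t b k m) = smul (ksign s t) (annih t b k (annih s a n m))"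
proof (rule linmap_list_eqI[where m = m])
  fix l :: "'h letter" and x :: "'h fock"
  assume IH: "annih s a n (annih t b k x) = smul (ksign s t) (annih t b k (annih s a n x))"
  obtain r c j where l: "l = (r, c, j)" by (cases l)
  have 1: "ksign s t * pairing t b k r c j = ksign s r * pairing t b k r c j" using pairing_ksign[of t r b k c j] by auto
  have 2: "ksign s t * pairing s a n r c j = ksign t r * pairing s a n r c j"
    using pairing_ksign[of s r a n c j] by (auto simp: ksign_commute)
  have 3: "ksign s r * (ksign s t * pairing t b k r c j) = pairing t b k r c j" using pairing_ksign[of t r b k c j] by auto
  show "annih s a n (annih t b k (prepend l x)) = smul (ksign s t) (annih t b k (annih s a n (prepend l x)))"
    unfolding l annih_prepend linmap_add[OF linmap_annih'] linmap_smul[OF linmap_annih'] smul.scale_right_distrib IH smul.scale_scale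
      linmap_smul[OF linmap_prepend'] 1 2
    by (simp add: mult_ac add_ac 3)
qed (auto intro!: linmap_intros simp: linmap_zero[OF linmap_annih'])

text \<open>The bosonic pairing asks for \<open>n = Suc j\<close>, so the zero mode contracts with
  no letter.\<close>

lemma annih_Bos_0 [simp]: "annih Bos a 0 m = 0"
proof -
  have "annih_word Bos a 0 w = 0" for w
    by (induct w) (auto simp: pairing_def linmap_zero[OF linmap_prepend'])
  then show ?thesis by (simp add: annih_def lin_def)
qed

text \<open>
  \<open>fderivation\<close> and \<open>fweight\<close> below are the operators \<open>D\<^sub>V\<close> and \<open>\<^bold>d\<close> on words.
\<close>

fun deriv_word :: "'h letter list \<Rightarrow> 'h fock" where
  "deriv_word [] = 0"
| "deriv_word ((s, b, j) # w) = smul (of_nat (Suc j)) (bv ((s, b, Suc j) # w)) + prepend (s, b, j) (deriv_word w)"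

definition fderivation :: "'h fock \<Rightarrow> 'h fock" where
  "fderivation = lin deriv_word"

lemma linmap_fderivation [linmap_intros]: "linmap f \<Longrightarrow> linmap (\<lambda>m. fderivation (f m))"
  unfolding fderivation_def by (intro linmap_intros)

lemmas linmap_fderivation' = linmap_fderivation[OF linmap_id]

lemma D_prepend: "fderivation (prepend (s, b, j) m) = smul (of_nat (Suc j)) (prepend (s, b, Suc j) m) + prepend (s, b, j) (fderivation m)"
  by (rule linmap_eqI[where m=m]) (auto intro!: linmap_intros simp: fderivation_def)

lemma D_create: "fderivation (create s a j m) = smul (of_nat (Suc j)) (create s a (Suc j) m) + create s a j (fderivation m)"
  by (simp add: create_def linmap_sum[OF linmap_fderivation'] linmap_smul[OF linmap_fderivation'] D_prepend smul.scale_right_distrib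
      sum.distrib smul.scale_sum_right mult.commute del: of_nat_Suc)

text \<open>The derivation raises the index of a letter and, dually, lowers that of the annihilating
  mode. For \<open>n = 0\<close> the truncated \<open>n - 1\<close> does no harm, as the factor
  \<open>n\<close> vanishes.\<close>

lemma pairing_D: "of_nat (Suc j) * pairing s a n t b (Suc j) = of_nat n * pairing s a (n - 1) t b j"
  by (auto simp: pairing_def split: species.split)

lemma fderivation_bv_Nil: "fderivation (bv []) = 0"
  by (simp add: fderivation_def)

lemma D_annih: "fderivation (annih s a n m) = annih s a n (fderivation m) - smul (of_nat n) (annih s a (n - 1) m)"
proof (rule linmap_list_eqI[where m = m])
  fix l :: "'h letter" and x :: "'h fock"
  assume IH: "fderivation (annih s a n x) = annih s a n (fderivation x) - smul (of_nat n) (annih s a (n - 1) x)"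
  obtain t b j where l: "l = (t, b, j)" by (cases l)
  have *: "smul (of_nat (Suc j) * pairing s a n t b (Suc j)) m = smul (of_nat n * pairing s a (n - 1) t b j) m" for m :: "'h fock"
    by (simp only: pairing_D)
  show "fderivation (annih s a n (prepend l x)) = annih s a n (fderivation (prepend l x)) - smul (of_nat n) (annih s a (n - 1) (prepend l x))"
    unfolding l annih_prepend D_prepend linmap_add[OF linmap_annih'] linmap_smul[OF linmap_annih'] linmap_add[OF linmap_fderivation'] linmap_smul[OF linmap_fderivation'] IH
      smul.scale_right_distrib smul.scale_right_diff_distrib linmap_diff[OF linmap_prepend'] linmap_smul[OF linmap_prepend'] smul.scale_scale *
    by (simp add: algebra_simps)
qed (auto intro!: linmap_intros simp: linmap_zero[OF linmap_annih'] linmap_zero[OF linmap_fderivation'] fderivation_bv_Nil)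

text \<open>One formula covers all integers \<open>k\<close>: at \<open>k = 0\<close>, where passing
  to \<open>k - 1\<close> turns annihilation into creation, the factor \<open>k\<close> is
  0.\<close>

lemma D_fmode: "fderivation (fmode s a k m) = fmode s a k (fderivation m) + smul (- of_int k) (fmode s a (k - 1) m)"
proof (cases "k < 0")
  case True
  then have "nat (- (k - 1) - 1) = Suc (nat (- k - 1))" "(of_int (- k) :: complex) = of_nat (Suc (nat (- k - 1)))"
    by auto
  then show ?thesis using True by (simp add: fmode_def D_create)
next
  case False
  then consider "k = 0" | "k > 0" "nat (k - 1) = nat k - 1" "(of_int k :: complex) = of_nat (nat k)" by force
  then show ?thesis by cases (auto simp: fmode_def D_annih)
qed

section \<open>Weights of words and the bracket of the weight operator with modes\<close>

definition letter_wt :: "'h letter \<Rightarrow> rat" where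
  "letter_wt l = of_nat (Suc (snd (snd l))) - (if fst l = Fer then 1 / 2 else 0)"

definition wt :: "'h letter list \<Rightarrow> rat" where
  "wt w = (\<Sum>l\<leftarrow>w. letter_wt l)"

definition fweight :: "'h fock \<Rightarrow> 'h fock" where
  "fweight = lin (\<lambda>w. smul (of_rat (wt w)) (bv w))"

lemma linmap_fweight [linmap_intros]: "linmap f \<Longrightarrow> linmap (\<lambda>m. fweight (f m))"
  unfolding fweight_def by (intro linmap_intros)

lemmas linmap_fweight' = linmap_fweight[OF linmap_id]

lemma fweight_prepend: "fweight (prepend l m) = smul (of_rat (letter_wt l)) (prepend l m) + prepend l (fweight m)"
  by (rule linmap_eqI[where m=m])
    (auto intro!: linmap_intros simp: fweight_def wt_def linmap_smul[OF linmap_prepend'] of_rat_add smul.scale_left_distrib)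

lemma fweight_create: "fweight (create s a j m) = smul (of_rat (letter_wt (s, a, j))) (create s a j m) + create s a j (fweight m)"
  by (simp add: create_def linmap_sum[OF linmap_fweight'] linmap_smul[OF linmap_fweight'] fweight_prepend smul.scale_right_distrib
      sum.distrib smul.scale_sum_right letter_wt_def mult.commute)

text \<open>The half-integral index of the mode, which is the amount by which it lowers the
  weight.\<close>

definition mode_wt :: "species \<Rightarrow> int \<Rightarrow> rat" where
  "mode_wt s k = of_int k + (if s = Fer then 1 / 2 else 0)"

lemma pairing_wt: "pairing s a n t b j = 0 \<or> letter_wt (t, b, j) = mode_wt s (int n)"
  by (auto simp: pairing_def letter_wt_def mode_wt_def split: species.split)

lemma fweight_bv_Nil: "fweight (bv []) = 0"
  by (simp add: fweight_def wt_def)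

lemma fweight_annih: "fweight (annih s a n m) = annih s a n (fweight m) - smul (of_rat (mode_wt s (int n))) (annih s a n m)"
proof (rule linmap_list_eqI[where m = m])
  fix l :: "'h letter" and x :: "'h fock"
  assume IH: "fweight (annih s a n x) = annih s a n (fweight x) - smul (of_rat (mode_wt s (int n))) (annih s a n x)"
  obtain t b j where l: "l = (t, b, j)" by (cases l)
  have *: "smul (of_rat (letter_wt (t, b, j)) * pairing s a n t b j) m = smul (of_rat (mode_wt s (int n)) * pairing s a n t b j) m" for m :: "'h fock"
    using pairing_wt[of s a n t b j] by auto
  show "fweight (annih s a n (prepend l x)) = annih s a n (fweight (prepend l x)) - smul (of_rat (mode_wt s (int n))) (annih s a n (prepend l x))"
    unfolding l annih_prepend fweight_prepend linmap_add[OF linmap_annih'] linmap_smul[OF linmap_annih'] linmap_add[OF linmap_fweight'] linmap_smul[OF linmap_fweight'] IH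
      smul.scale_right_distrib smul.scale_right_diff_distrib linmap_diff[OF linmap_prepend'] linmap_smul[OF linmap_prepend'] smul.scale_scale *
    by (simp add: algebra_simps)
qed (auto intro!: linmap_intros simp: linmap_zero[OF linmap_annih'] linmap_zero[OF linmap_fweight'] fweight_bv_Nil)

lemma fweight_fmode: "fweight (fmode s a k m) = fmode s a k (fweight m) - smul (of_rat (mode_wt s k)) (fmode s a k m)"
proof (cases "k < 0")
  case True
  then have "letter_wt (s, a, nat (- k - 1)) = - mode_wt s k" by (auto simp: letter_wt_def mode_wt_def of_nat_nat)
  then show ?thesis using True by (simp add: fmode_def fweight_create of_rat_minus)
next
  case False
  then show ?thesis by (auto simp: fmode_def fweight_annih)
qed

text \<open>The scalar \<open>ksigns s w\<close> depends on the word, so for a general vector the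
  sign picked up in passing the whole state has to be an operator. It takes the place of
  \<open>ksigns s A\<close> when vertex operators are extended linearly.\<close>

definition parity :: "species \<Rightarrow> 'h fock \<Rightarrow> 'h fock" where
  "parity s = lin (\<lambda>w. smul (ksigns s w) (bv w))"

lemma linmap_parity [linmap_intros]: "linmap f \<Longrightarrow> linmap (\<lambda>m. parity s (f m))"
  unfolding parity_def by (intro linmap_intros)

lemmas linmap_parity' = linmap_parity[OF linmap_id]

lemma parity_prepend: "parity s (prepend (t, b, j) m) = smul (ksign s t) (prepend (t, b, j) (parity s m))"
  by (rule linmap_eqI[where m=m]) (auto intro!: linmap_intros simp: parity_def linmap_smul[OF linmap_prepend'])

lemma parity_create: "parity s (create t b j m) = smul (ksign s t) (create t b j (parity s m))"
  by (simp add: create_def linmap_sum[OF linmap_parity'] linmap_smul[OF linmap_parity'] parity_prepend smul.scale_sum_right mult.commute)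

lemma parity_annih: "parity s (annih t b n m) = smul (ksign s t) (annih t b n (parity s m))"
proof (rule linmap_list_eqI[where m = m])
  fix l :: "'h letter" and x :: "'h fock"
  assume IH: "parity s (annih t b n x) = smul (ksign s t) (annih t b n (parity s x))"
  obtain r c j where l: "l = (r, c, j)" by (cases l)
  have *: "smul (ksign s t * (ksign s r * pairing t b n r c j)) m = smul (pairing t b n r c j) m" for m :: "'h fock"
    using pairing_ksign[of t r b n c j] by auto
  show "parity s (annih t b n (prepend l x)) = smul (ksign s t) (annih t b n (parity s (prepend l x)))"
    unfolding l annih_prepend parity_prepend linmap_add[OF linmap_annih'] linmap_smul[OF linmap_annih'] linmap_add[OF linmap_parity'] linmap_smul[OF linmap_parity'] IH
      smul.scale_right_distrib linmap_smul[OF linmap_prepend'] smul.scale_scale *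
    by (simp add: * mult_ac)
qed (auto intro!: linmap_intros simp: linmap_zero[OF linmap_annih'] linmap_zero[OF linmap_parity'] linmap_smul[OF linmap_annih'] parity_def)

lemma parity_fmode: "parity s (fmode t b k m) = smul (ksign s t) (fmode t b k (parity s m))"
  by (simp add: fmode_def parity_create parity_annih)

end

section \<open>Fields and vertex operators on words\<close>

text \<open>A letter counts with \<open>j + 1\<close> whatever its species: an integer version of
  the weight without the fermionic half. Every vector has a finite bound, and a nonnegative mode
  \<open>n\<close> lowers it by at least \<open>n\<close>; this is the source of the truncations
  below.\<close>

definition size_le :: "int \<Rightarrow> 'h fock \<Rightarrow> bool" where
  "size_le B m \<longleftrightarrow> (\<forall>w\<in>Poly_Mapping.keys m. (\<Sum>l\<leftarrow>w. int (Suc (snd (snd l)))) \<le> B)"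

definition word_size :: "(species \<times> 'h \<times> nat) list \<Rightarrow> int" where
  "word_size w = (\<Sum>l\<leftarrow>w. int (Suc (snd (snd l))))"

lemma word_size_simps [simp]: "word_size [] = 0" "word_size (l # w) = int (Suc (snd (snd l))) + word_size w"
  "word_size (v @ w) = word_size v + word_size w"
  by (simp_all add: word_size_def)

lemma word_size_nonneg: "word_size w \<ge> 0"
  by (induct w) auto

lemma size_le_word_size: "size_le B m \<longleftrightarrow> (\<forall>w\<in>Poly_Mapping.keys m. word_size w \<le> B)"
  by (simp add: size_le_def word_size_def)

lemma size_le_mono: "size_le B m \<Longrightarrow> B \<le> C \<Longrightarrow> size_le C m"
  by (force simp: size_le_word_size)

lemma size_le_zero [simp]: "size_le B 0"
  by (simp add: size_le_word_size)

lemma size_le_add: "size_le B m \<Longrightarrow> size_le B m' \<Longrightarrow> size_le B (m + m')"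
  using Poly_Mapping.keys_add[of m m'] by (auto simp: size_le_word_size)

lemma size_le_smul: "size_le B m \<Longrightarrow> size_le B (smul c m)"
  using keys_smul[of c m] by (auto simp: size_le_word_size)

lemma size_le_sum: "(\<And>i. i \<in> S \<Longrightarrow> size_le B (f i)) \<Longrightarrow> size_le B (sum f S)"
  by (induct S rule: infinite_finite_induct) (auto simp: size_le_add)

lemma size_le_bv: "size_le B (bv w) \<longleftrightarrow> word_size w \<le> B"
  by (simp add: size_le_word_size)

lemma size_le_neg:
  assumes "size_le B m" "B < 0"
  shows "m = 0"
proof -
  have "w \<notin> Poly_Mapping.keys m" for w
    using assms word_size_nonneg[of w] by (auto simp: size_le_word_size)
  then have "Poly_Mapping.keys m = {}" by blast
  then show ?thesis by simp
qed

lemma size_le_exists: "\<exists>B\<ge>0. size_le B m"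
proof -
  have "finite (word_size ` Poly_Mapping.keys m)" by simp
  then show ?thesis
    by (intro exI[of _ "Max (insert 0 (word_size ` Poly_Mapping.keys m))"]) (auto simp: size_le_word_size)
qed

lemma size_le_lin:
  assumes "size_le B m" and "\<And>w. word_size w \<le> B \<Longrightarrow> size_le C (f w)"
  shows "size_le C (lin f m)"
  unfolding lin_def using assms by (intro size_le_sum size_le_smul) (auto simp: size_le_word_size)

lemma size_le_prepend: "size_le B m \<Longrightarrow> size_le (B + int (Suc (snd (snd l)))) (prepend l m)"
  unfolding prepend_def by (rule size_le_lin) (auto simp: size_le_bv)

abbreviation fcoeff :: "nat \<Rightarrow> int \<Rightarrow> complex" where
  "fcoeff j n \<equiv> of_int (- n - 1) gchoose j"

text \<open>Compares the coefficients of neighbouring modes after the index shift that occurs in the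
  bracket with the derivation.\<close>

lemma fcoeff_shift: "of_int (n + 1) * fcoeff j (n + 1) = of_int (n + 1 + int j) * fcoeff j n"
proof -
  define e :: complex where "e = of_int (- n - 1)"
  have "(e gchoose j) * (e - of_nat j) = e * (e - 1 gchoose j)"
    using gbinomial_absorb_comp[of e j] by (simp add: mult.commute)
  moreover have "(of_int (- (n + 1) - 1) :: complex) = e - 1" "(of_int (n + 1) :: complex) = - e"
    "(of_int (n + 1 + int j) :: complex) = - (e - of_nat j)"
    by (simp_all add: e_def)
  ultimately show ?thesis unfolding e_def[symmetric] by (simp only: mult_minus_left mult_minus_right mult.commute[of "e - of_nat j"])
qed

text \<open>Encodes (j + 1) a^(j+1)(x) = d/dx a^(j)(x) on the coefficient of the mode
  \<open>n\<close>.\<close>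

lemma fcoeff_Suc: "of_nat (Suc j) * fcoeff (Suc j) n = of_int (- n - 1 - int j) * fcoeff j n"
proof -
  define e :: complex where "e = of_int (- n - 1)"
  have "of_nat (Suc j) * (e gchoose Suc j) = (e - of_nat j) * (e gchoose j)"
    using gbinomial_mult_1[of e j] by (simp add: algebra_simps)
  then show ?thesis by (simp add: e_def)
qed

text \<open>Differentiating \<open>j\<close> times kills the powers of x below \<open>j\<close>,
  that is, the negative modes above \<open>-1 - j\<close>.\<close>

lemma fcoeff_eq_0: "- 1 - int j < n \<Longrightarrow> n < 0 \<Longrightarrow> fcoeff j n = 0"
proof -
  assume "- 1 - int j < n" "n < 0"
  then have "(of_int (- n - 1) :: complex) = of_nat (nat (- n - 1))" "nat (- n - 1) < j" by auto
  then show ?thesis by (simp only: binomial_gbinomial[symmetric] binomial_eq_0 of_nat_0)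
qed

context bilinear_form_space
begin

text \<open>A contraction with index \<open>n\<close> removes a letter of size \<open>n\<close>
  (bosonic) or \<open>n + 1\<close> (fermionic).\<close>

lemma size_le_annih_word: "size_le (word_size w - int n) (annih_word s a n w)"
proof (induct w)
  case (Cons l w)
  obtain t b j where l: "l = (t, b, j)" by (cases l)
  have "size_le (word_size (l # w) - int n) (smul (pairing s a n t b j) (bv w))"
  proof (cases "pairing s a n t b j = 0")
    case False
    then have "n \<le> Suc j" by (auto simp: pairing_def split: species.splits if_splits)
    then show ?thesis by (intro size_le_smul) (simp add: l size_le_bv)
  qed simp
  moreover have "size_le (word_size (l # w) - int n) (smul (ksign s t) (prepend l (annih_word s a n w)))"
    using size_le_prepend[OF Cons, of l] by (intro size_le_smul) (simp add: algebra_simps)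
  ultimately show ?case by (simp add: l size_le_add)
qed simp

lemma size_le_fmode: "size_le B m \<Longrightarrow> size_le (B - k) (fmode s a k m)"
proof (cases "k < 0")
  case True
  assume "size_le B m"
  from size_le_prepend[OF this, of "(s, _, nat (- k - 1))"] True have "size_le (B - k) (prepend (s, b, nat (- k - 1)) m)" for b
    by (simp add: algebra_simps)
  then have "size_le (B - k) (create s a (nat (- k - 1)) m)" unfolding create_def by (intro size_le_sum size_le_smul)
  then show ?thesis using True by (simp add: fmode_def)
next
  case False
  assume m: "size_le B m"
  have "size_le (B - int (nat k)) (annih s a (nat k) m)"
    unfolding annih_def using m by (rule size_le_lin) (rule size_le_mono[OF size_le_annih_word], simp)
  then show ?thesis using False by (simp add: fmode_def)
qed

lemma fmode_eq_0: "size_le B m \<Longrightarrow> k > B \<Longrightarrow> fmode s a k m = 0"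
  using size_le_neg[OF size_le_fmode] by auto

text \<open>
  Zero modes act by \<open>0\<close> and nonnegative modes supercommute, so normal ordering only has to move
  nonnegative modes to the right.
\<close>

fun normal_op :: "'h letter list \<Rightarrow> int list \<Rightarrow> 'h fock \<Rightarrow> 'h fock" where
  "normal_op ((s, a, j) # A) (n # ns) m =
     (if n < 0 then fmode s a n (normal_op A ns m) else smul (ksigns s A) (normal_op A ns (fmode s a n m)))"
| "normal_op _ _ m = m"

lemma linmap_normal_op [linmap_intros]: "linmap f \<Longrightarrow> linmap (\<lambda>m. normal_op A ns (f m))"
proof (induct A ns arbitrary: f rule: list_induct2')
  case (4 x A n ns)
  obtain s a j where "x = (s, a, j)" by (cases x)
  then show ?case using 4 by (cases "n < 0") (auto intro!: linmap_fmode linmap_smulI)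
qed auto

lemmas linmap_normal_op' = linmap_normal_op[OF linmap_id]

definition coeff_prod :: "'h letter list \<Rightarrow> int list \<Rightarrow> complex" where
  "coeff_prod A ns = (\<Prod>(x, n)\<leftarrow>zip A ns. fcoeff (snd (snd x)) n)"

definition exponent :: "'h letter list \<Rightarrow> int list \<Rightarrow> int" where
  "exponent A ns = (\<Sum>(x, n)\<leftarrow>zip A ns. - n - 1 - int (snd (snd x)))"

lemma coeff_prod_simps [simp]: "coeff_prod [] ns = 1" "coeff_prod A [] = 1" "coeff_prod (x # A) (n # ns) = fcoeff (snd (snd x)) n * coeff_prod A ns"
  by (simp_all add: coeff_prod_def)

lemma exponent_simps [simp]: "exponent [] ns = 0" "exponent A [] = 0" "exponent (x # A) (n # ns) = - n - 1 - int (snd (snd x)) + exponent A ns"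
  by (simp_all add: exponent_def)

definition fterm :: "'h letter list \<Rightarrow> int list \<Rightarrow> 'h fock \<Rightarrow> 'h fock" where
  "fterm A ns m = smul (coeff_prod A ns) (normal_op A ns m)"

lemma linmap_fterm [linmap_intros]: "linmap f \<Longrightarrow> linmap (\<lambda>m. fterm A ns (f m))"
  unfolding fterm_def by (intro linmap_intros)

lemmas linmap_fterm' = linmap_fterm[OF linmap_id]

definition mode_indices :: "'h letter list \<Rightarrow> int \<Rightarrow> int list set" where
  "mode_indices A p = {ns. length ns = length A \<and> exponent A ns = p}"

text \<open>
  The coefficient of \<open>x\<^sup>p\<close> in the normally ordered product of the fields of the letters of \<open>A\<close>.
\<close>

definition ffield :: "'h letter list \<Rightarrow> int \<Rightarrow> 'h fock \<Rightarrow> 'h fock" where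
  "ffield A p m = (\<Sum>ns\<in>{ns \<in> mode_indices A p. fterm A ns m \<noteq> 0}. fterm A ns m)"

text \<open>The support in \<open>ffield\<close> varies with the vector; a finite box common to
  several vectors makes their sums comparable.\<close>

definition nbox :: "'h letter list \<Rightarrow> int \<Rightarrow> int \<Rightarrow> int list set" where
  "nbox A p K = {ns \<in> mode_indices A p. set ns \<subseteq> {- K..K}}"

lemma finite_nbox [simp]: "finite (nbox A p K)"
proof (rule finite_subset)
  show "nbox A p K \<subseteq> {ns. set ns \<subseteq> {- K..K} \<and> length ns = length A}" by (auto simp: nbox_def mode_indices_def)
  show "finite {ns. set ns \<subseteq> {- K..K} \<and> length ns = length A}" by (rule finite_lists_length_eq) simp
qed

text \<open>Nonnegative modes stand to the right, where each lowers the size of the vector by at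
  least its index. Their total cannot exceed \<open>B\<close> unless the vector becomes 0.\<close>

lemma normal_op_supp:
  "length ns = length A \<Longrightarrow> size_le B m \<Longrightarrow> normal_op A ns m \<noteq> 0 \<Longrightarrow> (\<Sum>n\<leftarrow>ns. max n 0) \<le> B"
proof (induct A ns arbitrary: m B rule: list_induct2')
  case 1
  then have "\<not> B < 0" using size_le_neg[of B m] by auto
  then show ?case by simp
next
  case (4 x A n ns)
  obtain s a j where x: "x = (s, a, j)" by (cases x)
  show ?case
  proof (cases "n < 0")
    case True
    moreover from this have "normal_op A ns m \<noteq> 0" using 4(4) by (auto simp: x linmap_zero[OF linmap_fmode'])
    ultimately show ?thesis using 4(1)[of B m] 4(2,3) by simp
  next
    case False
    then have "normal_op A ns (fmode s a n m) \<noteq> 0" using 4(4) by (auto simp: x)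
    then have "(\<Sum>n\<leftarrow>ns. max n 0) \<le> B - n"
      using 4(2,3) by (intro 4(1)[of "B - n" "fmode s a n m"]) (auto intro: size_le_fmode)
    then show ?thesis using False by simp
  qed
qed auto

lemma sum_max: "(\<Sum>n\<leftarrow>ns. max (- n) 0) = (\<Sum>n\<leftarrow>ns. max n (0::int)) + (\<Sum>n\<leftarrow>ns. - n)"
  by (induct ns) auto

lemma sum_neg_exponent: "length ns = length A \<Longrightarrow> (\<Sum>n\<leftarrow>ns. - n) = exponent A ns + word_size A"
  by (induct ns A rule: list_induct2) auto

text \<open>The size bounds the positive parts of the modes; the fixed total exponent then bounds
  the negative parts as well, so only finitely many mode lists contribute.\<close>

lemma fterm_supp:
  assumes "ns \<in> mode_indices A p" "size_le B m" "fterm A ns m \<noteq> 0"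
  shows "\<forall>n\<in>set ns. n \<le> B \<and> - n \<le> p + word_size A + B" "0 \<le> p + word_size A + B"
proof -
  have l: "length ns = length A" "exponent A ns = p" using assms by (auto simp: mode_indices_def)
  have "normal_op A ns m \<noteq> 0" using assms by (auto simp: fterm_def)
  then have s: "(\<Sum>n\<leftarrow>ns. max n 0) \<le> B" using normal_op_supp l assms by blast
  then have s': "(\<Sum>n\<leftarrow>ns. max (- n) 0) \<le> p + word_size A + B"
    using sum_max[of ns] sum_neg_exponent[OF l(1)] l(2) by simp
  have *: "f n \<le> (\<Sum>n\<leftarrow>ns. f n)" if "n \<in> set ns" "\<And>n. f n \<ge> (0::int)" for n and f :: "int \<Rightarrow> int"
  proof (rule member_le_sum_list)
    show "f n \<in> set (map f ns)" using that(1) by simp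
  qed (use that(2) in auto)
  show "\<forall>n\<in>set ns. n \<le> B \<and> - n \<le> p + word_size A + B"
  proof
    fix n assume n: "n \<in> set ns"
    show "n \<le> B \<and> - n \<le> p + word_size A + B"
      using *[OF n, of "\<lambda>n. max n 0"] *[OF n, of "\<lambda>n. max (- n) 0"] s s' by simp
  qed
  have "0 \<le> (\<Sum>n\<leftarrow>ns. max (- n) 0)" by (induct ns) auto
  then show "0 \<le> p + word_size A + B" using s' by simp
qed

lemma supp_nbox:
  assumes "size_le B m" "B \<le> K" "p + word_size A + B \<le> K"
  shows "{ns \<in> mode_indices A p. fterm A ns m \<noteq> 0} \<subseteq> nbox A p K"
proof
  fix ns assume "ns \<in> {ns \<in> mode_indices A p. fterm A ns m \<noteq> 0}"
  then have ns: "ns \<in> mode_indices A p" "fterm A ns m \<noteq> 0" by auto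
  have "n \<in> {- K..K}" if "n \<in> set ns" for n
    using fterm_supp(1)[OF ns(1) assms(1) ns(2)] assms(2,3) that by auto
  then show "ns \<in> nbox A p K" using ns(1) by (auto simp: nbox_def)
qed

lemma ffield_box:
  assumes "size_le B m" "B \<le> K" "p + word_size A + B \<le> K"
  shows "ffield A p m = (\<Sum>ns\<in>nbox A p K. fterm A ns m)"
  unfolding ffield_def using supp_nbox[OF assms] by (intro sum.mono_neutral_left finite_nbox) (auto simp: nbox_def)

lemma finite_supp: "finite {ns \<in> mode_indices A p. fterm A ns m \<noteq> 0}"
proof -
  obtain B where B: "size_le B m" using size_le_exists by blast
  show ?thesis
    by (rule finite_subset[OF supp_nbox[OF B, of "max B (p + word_size A + B)"]]) auto
qed

lemma ffield_low: "size_le B m \<Longrightarrow> p + word_size A + B < 0 \<Longrightarrow> ffield A p m = 0"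
  unfolding ffield_def using fterm_supp(2)[of _ A p B m] by (intro sum.neutral) auto

lemma linmap_ffield': "linmap (ffield A p)"
proof -
  have add: "ffield A p (x + y) = ffield A p x + ffield A p y" for x y
  proof -
    obtain B C where "size_le B x" "size_le C y" using size_le_exists by blast
    then have B: "size_le (max B C) x" "size_le (max B C) y" by (auto intro: size_le_mono)
    define K where "K = max (max B C) (p + word_size A + max B C)"
    have K: "max B C \<le> K" "p + word_size A + max B C \<le> K" by (auto simp: K_def)
    show ?thesis
      by (simp add: ffield_box[OF _ K] B size_le_add linmap_add[OF linmap_fterm'] sum.distrib)
  qed
  moreover have "ffield A p (smul c x) = smul c (ffield A p x)" for c x
  proof -
    obtain B where B: "size_le B x" using size_le_exists by blast
    define K where "K = max B (p + word_size A + B)"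
    have K: "B \<le> K" "p + word_size A + B \<le> K" by (auto simp: K_def)
    show ?thesis
      by (simp add: ffield_box[OF _ K] B size_le_smul linmap_smul[OF linmap_fterm'] smul.scale_sum_right)
  qed
  ultimately show ?thesis by (simp add: linmap_def)
qed

lemma linmap_ffield [linmap_intros]: "linmap f \<Longrightarrow> linmap (\<lambda>m. ffield A p (f m))"
  by (rule linmap_comp[OF linmap_ffield'])

lemma ffield_Nil: "ffield [] p m = (if p = 0 then m else 0)"
proof -
  have "{ns \<in> mode_indices [] p. fterm [] ns m \<noteq> 0} = (if p = 0 \<and> m \<noteq> 0 then {[]} else {})"
    by (auto simp: mode_indices_def fterm_def)
  then show ?thesis by (auto simp: ffield_def fterm_def)
qed

lemma fterm_Cons: "fterm ((s, a, j) # A) (n # ns) m = smul (fcoeff j n)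
   (if n < 0 then fmode s a n (fterm A ns m) else smul (ksigns s A) (fterm A ns (fmode s a n m)))"
  by (simp add: fterm_def linmap_smul[OF linmap_fmode'] mult_ac)

lemma nbox_Cons: "nbox ((s, a, j) # A) p K = (\<Union>n\<in>{- K..K}. (#) n ` nbox A (p + n + 1 + int j) K)"
proof (intro subset_antisym subsetI)
  fix ns assume ns: "ns \<in> nbox ((s, a, j) # A) p K"
  then obtain n ns' where n: "ns = n # ns'" by (cases ns) (auto simp: nbox_def mode_indices_def)
  then have "n \<in> {- K..K}" "ns' \<in> nbox A (p + n + 1 + int j) K"
    using ns by (auto simp: nbox_def mode_indices_def)
  then show "ns \<in> (\<Union>n\<in>{- K..K}. (#) n ` nbox A (p + n + 1 + int j) K)"
    using n by blast
qed (auto simp: nbox_def mode_indices_def)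

text \<open>One box serves all inner sums: for \<open>n < 0\<close> the inner exponent lies below
  \<open>p + Suc j\<close>, and for nonnegative \<open>n\<close> its growth by \<open>n\<close> is
  offset by the smaller size of \<open>fmode s a n m\<close>.\<close>

lemma ffield_Cons:
  assumes "size_le B m" "B \<le> K" "p + int (Suc j) + word_size A + B \<le> K"
  shows "ffield ((s, a, j) # A) p m = (\<Sum>n\<in>{- K..K}. smul (fcoeff j n)
     (if n < 0 then fmode s a n (ffield A (p + n + 1 + int j) m)
      else smul (ksigns s A) (ffield A (p + n + 1 + int j) (fmode s a n m))))"
proof -
  have "ffield ((s, a, j) # A) p m = (\<Sum>ns\<in>nbox ((s, a, j) # A) p K. fterm ((s, a, j) # A) ns m)"
    using assms by (intro ffield_box) auto
  also have "\<dots> = (\<Sum>n\<in>{- K..K}. \<Sum>ns\<in>(#) n ` nbox A (p + n + 1 + int j) K. fterm ((s, a, j) # A) ns m)"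
    unfolding nbox_Cons by (rule sum.UNION_disjoint) auto
  also have "\<dots> = (\<Sum>n\<in>{- K..K}. \<Sum>ns\<in>nbox A (p + n + 1 + int j) K. fterm ((s, a, j) # A) (n # ns) m)"
    by (intro sum.cong[OF refl] sum.reindex_cong[OF _ refl refl]) (auto simp: inj_on_def)
  also have "\<dots> = (\<Sum>n\<in>{- K..K}. smul (fcoeff j n)
     (if n < 0 then fmode s a n (ffield A (p + n + 1 + int j) m)
      else smul (ksigns s A) (ffield A (p + n + 1 + int j) (fmode s a n m))))"
  proof (intro sum.cong refl)
    fix n
    show "(\<Sum>ns\<in>nbox A (p + n + 1 + int j) K. fterm ((s, a, j) # A) (n # ns) m) = smul (fcoeff j n)
     (if n < 0 then fmode s a n (ffield A (p + n + 1 + int j) m)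
      else smul (ksigns s A) (ffield A (p + n + 1 + int j) (fmode s a n m)))"
    proof (cases "n < 0")
      case True
      then show ?thesis using assms
        by (subst ffield_box[of B _ K]) (auto simp: fterm_Cons linmap_sum[OF linmap_fmode'] smul.scale_sum_right)
    next
      case False
      then show ?thesis using assms
        by (subst ffield_box[of "B - n" _ K]) (auto simp: fterm_Cons smul.scale_sum_right size_le_fmode)
    qed
  qed
  finally show ?thesis .
qed

section \<open>Vertex operators of arbitrary vectors\<close>

definition fvertex :: "'h fock \<Rightarrow> int \<Rightarrow> 'h fock \<Rightarrow> 'h fock" where
  "fvertex u p m = lin (\<lambda>w. ffield w p m) u"

lemma fvertex_bv [simp]: "fvertex (bv w) p m = ffield w p m"
  by (simp add: fvertex_def)

lemma linmap_fvertex_left: "linmap f \<Longrightarrow> linmap (\<lambda>u. fvertex (f u) p m)"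
  unfolding fvertex_def by (intro linmap_intros)

lemma linmap_fvertex_right: "linmap f \<Longrightarrow> linmap (\<lambda>m. fvertex u p (f m))"
  unfolding fvertex_def lin_def by (intro linmap_intros)

lemmas linmap_fvertex_left' = linmap_fvertex_left[OF linmap_id] and linmap_fvertex_right' = linmap_fvertex_right[OF linmap_id]

text \<open>Both sides are linear in \<open>u\<close> and in \<open>a\<close>, so the recursion for
  words carries over; the sign of the word turns into \<open>parity s u\<close>.\<close>

lemma fvertex_create:
  assumes "size_le B m" "size_le C u" "B \<le> K" "p + int (Suc j) + C + B \<le> K"
  shows "fvertex (create s a j u) p m = (\<Sum>n\<in>{- K..K}. smul (fcoeff j n)
     (if n < 0 then fmode s a n (fvertex u (p + n + 1 + int j) m)
      else fvertex (parity s u) (p + n + 1 + int j) (fmode s a n m)))"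
proof -
  have oprep: "fmode s a n x = (\<Sum>b\<in>Basis. smul (representation Basis a b) (fmode s b n x))" for n x
  proof -
    have "fmode s (\<Sum>b\<in>S. scale (representation Basis a b) b) n x = (\<Sum>b\<in>S. smul (representation Basis a b) (fmode s b n x))" for S
      by (induct S rule: infinite_finite_induct) (auto simp: fmode_zero fmode_add fmode_scale)
    from this[of Basis] show ?thesis by (simp add: rep_sum)
  qed
  have 1: "fvertex (prepend (s, b, j) u) p m = (\<Sum>n\<in>{- K..K}. smul (fcoeff j n)
     (if n < 0 then fmode s b n (fvertex u (p + n + 1 + int j) m)
      else fvertex (parity s u) (p + n + 1 + int j) (fmode s b n m)))" for b
  proof (rule linmap_eqI[where m = u])
    fix w assume "w \<in> Poly_Mapping.keys u"
    then have "word_size w \<le> C" using assms by (auto simp: size_le_word_size)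
    then show "fvertex (prepend (s, b, j) (bv w)) p m = (\<Sum>n\<in>{- K..K}. smul (fcoeff j n)
     (if n < 0 then fmode s b n (fvertex (bv w) (p + n + 1 + int j) m)
      else fvertex (parity s (bv w)) (p + n + 1 + int j) (fmode s b n m)))"
      using assms ffield_Cons[of B m K p j w s b] by (simp add: parity_def linmap_smul[OF linmap_fvertex_left'] cong: if_cong)
  qed (intro linmap_fvertex_left linmap_intros)+
  have "fvertex (create s a j u) p m = (\<Sum>b\<in>Basis. smul (representation Basis a b) (fvertex (prepend (s, b, j) u) p m))"
    by (simp add: create_def linmap_sum[OF linmap_fvertex_left'] linmap_smul[OF linmap_fvertex_left'])
  also have "\<dots> = (\<Sum>n\<in>{- K..K}. \<Sum>b\<in>Basis. smul (representation Basis a b) (smul (fcoeff j n)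
     (if n < 0 then fmode s b n (fvertex u (p + n + 1 + int j) m)
      else fvertex (parity s u) (p + n + 1 + int j) (fmode s b n m))))"
    unfolding 1 smul.scale_sum_right by (rule sum.swap)
  also have "\<dots> = (\<Sum>n\<in>{- K..K}. smul (fcoeff j n)
     (if n < 0 then fmode s a n (fvertex u (p + n + 1 + int j) m)
      else fvertex (parity s u) (p + n + 1 + int j) (fmode s a n m)))"
  proof (intro sum.cong refl)
    fix n
    show "(\<Sum>b\<in>Basis. smul (representation Basis a b) (smul (fcoeff j n)
     (if n < 0 then fmode s b n (fvertex u (p + n + 1 + int j) m)
      else fvertex (parity s u) (p + n + 1 + int j) (fmode s b n m)))) = smul (fcoeff j n)
     (if n < 0 then fmode s a n (fvertex u (p + n + 1 + int j) m)
      else fvertex (parity s u) (p + n + 1 + int j) (fmode s a n m))"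
      unfolding oprep[of n m] oprep[of n "fvertex u (p + n + 1 + int j) m"]
      by (simp add: linmap_sum[OF linmap_fvertex_right'] linmap_smul[OF linmap_fvertex_right'] smul.scale_sum_right mult.commute)
  qed
  finally show ?thesis .
qed

text \<open>
  The multilinear counterpart of the word \<open>A\<close>: every letter is expanded in the basis.
\<close>

definition state :: "'h letter list \<Rightarrow> 'h fock" where
  "state A = foldr (\<lambda>(s, a, j). create s a j) A (bv [])"

lemma state_simps [simp]: "state [] = bv []" "state ((s, a, j) # A) = create s a j (state A)"
  by (simp_all add: state_def)

lemma state_Basis: "\<forall>(s, b, j)\<in>set A. b \<in> Basis \<Longrightarrow> state A = bv A"
  by (induct A) (auto simp: create_Basis)

lemma parity_state: "parity s (state A) = smul (ksigns s A) (state A)"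
proof (induct A)
  case (Cons l A)
  obtain t a j where "l = (t, a, j)" by (cases l)
  then show ?case by (simp add: parity_create Cons linmap_smul[OF linmap_create'])
qed (simp add: parity_def)

lemma size_le_state: "size_le (word_size A) (state A)"
proof (induct A)
  case (Cons l A)
  obtain s a j where l: "l = (s, a, j)" by (cases l)
  show ?case using size_le_fmode[OF Cons, of "- int j - 1" s a] by (simp add: l fmode_def algebra_simps)
qed (simp add: size_le_bv)

text \<open>A normally ordered product is linear in each letter, so expanding the letters in the
  basis leaves the operator unchanged, although \<open>state A\<close> and \<open>bv A\<close> may
  be different vectors.\<close>

lemma fvertex_state: "fvertex (state A) p m = ffield A p m"
proof (induct A arbitrary: p m)
  case (Cons l A)
  obtain s a j where l: "l = (s, a, j)" by (cases l)
  obtain B where B: "size_le B m" using size_le_exists by blast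
  define K where "K = max B (p + int (Suc j) + word_size A + B)"
  have K: "B \<le> K" "p + int (Suc j) + word_size A + B \<le> K" by (auto simp: K_def)
  show ?case
    by (simp add: l fvertex_create[OF B size_le_state K] ffield_Cons[OF B K] Cons parity_state linmap_smul[OF linmap_fvertex_left'] cong: if_cong)
qed simp

text \<open>On the empty word the nonnegative modes vanish. Of the negative ones, those above
  \<open>-1 - j\<close> have coefficient 0, and those below leave a negative exponent for the
  remaining letters, where the induction hypothesis gives 0. Only \<open>-1 - j\<close>
  survives.\<close>

lemma ffield_vac: "p \<le> 0 \<Longrightarrow> ffield A p (bv []) = (if p = 0 then state A else 0)"
proof (induct A arbitrary: p)
  case Nil
  then show ?case by (simp add: ffield_Nil)
next
  case (Cons l A)
  obtain s :: species and a :: 'h and j where l: "l = (s, a, j)" by (cases l)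
  have vac: "size_le 0 (bv [])" by (simp add: size_le_bv)
  have z: "fmode s a n (bv []) = 0" if "\<not> n < 0" for n using that by (simp add: fmode_def)
  have *: "ffield ((s, a, j) # A) p (bv []) = (if p = 0 then state ((s, a, j) # A) else 0)" if that: "p \<le> 0" for p
  proof -
    define K where "K = max (int (Suc j)) (p + int (Suc j) + word_size A)"
    have K: "0 \<le> K" "p + int (Suc j) + word_size A + 0 \<le> K" by (auto simp: K_def)
    have "ffield ((s, a, j) # A) p (bv []) = (\<Sum>n\<in>{- K..K}. smul (fcoeff j n)
     (if n < 0 then fmode s a n (ffield A (p + n + 1 + int j) (bv [])) else 0))"
      by (subst ffield_Cons[OF vac K]) (auto intro!: sum.cong simp: z linmap_zero[OF linmap_ffield'])
    also have "\<dots> = (\<Sum>n\<in>{- K..K}. if n = - 1 - int j then (if p = 0 then state ((s, a, j) # A) else 0) else 0)"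
    proof (intro sum.cong refl)
      fix n
      consider "n \<ge> 0" | "n < 0" "n > - 1 - int j" | "n < - 1 - int j" | "n = - 1 - int j" by linarith
      then show "smul (fcoeff j n) (if n < 0 then fmode s a n (ffield A (p + n + 1 + int j) (bv [])) else 0)
        = (if n = - 1 - int j then (if p = 0 then state ((s, a, j) # A) else 0) else 0)"
      proof cases
        case 2
        then show ?thesis using fcoeff_eq_0[of j n] by simp
      next
        case 3
        then have "p + n + 1 + int j < 0" using that by simp
        then show ?thesis using 3 by (simp add: Cons(1) linmap_zero[OF linmap_fmode'])
      next
        case 4
        then show ?thesis using that by (cases "p = 0") (auto simp: Cons linmap_zero[OF linmap_create'] fmode_def simp flip: binomial_gbinomial)
      qed auto
    qed
    also have "\<dots> = (if p = 0 then state ((s, a, j) # A) else 0)"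
      by (simp add: K_def)
    finally show ?thesis .
  qed
  show ?case using *[OF Cons(2)] by (simp add: l)
qed

section \<open>Brackets of vertex operators with the weight operator and the derivation\<close>

lemma fweight_normal_op: "length ns = length A \<Longrightarrow>
  fweight (normal_op A ns m) = normal_op A ns (fweight m) + smul (of_int (exponent A ns) + of_rat (wt A)) (normal_op A ns m)"
proof (induct A ns m rule: normal_op.induct)
  case (1 s a j A n ns m)
  \<comment> \<open>\<open>-n - 1 - j\<close> from the exponent and \<open>j + 1 - |a|/2\<close>
    from the weight add up to \<open>- mode_wt s n\<close>.\<close>
  have *: "(of_int (exponent ((s, a, j) # A) (n # ns)) + of_rat (wt ((s, a, j) # A)) :: complex) =
     of_int (exponent A ns) + of_rat (wt A) - of_rat (mode_wt s n)"
    by (simp add: wt_def mode_wt_def letter_wt_def of_rat_add of_rat_diff of_rat_divide)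
  show ?case
  proof (cases "n < 0")
    case True
    then show ?thesis using 1 unfolding *
      by (simp add: fweight_fmode linmap_add[OF linmap_fmode'] linmap_smul[OF linmap_fmode'] algebra_simps smul.scale_left_diff_distrib)
  next
    case False
    have IH: "fweight (normal_op A ns (fmode s a n m)) = normal_op A ns (fweight (fmode s a n m))
        + smul (of_int (exponent A ns) + of_rat (wt A)) (normal_op A ns (fmode s a n m))"
      using 1(2)[OF False] 1(3) by simp
    show ?thesis using False unfolding *
      by (simp add: IH fweight_fmode linmap_smul[OF linmap_fweight'] linmap_diff[OF linmap_normal_op'] linmap_smul[OF linmap_normal_op'] algebra_simps
          smul.scale_left_diff_distrib smul.scale_right_distrib smul.scale_right_diff_distrib)
  qed
qed (auto simp: wt_def)

lemma fweight_ffield: "fweight (ffield A p m) = ffield A p (fweight m) + smul (of_int p + of_rat (wt A)) (ffield A p m)"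
proof -
  obtain B C where "size_le B m" "size_le C (fweight m)" using size_le_exists by blast
  then have B: "size_le (max B C) m" "size_le (max B C) (fweight m)" by (auto intro: size_le_mono)
  define K where "K = max (max B C) (p + word_size A + max B C)"
  have K: "max B C \<le> K" "p + word_size A + max B C \<le> K" by (auto simp: K_def)
  have "fweight (fterm A ns m) = fterm A ns (fweight m) + smul (of_int p + of_rat (wt A)) (fterm A ns m)" if "ns \<in> nbox A p K" for ns
    using that fweight_normal_op[of ns A m]
    by (simp add: nbox_def mode_indices_def fterm_def linmap_smul[OF linmap_fweight'] smul.scale_right_distrib mult.commute)
  then show ?thesis
    by (simp add: ffield_box[OF _ K] B linmap_sum[OF linmap_fweight'] sum.distrib smul.scale_sum_right)
qed

lemma fweight_bv: "fweight (bv w) = smul (of_rat (wt w)) (bv w)"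
  and fderivation_bv: "fderivation (bv w) = deriv_word w"
  by (simp_all add: fweight_def fderivation_def)

lemma fweight_fvertex: "fweight (fvertex u p m) = fvertex u p (fweight m) + smul (of_int p) (fvertex u p m) + fvertex (fweight u) p m"
  by (rule linmap_eqI[where m = u])
    (auto intro!: linmap_intros linmap_fvertex_left linmap_fvertex_right simp: fweight_ffield fweight_bv linmap_smul[OF linmap_fvertex_left']
      smul.scale_left_distrib add_ac)

text \<open>The commutator is computed termwise from \<open>D_fmode\<close> and the induction
  hypothesis. The terms with a lowered mode are shifted by one, after which the coefficients combine
  by \<open>fcoeff_shift\<close> to the single factor \<open>p + 1\<close>.\<close>

lemma D_ffield: "fderivation (ffield A p m) - ffield A p (fderivation m) = smul (of_int (p + 1)) (ffield A (p + 1) m)"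
proof (induct A arbitrary: p m)
  case Nil
  then show ?case by (cases "p = - 1") (auto simp: ffield_Nil linmap_zero[OF linmap_fderivation'])
next
  case (Cons l A)
  obtain s a j where l: "l = (s, a, j)" by (cases l)
  obtain B C where "size_le B m" "size_le C (fderivation m)" "B \<ge> 0" "C \<ge> 0" using size_le_exists by metis
  then have B: "size_le (max B C) m" "size_le (max B C) (fderivation m)" "max B C \<ge> 0" by (auto intro: size_le_mono)
  \<comment> \<open>The slack leaves room for the index shift below, where the boundary terms at
    \<open>K\<close> and \<open>-K - 1\<close> have to vanish.\<close>
  define K where "K = max (max B C) (\<bar>p\<bar> + 3 + int (Suc j) + word_size A + max B C) + 1"
  have K: "max B C \<le> K" "p + int (Suc j) + word_size A + max B C \<le> K" "p + 1 + int (Suc j) + word_size A + max B C \<le> K"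
    by (auto simp: K_def)
  define g where "g n q = (if n < 0 then fmode s a n (ffield A q m) else smul (ksigns s A) (ffield A q (fmode s a n m)))" for n q
  have split: "(if P then x else y) - (if P then x' else y') = (if P then x - x' else y - y')" for P and x y x' y' :: "'h fock"
    by simp
  have D1: "fderivation (ffield A q x) = ffield A q (fderivation x) + smul (of_int (q + 1)) (ffield A (q + 1) x)" for q x
    using Cons[of q x] by (simp add: algebra_simps)
  have "fderivation (ffield ((s, a, j) # A) p m) - ffield ((s, a, j) # A) p (fderivation m) =
     (\<Sum>n\<in>{- K..K}. smul (fcoeff j n) (smul (of_int (p + n + 2 + int j)) (g n (p + n + 2 + int j))
        - smul (of_int n) (g (n - 1) (p + n + 1 + int j))))"
    unfolding ffield_Cons[OF B(1) K(1,2)] ffield_Cons[OF B(2) K(1,2)] linmap_sum[OF linmap_fderivation'] sum_subtractf[symmetric]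
  proof (intro sum.cong refl)
    fix n
    let ?q = "p + n + 1 + int j"
    have q: "?q + 1 = p + n + 2 + int j" by simp
    show "fderivation (smul (fcoeff j n) (if n < 0 then fmode s a n (ffield A ?q m) else smul (ksigns s A) (ffield A ?q (fmode s a n m))))
        - smul (fcoeff j n) (if n < 0 then fmode s a n (ffield A ?q (fderivation m)) else smul (ksigns s A) (ffield A ?q (fmode s a n (fderivation m))))
      = smul (fcoeff j n) (smul (of_int (p + n + 2 + int j)) (g n (p + n + 2 + int j)) - smul (of_int n) (g (n - 1) ?q))"
    proof (cases "n < 0")
      case True
      have "fderivation (fmode s a n (ffield A ?q m)) - fmode s a n (ffield A ?q (fderivation m)) =
        smul (of_int (?q + 1)) (fmode s a n (ffield A (?q + 1) m)) - smul (of_int n) (fmode s a (n - 1) (ffield A ?q m))"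
        unfolding D_fmode D1 linmap_add[OF linmap_fmode'] linmap_smul[OF linmap_fmode'] by simp
      with True show ?thesis unfolding q g_def
        by (simp only: if_True linmap_smul[OF linmap_fderivation'] smul.scale_right_diff_distrib[symmetric]) simp
    next
      case False
      have "fderivation (ffield A ?q (fmode s a n m)) - ffield A ?q (fmode s a n (fderivation m)) =
        smul (of_int (?q + 1)) (ffield A (?q + 1) (fmode s a n m)) - smul (of_int n) (ffield A ?q (fmode s a (n - 1) m))"
        unfolding D_fmode D1 linmap_add[OF linmap_ffield'] linmap_smul[OF linmap_ffield'] by simp
      moreover have "smul (of_int n) (g (n - 1) ?q) = smul (ksigns s A) (smul (of_int n) (ffield A ?q (fmode s a (n - 1) m)))"
        using False by (cases "n = 0") (auto simp: g_def mult.commute)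
      moreover have "smul (of_int (p + n + 2 + int j)) (g n (p + n + 2 + int j))
         = smul (ksigns s A) (smul (of_int (?q + 1)) (ffield A (?q + 1) (fmode s a n m)))"
        unfolding q using False by (simp add: g_def mult.commute del: of_int_add)
      ultimately show ?thesis using False
        by (simp only: if_False linmap_smul[OF linmap_fderivation'] smul.scale_right_diff_distrib[symmetric])
    qed
  qed
  also have "\<dots> = (\<Sum>n\<in>{- K..K}. smul (fcoeff j n * of_int (p + n + 2 + int j)) (g n (p + n + 2 + int j)))
      - (\<Sum>n\<in>{- K..K}. smul (fcoeff j n * of_int n) (g (n - 1) (p + n + 1 + int j)))"
    by (simp add: smul.scale_right_diff_distrib sum_subtractf)
  also have "(\<Sum>n\<in>{- K..K}. smul (fcoeff j n * of_int n) (g (n - 1) (p + n + 1 + int j)))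
      = (\<Sum>n\<in>{- K - 1..K - 1}. smul (fcoeff j (n + 1) * of_int (n + 1)) (g n (p + n + 2 + int j)))"
    by (rule sum.reindex_bij_witness[of _ "\<lambda>n. n + 1" "\<lambda>n. n - 1"]) (auto simp: add_ac)
  \<comment> \<open>The original range may be restored: at \<open>n = K\<close> the mode annihilates
    \<open>m\<close>, and at \<open>n = -K - 1\<close> the remaining exponent lies below the lower
    truncation \<open>ffield_low\<close>.\<close>
  also have "\<dots> = (\<Sum>n\<in>{- K..K}. smul (fcoeff j (n + 1) * of_int (n + 1)) (g n (p + n + 2 + int j)))"
  proof (rule sum.mono_neutral_cong)
    fix n assume "n \<in> {- K..K} - {- K - 1..K - 1}"
    then have "n = K" by auto
    then have "fmode s a n m = 0" "\<not> n < 0" using B by (auto intro!: fmode_eq_0[OF B(1)] simp: K_def)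
    then show "smul (fcoeff j (n + 1) * of_int (n + 1)) (g n (p + n + 2 + int j)) = 0" by (simp add: g_def linmap_zero[OF linmap_ffield'])
  next
    fix n assume "n \<in> {- K - 1..K - 1} - {- K..K}"
    then have "n = - K - 1" by auto
    then have "n < 0" "p + n + 2 + int j + word_size A + max B C < 0" using B word_size_nonneg[of A] by (auto simp: K_def)
    then show "smul (fcoeff j (n + 1) * of_int (n + 1)) (g n (p + n + 2 + int j)) = 0"
      by (simp add: g_def ffield_low[OF B(1)] linmap_zero[OF linmap_fmode'])
  qed auto
  also have "(\<Sum>n\<in>{- K..K}. smul (fcoeff j n * of_int (p + n + 2 + int j)) (g n (p + n + 2 + int j))) - \<dots>
    = (\<Sum>n\<in>{- K..K}. smul (of_int (p + 1)) (smul (fcoeff j n) (g n (p + n + 2 + int j))))"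
    unfolding sum_subtractf[symmetric] smul.scale_left_diff_distrib[symmetric] smul.scale_scale
  proof (intro sum.cong refl arg_cong2[of _ _ _ _ smul])
    fix n
    have "fcoeff j (n + 1) * of_int (n + 1) = of_int (n + 1 + int j) * fcoeff j n" using fcoeff_shift[of n j] by (simp only: mult.commute)
    then show "fcoeff j n * of_int (p + n + 2 + int j) - fcoeff j (n + 1) * of_int (n + 1) = of_int (p + 1) * fcoeff j n"
      by (simp only:) (simp add: algebra_simps)
  qed
  also have "\<dots> = smul (of_int (p + 1)) (ffield ((s, a, j) # A) (p + 1) m)"
    unfolding ffield_Cons[OF B(1) K(1,3)] smul.scale_sum_right g_def by (intro sum.cong refl) (simp add: algebra_simps)
  finally show ?case unfolding l .
qed

lemma D_fvertex: "fderivation (fvertex u p m) - fvertex u p (fderivation m) = smul (of_int (p + 1)) (fvertex u (p + 1) m)"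
  by (rule linmap_eqI[where m = u]) (auto intro!: linmap_intros linmap_fvertex_left simp: D_ffield)

lemma size_le_deriv_word: "size_le (word_size w + 1) (deriv_word w)"
proof (induct w)
  case (Cons l w)
  obtain s b j where l: "l = (s, b, j)" by (cases l)
  show ?case using size_le_prepend[OF Cons, of l] by (auto simp: l add_ac intro!: size_le_add size_le_smul size_le_bv[THEN iffD2])
qed simp

lemma parity_deriv_word: "parity s (deriv_word w) = smul (ksigns s w) (deriv_word w)"
proof (induct w)
  case (Cons l w)
  obtain t b j where l: "l = (t, b, j)" by (cases l)
  show ?case
    unfolding l deriv_word.simps linmap_add[OF linmap_parity'] linmap_smul[OF linmap_parity'] parity_prepend Cons linmap_smul[OF linmap_prepend']
    by (simp add: parity_def smul.scale_right_distrib mult_ac)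
qed (simp add: parity_def)

text \<open>Leibniz rule: the derivation of the first letter differentiates its field by
  \<open>fcoeff_Suc\<close>, the rest is the induction hypothesis, and the two factors add up to
  \<open>p + 1\<close>.\<close>

lemma fvertex_deriv_word: "fvertex (deriv_word A) p m = smul (of_int (p + 1)) (ffield A (p + 1) m)"
proof (induct A arbitrary: p m)
  case Nil
  then show ?case by (cases "p = - 1") (auto simp: ffield_Nil fvertex_def)
next
  case (Cons l A)
  obtain s a j where l: "l = (s, a, j)" by (cases l)
  obtain B where B: "size_le B m" using size_le_exists by blast
  define K where "K = max B (\<bar>p\<bar> + 4 + int (Suc j) + word_size A + B)"
  have K: "B \<le> K" "p + int (Suc (Suc j)) + word_size A + B \<le> K" "p + int (Suc j) + (word_size A + 1) + B \<le> K"
    "p + 1 + int (Suc j) + word_size A + B \<le> K"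
    by (auto simp: K_def)
  define g where "g n q = (if n < 0 then fmode s a n (ffield A q m) else smul (ksigns s A) (ffield A q (fmode s a n m)))" for n q
  \<comment> \<open>\<open>deriv_word\<close> prepends raw letters, so the recursion is required for
    \<open>prepend\<close> and not for \<open>create\<close>.\<close>
  have lp: "fvertex (prepend (s, a, j) u) p m = (\<Sum>n\<in>{- K..K}. smul (fcoeff j n)
     (if n < 0 then fmode s a n (fvertex u (p + n + 1 + int j) m)
      else fvertex (parity s u) (p + n + 1 + int j) (fmode s a n m)))" if "size_le (word_size A + 1) u" for u
  proof (rule linmap_eqI[where m = u])
    fix w assume "w \<in> Poly_Mapping.keys u"
    then have "word_size w \<le> word_size A + 1" using that by (auto simp: size_le_word_size)
    then show "fvertex (prepend (s, a, j) (bv w)) p m = (\<Sum>n\<in>{- K..K}. smul (fcoeff j n)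
     (if n < 0 then fmode s a n (fvertex (bv w) (p + n + 1 + int j) m)
      else fvertex (parity s (bv w)) (p + n + 1 + int j) (fmode s a n m)))"
      using B K ffield_Cons[of B m K p j w s a] by (simp add: parity_def linmap_smul[OF linmap_fvertex_left'] cong: if_cong)
  qed (intro linmap_fvertex_left linmap_intros)+
  have "fvertex (deriv_word (l # A)) p m = smul (of_nat (Suc j)) (ffield ((s, a, Suc j) # A) p m) + fvertex (prepend (s, a, j) (deriv_word A)) p m"
    unfolding l deriv_word.simps linmap_add[OF linmap_fvertex_left'] linmap_smul[OF linmap_fvertex_left'] fvertex_bv ..
  also have "\<dots> = (\<Sum>n\<in>{- K..K}. smul (of_nat (Suc j) * fcoeff (Suc j) n) (g n (p + n + 2 + int j)))
     + (\<Sum>n\<in>{- K..K}. smul (fcoeff j n * of_int (p + n + 2 + int j)) (g n (p + n + 2 + int j)))"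
  proof (intro arg_cong2[of _ _ _ _ "(+)"])
    show "smul (of_nat (Suc j)) (ffield ((s, a, Suc j) # A) p m) =
       (\<Sum>n\<in>{- K..K}. smul (of_nat (Suc j) * fcoeff (Suc j) n) (g n (p + n + 2 + int j)))"
      unfolding ffield_Cons[OF B K(1,2)] smul.scale_sum_right g_def
      by (intro sum.cong refl) (simp add: algebra_simps)
    show "fvertex (prepend (s, a, j) (deriv_word A)) p m =
       (\<Sum>n\<in>{- K..K}. smul (fcoeff j n * of_int (p + n + 2 + int j)) (g n (p + n + 2 + int j)))"
      unfolding lp[OF size_le_deriv_word] parity_deriv_word
    proof (intro sum.cong refl)
      fix n
      have q: "p + n + 1 + int j + 1 = p + n + 2 + int j" by simp
      show "smul (fcoeff j n) (if n < 0 then fmode s a n (fvertex (deriv_word A) (p + n + 1 + int j) m)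
          else fvertex (smul (ksigns s A) (deriv_word A)) (p + n + 1 + int j) (fmode s a n m)) =
        smul (fcoeff j n * of_int (p + n + 2 + int j)) (g n (p + n + 2 + int j))"
        unfolding linmap_smul[OF linmap_fvertex_left'] Cons q g_def
        by (simp add: linmap_smul[OF linmap_fmode'] mult_ac del: of_int_add)
    qed
  qed
  also have "\<dots> = (\<Sum>n\<in>{- K..K}. smul (of_int (p + 1)) (smul (fcoeff j n) (g n (p + n + 2 + int j))))"
    unfolding sum.distrib[symmetric] smul.scale_left_distrib[symmetric] smul.scale_scale
  proof (intro sum.cong refl arg_cong2[of _ _ _ _ smul])
    fix n
    show "of_nat (Suc j) * fcoeff (Suc j) n + fcoeff j n * of_int (p + n + 2 + int j) = of_int (p + 1) * fcoeff j n"
      unfolding fcoeff_Suc by (simp add: algebra_simps)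
  qed
  also have "\<dots> = smul (of_int (p + 1)) (ffield ((s, a, j) # A) (p + 1) m)"
    unfolding ffield_Cons[OF B K(1,4)] smul.scale_sum_right g_def by (intro sum.cong refl) (simp add: algebra_simps)
  finally show ?case unfolding l .
qed

lemma D_fvertex_left: "fvertex (fderivation u) p m = smul (of_int (p + 1)) (fvertex u (p + 1) m)"
  by (rule linmap_eqI[where m = u]) (auto intro!: linmap_intros linmap_fvertex_left simp: fvertex_deriv_word fderivation_bv)

end

section \<open>Absolutely convergent sums and rational functions\<close>

text \<open>Over the complex numbers unordered sums converge absolutely, which supplies summability
  on the product set.\<close>

lemma has_sum_prod:
  fixes f :: "'i \<Rightarrow> complex" and g :: "'j \<Rightarrow> complex"
  assumes "(f has_sum s) A" "(g has_sum t) B"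
  shows "((\<lambda>(i, j). f i * g j) has_sum s * t) (A \<times> B)"
proof (rule has_sum_SigmaI)
  show "((\<lambda>y. case (x, y) of (i, j) \<Rightarrow> f i * g j) has_sum f x * t) B" for x
    using has_sum_cmult_right[OF assms(2), of "f x"] by simp
  show "((\<lambda>x. f x * t) has_sum s * t) A"
    using has_sum_cmult_left[OF assms(1), of t] by simp
  have "(\<lambda>x. norm (f x)) summable_on A" "(\<lambda>x. norm (g x)) summable_on B"
    using assms by (auto simp: summable_on_iff_abs_summable_on_complex dest!: has_sum_imp_summable)
  then have "(\<lambda>x. norm (case x of (i, j) \<Rightarrow> f i * g j)) summable_on A \<times> B"
    unfolding Infinite_Sum.abs_summable_on_Sigma_iff[where f = "\<lambda>(i, j). f i * g j"]
    by (auto simp: norm_mult infsum_cmult_right' abs_mult intro!: summable_on_cmult_right summable_on_cmult_left)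
  then show "(\<lambda>(i, j). f i * g j) summable_on A \<times> B"
    by (rule abs_summable_summable)
qed

text \<open>The shape of all sums below in which a functional or a vector cuts one infinite range of
  modes down to a finite one.\<close>

lemma has_sum_slices:
  fixes f :: "'n \<Rightarrow> 'i \<Rightarrow> complex"
  assumes "finite F" "\<And>n. n \<in> F \<Longrightarrow> (f n has_sum s n) J"
    and "\<And>n i. n \<notin> F \<Longrightarrow> i \<in> J \<Longrightarrow> f n i = 0"
  shows "((\<lambda>(n, i). f n i) has_sum sum s F) (UNIV \<times> J)"
proof -
  have "((\<lambda>(n, i). f n i) has_sum sum s F) (F \<times> J)"
    using assms(1,2)
  proof (induct F rule: finite_induct)
    case (insert n F)
    have "((\<lambda>(n, i). f n i) has_sum s n) ((\<lambda>i. (n, i)) ` J)"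
      by (subst has_sum_reindex) (use insert(4)[of n] in \<open>auto simp: inj_on_def comp_def\<close>)
    then have "((\<lambda>(n, i). f n i) has_sum s n + sum s F) ((\<lambda>i. (n, i)) ` J \<union> F \<times> J)"
      using insert by (intro has_sum_Un_disjoint) auto
    moreover have "(\<lambda>i. (n, i)) ` J \<union> F \<times> J = insert n F \<times> J" by auto
    ultimately show ?case using insert by simp
  qed simp
  moreover have "((\<lambda>(n, i). f n i) has_sum sum s F) (F \<times> J) \<longleftrightarrow> ((\<lambda>(n, i). f n i) has_sum sum s F) (UNIV \<times> J)"
    by (rule has_sum_cong_neutral) (use assms(3) in auto)
  ultimately show ?thesis by simp
qed

lemma has_sum_binomial:
  fixes x z :: complex
  assumes "norm x < norm z"
  shows "((\<lambda>i. (of_int e gchoose i) * x ^ i * z powi (e - int i)) has_sum (z + x) powi e) UNIV"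
proof -
  have z: "z \<noteq> 0" using assms by auto
  define w where "w = x / z"
  have w: "norm w < 1" using assms z by (simp add: w_def norm_divide)
  \<comment> \<open>An intermediate radius: convergence at \<open>y\<close> gives absolute
    convergence at the smaller \<open>w\<close>.\<close>
  define y :: complex where "y = of_real ((norm w + 1) / 2)"
  have y: "norm w < norm y" "norm y < 1"
    unfolding y_def norm_of_real using w by auto
  have "summable (\<lambda>n. norm ((of_int e gchoose n :: complex) * w ^ n))"
    by (rule powser_insidea[OF sums_summable[OF gen_binomial_complex[OF y(2)]] y(1)])
  then have "((\<lambda>n. (of_int e gchoose n) * w ^ n) has_sum (1 + w) powr of_int e) UNIV"
    using gen_binomial_complex[OF w] by (intro norm_summable_imp_has_sum)
  moreover have "1 + w \<noteq> 0"
    using w by (metis add.commute add_cancel_left_right add_eq_0_iff norm_minus_cancel norm_one order_less_irrefl)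
  then have "(1 + w) powr of_int e = (1 + w) powi e" by (simp add: complex_powr_of_int)
  ultimately have "((\<lambda>n. z powi e * ((of_int e gchoose n) * w ^ n)) has_sum z powi e * (1 + w) powi e) UNIV"
    by (intro has_sum_cmult_right) simp
  moreover have "z powi e * (1 + w) powi e = (z + x) powi e"
    using z by (simp flip: power_int_mult_distrib add: w_def distrib_left)
  moreover have "z powi e * ((of_int e gchoose n) * w ^ n) = (of_int e gchoose n) * x ^ n * z powi (e - int n)" for n
    using z by (simp add: w_def power_divide power_int_diff)
  ultimately show ?thesis by simp
qed

text \<open>The form in which contractions occur. The coefficients are
  \<open>(- N - 1) gchoose k\<close> up to a sign (-1)^k, which is absorbed into
  \<open>- w\<close>.\<close>

lemma has_sum_neg_binomial:
  fixes w z :: complex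
  assumes "norm w < norm z"
  shows "((\<lambda>k. of_nat (k + N choose k) * w ^ k * z powi (- int k - int N - 1)) has_sum (z - w) powi (- int N - 1)) UNIV"
proof -
  have g: "((of_int (- int N - 1) :: complex) gchoose k) = (- 1) ^ k * of_nat (k + N choose k)" for k
  proof -
    have "of_nat k - of_int (- int N - 1) - 1 = (of_nat (k + N) :: complex)" by simp
    then show ?thesis by (subst gbinomial_negated_upper) (simp add: binomial_gbinomial del: of_nat_add of_int_diff)
  qed
  then have "(of_int (- int N - 1) gchoose k) * (- w) ^ k * z powi (- int N - 1 - int k) =
     of_nat (k + N choose k) * w ^ k * z powi (- int k - int N - 1)" for k
  proof -
    have "- int N - 1 - int k = - int k - int N - 1" by simp
    then show ?thesis
      unfolding g power_minus[of w] by (simp only: mult_ac) (simp flip: power_mult_distrib mult.assoc)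
  qed
  then show ?thesis using has_sum_binomial[of "- w" z "- int N - 1"] assms by (simp only: norm_minus_cancel add_uminus_conv_diff)
qed

definition admissible :: "nat \<Rightarrow> complex list \<Rightarrow> bool" where
  "admissible n zs \<longleftrightarrow> length zs = n \<and> 0 \<notin> set zs \<and> distinct zs"

text \<open>A function given by any formula is compared with a quotient of polynomials at admissible
  points only, so sums and products can be formed before a common denominator is chosen.\<close>

definition rational_on :: "nat \<Rightarrow> (complex list \<Rightarrow> complex) \<Rightarrow> bool" where
  "rational_on n f \<longleftrightarrow> (\<exists>P Q. polyfun n P \<and> polyfun n Q \<and> (\<forall>zs. admissible n zs \<longrightarrow> Q zs \<noteq> 0 \<and> f zs = P zs / Q zs))"

lemma rational_on_polyfun: "polyfun n f \<Longrightarrow> rational_on n f"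
  unfolding rational_on_def by (intro exI[of _ f] exI[of _ "\<lambda>_. 1"]) (auto intro: polyfun.intros)

lemma rational_on_const [intro]: "rational_on n (\<lambda>zs. c)"
  by (intro rational_on_polyfun polyfun.intros)

lemma rational_on_mult:
  assumes "rational_on n f" "rational_on n g"
  shows "rational_on n (\<lambda>zs. f zs * g zs)"
proof -
  obtain P Q P' Q' where "polyfun n P" "polyfun n Q" "polyfun n P'" "polyfun n Q'"
    "\<forall>zs. admissible n zs \<longrightarrow> Q zs \<noteq> 0 \<and> f zs = P zs / Q zs" "\<forall>zs. admissible n zs \<longrightarrow> Q' zs \<noteq> 0 \<and> g zs = P' zs / Q' zs"
    using assms by (auto simp: rational_on_def)
  then show ?thesis unfolding rational_on_def
    by (intro exI[of _ "\<lambda>zs. P zs * P' zs"] exI[of _ "\<lambda>zs. Q zs * Q' zs"]) (auto intro: polyfun.intros)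
qed

lemma rational_on_add:
  assumes "rational_on n f" "rational_on n g"
  shows "rational_on n (\<lambda>zs. f zs + g zs)"
proof -
  obtain P Q P' Q' where "polyfun n P" "polyfun n Q" "polyfun n P'" "polyfun n Q'"
    "\<forall>zs. admissible n zs \<longrightarrow> Q zs \<noteq> 0 \<and> f zs = P zs / Q zs" "\<forall>zs. admissible n zs \<longrightarrow> Q' zs \<noteq> 0 \<and> g zs = P' zs / Q' zs"
    using assms by (auto simp: rational_on_def)
  then show ?thesis unfolding rational_on_def
    by (intro exI[of _ "\<lambda>zs. P zs * Q' zs + P' zs * Q zs"] exI[of _ "\<lambda>zs. Q zs * Q' zs"])
      (auto intro: polyfun.intros simp: add_frac_eq)
qed

lemma rational_on_sum: "(\<And>i. i \<in> S \<Longrightarrow> rational_on n (f i)) \<Longrightarrow> rational_on n (\<lambda>zs. \<Sum>i\<in>S. f i zs)"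
  by (induct S rule: infinite_finite_induct) (auto intro: rational_on_add)

lemma polyfun_power: "polyfun n f \<Longrightarrow> polyfun n (\<lambda>zs. f zs ^ k)"
  by (induct k) (auto intro: polyfun.intros)

lemma rational_on_powi_polyfun:
  assumes "polyfun n f" "\<And>zs. admissible n zs \<Longrightarrow> f zs \<noteq> 0"
  shows "rational_on n (\<lambda>zs. f zs powi k)"
proof (cases "k \<ge> 0")
  case True
  then show ?thesis using assms by (auto simp: power_int_def intro: rational_on_polyfun polyfun_power)
next
  case False
  then show ?thesis using assms unfolding rational_on_def
    by (intro exI[of _ "\<lambda>_. 1"] exI[of _ "\<lambda>zs. f zs ^ nat (- k)"])
      (auto simp: power_int_def field_simps intro: polyfun.intros polyfun_power)
qed

lemma rational_on_powi: "i < n \<Longrightarrow> rational_on n (\<lambda>zs. (zs ! i) powi k)"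
  by (rule rational_on_powi_polyfun) (auto simp: admissible_def in_set_conv_nth intro: polyfun.intros)

lemma rational_on_diff_powi: "i < n \<Longrightarrow> j < n \<Longrightarrow> i \<noteq> j \<Longrightarrow> rational_on n (\<lambda>zs. (zs ! i - zs ! j) powi k)"
proof (rule rational_on_powi_polyfun)
  assume "i < n" "j < n"
  then have "polyfun n (\<lambda>zs. zs ! i + (- 1) * zs ! j)" by (intro polyfun.intros)
  then show "polyfun n (\<lambda>zs. zs ! i - zs ! j)" by simp
qed (auto simp: admissible_def nth_eq_iff_index_eq)

text \<open>Absolute convergence comes for free: for complex terms summability and absolute
  summability agree.\<close>

lemma converges_to_rationalI:
  assumes "rational_on n f" "\<And>zs. length zs = n \<Longrightarrow> R zs \<Longrightarrow> admissible n zs"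
    and "\<And>zs. length zs = n \<Longrightarrow> R zs \<Longrightarrow> (t zs has_sum f zs) A"
  shows "converges_to_rational n R A t"
proof -
  obtain P Q where PQ: "polyfun n P" "polyfun n Q" "\<And>zs. admissible n zs \<Longrightarrow> Q zs \<noteq> 0 \<and> f zs = P zs / Q zs"
    using assms(1) by (auto simp: rational_on_def)
  have "(\<lambda>i. norm (t zs i)) summable_on A \<and> (t zs has_sum (P zs / Q zs)) A" if "length zs = n" "R zs" for zs
    using assms(2,3)[OF that] PQ(3)[of zs]
    by (metis has_sum_imp_summable summable_on_iff_abs_summable_on_complex)
  then show ?thesis unfolding converges_to_rational_def
    by (intro exI[of _ P] exI[of _ Q]) (use PQ in \<open>auto simp: admissible_def\<close>)
qed

definition delete_at :: "nat \<Rightarrow> 'a list \<Rightarrow> 'a list" where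
  "delete_at j xs = take j xs @ drop (Suc j) xs"

definition insert_at :: "nat \<Rightarrow> 'a \<Rightarrow> 'a list \<Rightarrow> 'a list" where
  "insert_at j x xs = take j xs @ x # drop j xs"

lemma delete_at_Cons [simp]: "delete_at 0 (x # xs) = xs" "delete_at (Suc j) (x # xs) = x # delete_at j xs"
  by (simp_all add: delete_at_def)

lemma length_delete_at: "j < length xs \<Longrightarrow> length (delete_at j xs) = length xs - 1"
  and length_insert_at: "j \<le> length xs \<Longrightarrow> length (insert_at j x xs) = Suc (length xs)"
  and insert_at_nth: "j \<le> length xs \<Longrightarrow> insert_at j x xs ! j = x"
  and delete_at_insert_at: "j \<le> length xs \<Longrightarrow> delete_at j (insert_at j x xs) = xs"
  and insert_at_delete_at: "j < length xs \<Longrightarrow> insert_at j (xs ! j) (delete_at j xs) = xs"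
  by (auto simp: delete_at_def insert_at_def min_def nth_append id_take_nth_drop[symmetric])

lemma has_sum_finite_sum:
  fixes f :: "'j \<Rightarrow> 'i \<Rightarrow> complex"
  shows "finite S \<Longrightarrow> (\<And>j. j \<in> S \<Longrightarrow> (f j has_sum s j) A) \<Longrightarrow> ((\<lambda>i. \<Sum>j\<in>S. f j i) has_sum sum s S) A"
  by (induct S rule: finite_induct) (auto intro: has_sum_add)

section \<open>Moving the nonnegative part of a field to the right\<close>

context bilinear_form_space
begin

definition mode_coeff :: "'h letter \<Rightarrow> complex \<Rightarrow> int \<Rightarrow> complex" where
  "mode_coeff x z n = fcoeff (snd (snd x)) n * z powi (- n - 1 - int (snd (snd x)))"

definition mode_term :: "complex \<Rightarrow> 'h letter \<Rightarrow> int \<Rightarrow> 'h fock \<Rightarrow> 'h fock" where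
  "mode_term z x n w = smul (mode_coeff x z n) (fmode (fst x) (fst (snd x)) n w)"

text \<open>Extending by 0 to the negative modes lets the sums run over all integers, which keeps
  reindexing simple.\<close>

definition nonneg_term :: "complex \<Rightarrow> 'h letter \<Rightarrow> int \<Rightarrow> 'h fock \<Rightarrow> 'h fock" where
  "nonneg_term z x n w = (if n < 0 then 0 else mode_term z x n w)"

text \<open>\<open>normal_op\<close> with coefficients and powers of \<open>z\<close> distributed
  over the single modes, so that the contraction of a pair of modes carries its own factors and can
  be summed in closed form.\<close>

fun group_op :: "complex \<Rightarrow> 'h letter list \<Rightarrow> int list \<Rightarrow> 'h fock \<Rightarrow> 'h fock" where
  "group_op z (x # A) (n # ns) w =
     (if n < 0 then mode_term z x n (group_op z A ns w) else smul (ksigns (fst x) A) (group_op z A ns (mode_term z x n w)))"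
| "group_op _ _ _ w = w"

lemma linmap_mode_term [linmap_intros]: "linmap f \<Longrightarrow> linmap (\<lambda>m. mode_term z x n (f m))"
  unfolding mode_term_def by (intro linmap_intros)

lemma linmap_nonneg_term [linmap_intros]: "linmap f \<Longrightarrow> linmap (\<lambda>m. nonneg_term z x n (f m))"
  unfolding nonneg_term_def by (intro linmap_intros)

lemma linmap_group_op [linmap_intros]: "linmap f \<Longrightarrow> linmap (\<lambda>m. group_op z A ns (f m))"
proof (induct A ns arbitrary: f rule: list_induct2')
  case (4 x A n ns)
  then show ?case by (cases "n < 0") (auto intro!: linmap_mode_term linmap_smulI)
qed auto

lemmas linmap_mode_term' = linmap_mode_term[OF linmap_id] and linmap_nonneg_term' = linmap_nonneg_term[OF linmap_id] and linmap_group_op' = linmap_group_op[OF linmap_id]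

lemma group_op_fterm: "length ns = length A \<Longrightarrow> z \<noteq> 0 \<Longrightarrow> group_op z A ns w = smul (z powi exponent A ns) (fterm A ns w)"
proof (induct ns A arbitrary: w rule: list_induct2)
  case (Cons n ns x A)
  obtain s a j where x: "x = (s, a, j)" by (cases x)
  show ?case
    using Cons(1,3) Cons(2)[of w] Cons(2)[of "fmode s a n w"]
    by (simp add: x mode_term_def mode_coeff_def fterm_Cons linmap_smul[OF linmap_fmode'] linmap_smul[OF linmap_group_op'] power_int_add mult_ac)
qed (simp add: fterm_def)

text \<open>
  The contribution of the modes \<open>n\<close> of \<open>x\<close> and \<open>n'\<close> of \<open>y\<close> to the supercommutator of the nonnegative
  part of the field of \<open>x\<close> at \<open>z\<close> with the field of \<open>y\<close> at \<open>z'\<close>.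
\<close>

definition contraction :: "complex \<Rightarrow> 'h letter \<Rightarrow> complex \<Rightarrow> 'h letter \<Rightarrow> int \<Rightarrow> int \<Rightarrow> complex" where
  "contraction z x z' y n n' = (if 0 \<le> n \<and> n' < 0 then mode_coeff x z n * mode_coeff y z' n' *
     pairing (fst x) (fst (snd x)) (nat n) (fst y) (fst (snd y)) (nat (- n' - 1)) else 0)"

lemma mode_term_mode_term_neg: "0 \<le> n \<Longrightarrow> n' < 0 \<Longrightarrow>
    mode_term z x n (mode_term z' y n' u) = smul (contraction z x z' y n n') u + smul (ksign (fst x) (fst y)) (mode_term z' y n' (mode_term z x n u))"
  by (simp add: mode_term_def fmode_def linmap_smul[OF linmap_annih'] linmap_smul[OF linmap_create'] annih_create contraction_def smul.scale_right_distrib mult_ac)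

lemma mode_term_mode_term_pos: "0 \<le> n \<Longrightarrow> 0 \<le> n' \<Longrightarrow>
    mode_term z x n (mode_term z' y n' u) = smul (ksign (fst x) (fst y)) (mode_term z' y n' (mode_term z x n u))"
  using annih_annih[of "fst x" "fst (snd x)" "nat n" "fst y" "fst (snd y)" "nat n'" u]
  by (simp add: mode_term_def fmode_def linmap_smul[OF linmap_annih'] mult_ac)

text \<open>A nonzero contraction needs equal species, so the sign of the letter
  \<open>B ! j\<close> may be replaced by that of \<open>x\<close>.\<close>

lemma contraction_ksigns: "j < length B \<Longrightarrow>
  ksigns t B * contraction z x z' (B ! j) n k = ksign t (fst x) * ksigns t (delete_at j B) * contraction z x z' (B ! j) n k"
proof (cases "fst (B ! j) = fst x")
  case True
  assume "j < length B"
  then have "ksigns t B = ksigns t (take j B @ B ! j # drop (Suc j) B)" by (simp only: id_take_nth_drop[symmetric])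
  then show ?thesis using True by (simp add: delete_at_def)
next
  case False
  then show ?thesis by (simp add: contraction_def pairing_def)
qed

text \<open>Wick expansion of one nonnegative mode against a normally ordered group: it passes every
  letter with its Koszul sign and is contracted once with each letter whose mode is
  negative.\<close>

lemma mode_term_group_op:
  "length ns = length B \<Longrightarrow> 0 \<le> n \<Longrightarrow> mode_term z x n (group_op z' B ns w) =
     smul (ksigns (fst x) B) (group_op z' B ns (mode_term z x n w)) +
     (\<Sum>j<length B. smul (ksigns (fst x) (take j B) * contraction z x z' (B ! j) n (ns ! j)) (group_op z' (delete_at j B) (delete_at j ns) w))"
proof (induct ns B arbitrary: w rule: list_induct2)
  case (Cons k ns y B)
  let ?s = "fst x" and ?t = "fst y"
  let ?S = "\<lambda>w. \<Sum>j<length B. smul (ksigns ?s (take j B) * contraction z x z' (B ! j) n (ns ! j)) (group_op z' (delete_at j B) (delete_at j ns) w)"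
  note IH = Cons(2)[OF Cons(3)]
  show ?case
  proof (cases "k < 0")
    case True
    have "mode_term z x n (group_op z' (y # B) (k # ns) w) =
      smul (contraction z x z' y n k) (group_op z' B ns w) + smul (ksign ?s ?t) (mode_term z' y k (mode_term z x n (group_op z' B ns w)))"
      using True Cons(3) by (simp add: mode_term_mode_term_neg)
    also have "mode_term z' y k (mode_term z x n (group_op z' B ns w)) =
      smul (ksigns ?s B) (group_op z' (y # B) (k # ns) (mode_term z x n w)) +
      (\<Sum>j<length B. smul (ksigns ?s (take j B) * contraction z x z' (B ! j) n (ns ! j)) (group_op z' (y # delete_at j B) (k # delete_at j ns) w))"
      using True by (simp add: IH linmap_add[OF linmap_mode_term'] linmap_smul[OF linmap_mode_term'] linmap_sum[OF linmap_mode_term'])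
    finally show ?thesis
      unfolding length_Cons sum.lessThan_Suc_shift
      by (simp add: smul.scale_right_distrib smul.scale_sum_right mult_ac add_ac)
  next
    case False
    have "mode_term z x n (group_op z' (y # B) (k # ns) w) = smul (ksigns ?t B)
       (smul (ksigns ?s B) (group_op z' B ns (mode_term z x n (mode_term z' y k w))) + ?S (mode_term z' y k w))"
      using False by (simp add: IH linmap_smul[OF linmap_mode_term'])
    also have "\<dots> = smul (ksigns ?s (y # B)) (group_op z' (y # B) (k # ns) (mode_term z x n w))
       + smul (ksigns ?t B) (?S (mode_term z' y k w))"
      using False Cons(3) by (simp add: smul.scale_right_distrib mode_term_mode_term_pos[of n k z x z' y w] linmap_smul[OF linmap_group_op'] mult_ac)
    \<comment> \<open>The mode of \<open>y\<close> acts to the right of \<open>B\<close>. Its sign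
      counts all of \<open>B\<close> before the contraction and \<open>B\<close> without letter
      \<open>j\<close> after it; \<open>contraction_ksigns\<close> accounts for the
      difference.\<close>
    also have "smul (ksigns ?t B) (?S (mode_term z' y k w)) =
       (\<Sum>j<length B. smul (ksigns ?s (take (Suc j) (y # B)) * contraction z x z' (B ! j) n (ns ! j)) (group_op z' (y # delete_at j B) (k # delete_at j ns) w))"
      unfolding smul.scale_sum_right smul.scale_scale
    proof (intro sum.cong refl)
      fix j assume "j \<in> {..<length B}"
      then have E: "ksigns ?t B * (ksigns ?s (take j B) * contraction z x z' (B ! j) n (ns ! j)) =
        ksigns ?s (take (Suc j) (y # B)) * contraction z x z' (B ! j) n (ns ! j) * ksigns ?t (delete_at j B)"
        using contraction_ksigns[of j B ?t z x z' n "ns ! j"] by (simp add: ksign_commute[of ?t] mult_ac)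
      show "smul (ksigns ?t B * (ksigns ?s (take j B) * contraction z x z' (B ! j) n (ns ! j))) (group_op z' (delete_at j B) (delete_at j ns) (mode_term z' y k w))
         = smul (ksigns ?s (take (Suc j) (y # B)) * contraction z x z' (B ! j) n (ns ! j)) (group_op z' (y # delete_at j B) (k # delete_at j ns) w)"
        unfolding E using False by simp
    qed
    finally show ?thesis
      using False unfolding length_Cons sum.lessThan_Suc_shift by (simp add: contraction_def[of _ _ _ y])
  qed
qed simp

lemma nonneg_term_group_op:
  "length ns = length B \<Longrightarrow> nonneg_term z x n (group_op z' B ns w) =
     smul (ksigns (fst x) B) (group_op z' B ns (nonneg_term z x n w)) +
     (\<Sum>j<length B. smul (ksigns (fst x) (take j B) * contraction z x z' (B ! j) n (ns ! j)) (group_op z' (delete_at j B) (delete_at j ns) w))"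
  using mode_term_group_op[of ns B n z x z' w] by (cases "n < 0") (auto simp: nonneg_term_def linmap_zero[OF linmap_group_op'] contraction_def)

text \<open>
  A group \<open>(i, A)\<close> is the normally ordered product of the fields of the letters of \<open>A\<close> at \<open>zs ! i\<close>.
\<close>

fun groups_op :: "complex list \<Rightarrow> (nat \<times> 'h letter list) list \<Rightarrow> int list list \<Rightarrow>
    'h fock \<Rightarrow> 'h fock" where
  "groups_op zs ((i, A) # Gs) (ns # Ns) m = group_op (zs ! i) A ns (groups_op zs Gs Ns m)"
| "groups_op _ _ _ m = m"

lemma linmap_groups_op [linmap_intros]: "linmap f \<Longrightarrow> linmap (\<lambda>m. groups_op zs Gs Ns (f m))"
  by (induct Gs Ns rule: list_induct2') (auto intro!: linmap_group_op)

lemmas linmap_groups_op' = linmap_groups_op[OF linmap_id]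

lemma groups_op_append: "length Ns = length Gs \<Longrightarrow> groups_op zs (Gs @ Gs') (Ns @ Ns') m = groups_op zs Gs Ns (groups_op zs Gs' Ns' m)"
  by (induct Ns Gs rule: list_induct2) auto

definition group_indices :: "(nat \<times> 'h letter list) list \<Rightarrow> int list list set" where
  "group_indices Gs = {Ns. map length Ns = map (\<lambda>G. length (snd G)) Gs}"

lemma group_indices_Nil [simp]: "group_indices [] = {[]}"
  by (auto simp: group_indices_def)

lemma group_indices_length: "Ns \<in> group_indices Gs \<Longrightarrow> length Ns = length Gs"
  unfolding group_indices_def using map_eq_imp_length_eq by blast

lemma group_indices_Cons: "Ns \<in> group_indices (G # Gs) \<longleftrightarrow> (\<exists>ns Ns'. Ns = ns # Ns' \<and> length ns = length (snd G) \<and> Ns' \<in> group_indices Gs)"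
  by (auto simp: group_indices_def)

lemma group_indices_append: "Ns \<in> group_indices (Gs @ Gs') \<longleftrightarrow> (\<exists>Ns1 Ns2. Ns = Ns1 @ Ns2 \<and> Ns1 \<in> group_indices Gs \<and> Ns2 \<in> group_indices Gs')"
proof
  assume "Ns \<in> group_indices (Gs @ Gs')"
  then obtain Ns1 Ns2 where "Ns = Ns1 @ Ns2" "map length Ns1 = map (\<lambda>G. length (snd G)) Gs"
    "map length Ns2 = map (\<lambda>G. length (snd G)) Gs'"
    unfolding group_indices_def mem_Collect_eq map_append map_eq_append_conv by metis
  then show "\<exists>Ns1 Ns2. Ns = Ns1 @ Ns2 \<and> Ns1 \<in> group_indices Gs \<and> Ns2 \<in> group_indices Gs'" by (auto simp: group_indices_def)
qed (auto simp: group_indices_def)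

lemma group_indices_mid: "N1 \<in> group_indices Bs \<Longrightarrow> length ns = length (snd G) \<Longrightarrow> N2 \<in> group_indices As \<Longrightarrow> N1 @ ns # N2 \<in> group_indices (Bs @ G # As)"
  by (auto simp: group_indices_def)

text \<open>
  The nonnegative part of the field of \<open>x\<close> at \<open>z\<close>, in transit from left to right, has passed the
  groups \<open>Bs\<close> and still has the groups \<open>As\<close> in front of it.
\<close>

definition transport :: "complex list \<Rightarrow> ('h fock \<Rightarrow> complex) \<Rightarrow> complex \<Rightarrow> 'h letter \<Rightarrow>
    (nat \<times> 'h letter list) list \<Rightarrow> (nat \<times> 'h letter list) list \<Rightarrow> 'h fock \<Rightarrow> int \<times> int list list \<Rightarrow> complex" where
  "transport zs \<phi> z x Bs As m = (\<lambda>(n, Ns). \<phi> (groups_op zs Bs (take (length Bs) Ns) (nonneg_term z x n (groups_op zs As (drop (length Bs) Ns) m))))"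

text \<open>Normal ordering already places the nonnegative part of \<open>x\<close> to the right of
  \<open>A\<close>, so the transport starts with its own group passed, at the price of one sign. The
  negative part stands left of everything and is cut to \<open>-K..-1\<close> by the
  functional.\<close>

lemma split_step:
  assumes phi: "linfun \<phi>"
    and K: "\<And>n w. n < - K \<Longrightarrow> \<phi> (fmode (fst x) (fst (snd x)) n w) = 0"
    and neg: "\<And>n. n \<in> {- K..-1} \<Longrightarrow>
      ((\<lambda>Ns. \<phi> (fmode (fst x) (fst (snd x)) n (groups_op zs ((i, A) # Gs) Ns m))) has_sum sN n) (group_indices ((i, A) # Gs))"
    and Q: "(transport zs \<phi> (zs ! i) x [(i, A)] Gs m has_sum sQ) (UNIV \<times> group_indices ((i, A) # Gs))"
  shows "((\<lambda>Ns. \<phi> (groups_op zs ((i, x # A) # Gs) Ns m)) has_sum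
    (\<Sum>n\<in>{- K..-1}. mode_coeff x (zs ! i) n * sN n) + ksigns (fst x) A * sQ) (group_indices ((i, x # A) # Gs))"
proof -
  let ?J = "group_indices ((i, A) # Gs)"
  define f where "f n Ns = (if n < 0 then mode_coeff x (zs ! i) n * \<phi> (fmode (fst x) (fst (snd x)) n (groups_op zs ((i, A) # Gs) Ns m)) else 0)" for n Ns
  have 1: "((\<lambda>(n, Ns). f n Ns) has_sum (\<Sum>n\<in>{- K..-1}. mode_coeff x (zs ! i) n * sN n)) (UNIV \<times> ?J)"
  proof (rule has_sum_slices)
    fix n assume "n \<in> {- K..-1}"
    moreover from this have "f n = (\<lambda>Ns. mode_coeff x (zs ! i) n * \<phi> (fmode (fst x) (fst (snd x)) n (groups_op zs ((i, A) # Gs) Ns m)))"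
      by (simp add: f_def fun_eq_iff)
    ultimately show "(f n has_sum mode_coeff x (zs ! i) n * sN n) ?J"
      using has_sum_cmult_right[OF neg, of n "mode_coeff x (zs ! i) n"] by (simp only:)
  next
    fix n Ns assume "n \<notin> {- K..-1}"
    then show "f n Ns = 0" using K[of n] by (auto simp: f_def)
  qed simp
  have 2: "((\<lambda>p. (\<lambda>(n, Ns). f n Ns) p + ksigns (fst x) A * transport zs \<phi> (zs ! i) x [(i, A)] Gs m p) has_sum
    (\<Sum>n\<in>{- K..-1}. mode_coeff x (zs ! i) n * sN n) + ksigns (fst x) A * sQ) (UNIV \<times> ?J)"
    by (rule has_sum_add[OF 1 has_sum_cmult_right[OF Q]])
  show ?thesis
  proof (rule has_sum_reindex_bij_witness[THEN iffD2, OF _ _ _ _ _ refl 2])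
    \<comment> \<open>The bijection detaches the mode of \<open>x\<close> from the front of the
      first mode list.\<close>
    let ?i = "\<lambda>(n :: int, Ns). (n # hd Ns) # tl Ns" and ?j = "\<lambda>Ns :: int list list. (hd (hd Ns), tl (hd Ns) # tl Ns)"
    fix Ns assume "Ns \<in> group_indices ((i, x # A) # Gs)"
    then obtain n ns Ns' where N: "Ns = (n # ns) # Ns'" "length ns = length A" "Ns' \<in> group_indices Gs"
      by (auto simp: group_indices_Cons length_Suc_conv)
    show "?i (?j Ns) = Ns" using N by simp
    show "?j Ns \<in> UNIV \<times> ?J" using N by (auto simp: group_indices_Cons)
    show "(\<lambda>(n, Ns). f n Ns) (?j Ns) + ksigns (fst x) A * transport zs \<phi> (zs ! i) x [(i, A)] Gs m (?j Ns) = \<phi> (groups_op zs ((i, x # A) # Gs) Ns m)"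
      using N by (cases "n < 0")
        (auto simp: f_def transport_def nonneg_term_def mode_term_def linmap_zero[OF linmap_group_op'] linfun_zero[OF phi] linfun_smul[OF phi])
  next
    let ?i = "\<lambda>(n :: int, Ns). (n # hd Ns) # tl Ns" and ?j = "\<lambda>Ns :: int list list. (hd (hd Ns), tl (hd Ns) # tl Ns)"
    fix p :: "int \<times> int list list" assume "p \<in> UNIV \<times> ?J"
    then show "?j (?i p) = p" "?i p \<in> group_indices ((i, x # A) # Gs)"
      by (auto simp: group_indices_Cons)
  qed
qed

text \<open>Once no group is left in front, the mode acts on \<open>m\<close> itself, and only the
  modes up to \<open>K\<close> survive.\<close>

lemma end_step:
  assumes K: "\<And>n. n > K \<Longrightarrow> fmode (fst x) (fst (snd x)) n m = 0" and phi: "linfun \<phi>"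
    and pos: "\<And>n. n \<in> {0..K} \<Longrightarrow>
      ((\<lambda>Ns. \<phi> (groups_op zs Bs Ns (fmode (fst x) (fst (snd x)) n m))) has_sum sP n) (group_indices Bs)"
  shows "(transport zs \<phi> z x Bs [] m has_sum (\<Sum>n\<in>{0..K}. mode_coeff x z n * sP n)) (UNIV \<times> group_indices Bs)"
proof -
  have "((\<lambda>(n, Ns). transport zs \<phi> z x Bs [] m (n, Ns)) has_sum (\<Sum>n\<in>{0..K}. mode_coeff x z n * sP n)) (UNIV \<times> group_indices Bs)"
  proof (rule has_sum_slices)
    fix n assume n: "n \<in> {0..K}"
    have "transport zs \<phi> z x Bs [] m (n, Ns) = mode_coeff x z n * \<phi> (groups_op zs Bs Ns (fmode (fst x) (fst (snd x)) n m))" if "Ns \<in> group_indices Bs" for Ns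
      using that n group_indices_length[of Ns Bs] by (simp add: transport_def nonneg_term_def mode_term_def linmap_smul[OF linmap_groups_op'] linfun_smul[OF phi])
    then show "((\<lambda>Ns. transport zs \<phi> z x Bs [] m (n, Ns)) has_sum mode_coeff x z n * sP n) (group_indices Bs)"
      using has_sum_cmult_right[OF pos[OF n], of "mode_coeff x z n"] by (simp cong: has_sum_cong)
  next
    fix n Ns assume "n \<notin> {0..K}"
    then show "transport zs \<phi> z x Bs [] m (n, Ns) = 0"
      using K[of n] by (auto simp: transport_def nonneg_term_def mode_term_def linmap_zero[OF linmap_groups_op'] linfun_zero[OF phi])
  qed simp
  then show ?thesis by simp
qed

text \<open>The contracted pair of modes and the remaining modes vary independently, so each
  contraction contributes a product of two sums: a closed form \<open>kv j\<close> and a product of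
  fields with one letter less.\<close>

lemma move_step:
  assumes phi: "linfun \<phi>"
    and Q: "(transport zs \<phi> z x (Bs @ [(i, B)]) As m has_sum sQ) (UNIV \<times> group_indices (Bs @ (i, B) # As))"
    and pairing: "\<And>j. j < length B \<Longrightarrow> ((\<lambda>(n, n'). contraction z x (zs ! i) (B ! j) n n') has_sum kv j) UNIV"
    and H: "\<And>j. j < length B \<Longrightarrow>
      ((\<lambda>Ns. \<phi> (groups_op zs (Bs @ (i, delete_at j B) # As) Ns m)) has_sum s j) (group_indices (Bs @ (i, delete_at j B) # As))"
  shows "(transport zs \<phi> z x Bs ((i, B) # As) m has_sum
     ksigns (fst x) B * sQ + (\<Sum>j<length B. ksigns (fst x) (take j B) * kv j * s j)) (UNIV \<times> group_indices (Bs @ (i, B) # As))"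
proof -
  let ?I = "(UNIV :: int set) \<times> group_indices (Bs @ (i, B) # As)" and ?k = "length Bs"
  define f where "f j = (\<lambda>(n, Ns). ksigns (fst x) (take j B) * (contraction z x (zs ! i) (B ! j) n (Ns ! ?k ! j) *
     \<phi> (groups_op zs (Bs @ (i, delete_at j B) # As) (Ns[?k := delete_at j (Ns ! ?k)]) m)))" for j
  have f: "(f j has_sum ksigns (fst x) (take j B) * kv j * s j) ?I" if j: "j < length B" for j
  proof -
    have 1: "((\<lambda>(p, Ns). (case p of (n, n') \<Rightarrow> contraction z x (zs ! i) (B ! j) n n') * \<phi> (groups_op zs (Bs @ (i, delete_at j B) # As) Ns m))
       has_sum kv j * s j) (UNIV \<times> group_indices (Bs @ (i, delete_at j B) # As))"
      by (rule has_sum_prod[OF pairing[OF j] H[OF j]])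
    \<comment> \<open>The mode of the contracted letter is taken out of the mode list of its group,
      which has position \<open>length Bs\<close>; the inverse inserts it again.\<close>
    let ?j = "\<lambda>(n :: int, Ns :: int list list). ((n, Ns ! ?k ! j), Ns[?k := delete_at j (Ns ! ?k)])"
    let ?i = "\<lambda>((n :: int, n' :: int), Ns). (n, Ns[?k := insert_at j n' (Ns ! ?k)])"
    have "((\<lambda>(n, Ns). contraction z x (zs ! i) (B ! j) n (Ns ! ?k ! j) * \<phi> (groups_op zs (Bs @ (i, delete_at j B) # As) (Ns[?k := delete_at j (Ns ! ?k)]) m))
       has_sum kv j * s j) ?I"
    proof (rule has_sum_reindex_bij_witness[THEN iffD2, OF _ _ _ _ _ refl 1])
      fix p :: "int \<times> int list list" assume "p \<in> ?I"
      then obtain n N1 ns N2 where p: "p = (n, N1 @ ns # N2)" "N1 \<in> group_indices Bs" "length ns = length B" "N2 \<in> group_indices As"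
        by (auto simp: group_indices_append group_indices_Cons)
      then have l: "length N1 = ?k" using group_indices_length by blast
      show "?i (?j p) = p" using p l j by (simp add: nth_append insert_at_delete_at list_update_append)
      show "?j p \<in> UNIV \<times> group_indices (Bs @ (i, delete_at j B) # As)"
        using p l j by (auto simp: nth_append list_update_append length_delete_at intro!: group_indices_mid)
      show "(case ?j p of (p, Ns) \<Rightarrow> (case p of (n, n') \<Rightarrow> contraction z x (zs ! i) (B ! j) n n') * \<phi> (groups_op zs (Bs @ (i, delete_at j B) # As) Ns m)) =
        (case p of (n, Ns) \<Rightarrow> contraction z x (zs ! i) (B ! j) n (Ns ! ?k ! j) * \<phi> (groups_op zs (Bs @ (i, delete_at j B) # As) (Ns[?k := delete_at j (Ns ! ?k)]) m))"
        by (simp add: case_prod_beta)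
    next
      fix p :: "(int \<times> int) \<times> int list list" assume "p \<in> UNIV \<times> group_indices (Bs @ (i, delete_at j B) # As)"
      then obtain n n' N1 ns N2 where p: "p = ((n, n'), N1 @ ns # N2)" "N1 \<in> group_indices Bs" "length ns = length B - 1" "N2 \<in> group_indices As"
        using j by (cases p) (auto simp: group_indices_append group_indices_Cons length_delete_at)
      then have l: "length N1 = ?k" "j \<le> length ns" using group_indices_length j by auto
      show "?j (?i p) = p" using p l j by (simp add: nth_append insert_at_nth delete_at_insert_at list_update_append)
      show "?i p \<in> ?I" using p l j by (auto simp: nth_append list_update_append length_insert_at intro!: group_indices_mid)
    qed
    from has_sum_cmult_right[OF this, of "ksigns (fst x) (take j B)"] show ?thesis
      by (simp add: f_def case_prod_beta' mult.assoc)
  qed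
  have tot: "((\<lambda>p. ksigns (fst x) B * transport zs \<phi> z x (Bs @ [(i, B)]) As m p + (\<Sum>j<length B. f j p)) has_sum
     ksigns (fst x) B * sQ + (\<Sum>j<length B. ksigns (fst x) (take j B) * kv j * s j)) ?I"
    by (intro has_sum_add has_sum_cmult_right Q has_sum_finite_sum f) auto
  have eq: "ksigns (fst x) B * transport zs \<phi> z x (Bs @ [(i, B)]) As m p + (\<Sum>j<length B. f j p) = transport zs \<phi> z x Bs ((i, B) # As) m p"
    if "p \<in> ?I" for p
  proof -
    from that obtain n N1 ns N2 where p: "p = (n, N1 @ ns # N2)" "N1 \<in> group_indices Bs" "length ns = length B" "N2 \<in> group_indices As"
      by (auto simp: group_indices_append group_indices_Cons)
    then have l: "length N1 = ?k" using group_indices_length by blast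
    have *: "groups_op zs (Bs @ [(i, B)]) (N1 @ [ns]) w = groups_op zs Bs N1 (group_op (zs ! i) B ns w)" for w
      by (subst groups_op_append) (simp_all add: l)
    define w where "w = groups_op zs As N2 m"
    have "transport zs \<phi> z x Bs ((i, B) # As) m p = \<phi> (groups_op zs Bs N1 (nonneg_term z x n (group_op (zs ! i) B ns w)))"
      by (simp add: p l transport_def w_def)
    also have "\<dots> = ksigns (fst x) B * \<phi> (groups_op zs Bs N1 (group_op (zs ! i) B ns (nonneg_term z x n w))) +
       (\<Sum>j<length B. ksigns (fst x) (take j B) * contraction z x (zs ! i) (B ! j) n (ns ! j) * \<phi> (groups_op zs Bs N1 (group_op (zs ! i) (delete_at j B) (delete_at j ns) w)))"
      unfolding nonneg_term_group_op[OF p(3)] linmap_add[OF linmap_groups_op'] linmap_smul[OF linmap_groups_op'] linmap_sum[OF linmap_groups_op'] linfun_add[OF phi] linfun_smul[OF phi] linfun_sum[OF phi] ..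
    also have "ksigns (fst x) B * \<phi> (groups_op zs Bs N1 (group_op (zs ! i) B ns (nonneg_term z x n w))) = ksigns (fst x) B * transport zs \<phi> z x (Bs @ [(i, B)]) As m p"
      by (simp add: p l transport_def w_def *)
    also have "(\<Sum>j<length B. ksigns (fst x) (take j B) * contraction z x (zs ! i) (B ! j) n (ns ! j) * \<phi> (groups_op zs Bs N1 (group_op (zs ! i) (delete_at j B) (delete_at j ns) w)))
       = (\<Sum>j<length B. f j p)"
      by (intro sum.cong refl) (simp add: p l f_def w_def nth_append list_update_append groups_op_append mult.assoc)
    finally show ?thesis by simp
  qed
  show ?thesis by (rule has_sum_cong[THEN iffD1, OF eq tot])
qed

end

section \<open>Closed form of the contractions and bounded functionals\<close>

lemma fcoeff_nat: "fcoeff p (int n) = (- 1) ^ p * of_nat (n + p choose p)"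
proof -
  have "of_nat p - of_int (- int n - 1) - 1 = (of_nat (n + p) :: complex)" by simp
  then show ?thesis by (subst gbinomial_negated_upper) (simp add: binomial_gbinomial del: of_nat_add of_int_diff)
qed

lemma fcoeff_neg: "fcoeff p (- 1 - int n) = of_nat (n choose p)"
  by (simp add: binomial_gbinomial)

text \<open>Both sides are the multinomial coefficient (k + p + q)! / (k! p! q!).\<close>

lemma choose_contract:
  "of_nat (k + q + p choose p) * of_nat (k + q choose q) = (of_nat (q + p choose p) * of_nat (k + p + q choose k) :: complex)"
  by (simp add: binomial_fact field_simps)

lemma keys_lin: "Poly_Mapping.keys (lin f m) \<subseteq> (\<Union>w\<in>Poly_Mapping.keys m. Poly_Mapping.keys (f w))"
proof
  fix v assume "v \<in> Poly_Mapping.keys (lin f m)"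
  then have "(\<Sum>w\<in>Poly_Mapping.keys m. Poly_Mapping.lookup m w * Poly_Mapping.lookup (f w) v) \<noteq> 0"
    by (simp add: in_keys_iff lin_def lookup_sum)
  then obtain w where "w \<in> Poly_Mapping.keys m" "Poly_Mapping.lookup m w * Poly_Mapping.lookup (f w) v \<noteq> 0"
    by (rule sum.not_neutral_contains_not_neutral)
  then show "v \<in> (\<Union>w\<in>Poly_Mapping.keys m. Poly_Mapping.keys (f w))" by (auto simp: in_keys_iff)
qed

text \<open>The form in which elements of the graded dual are used on words; the integer size
  replaces the half-integral weight.\<close>

definition bounded_linfun :: "('h fock \<Rightarrow> complex) \<Rightarrow> bool" where
  "bounded_linfun \<phi> \<longleftrightarrow> linfun \<phi> \<and> (\<exists>K. \<forall>w. word_size w > K \<longrightarrow> \<phi> (bv w) = 0)"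

definition product_region :: "nat \<Rightarrow> complex list \<Rightarrow> bool" where
  "product_region n zs \<longleftrightarrow> length zs = n \<and> sorted_wrt (\<lambda>z w. norm z > norm w) zs \<and> (\<forall>z\<in>set zs. norm z > 0)"

lemma product_region_admissible:
  assumes "product_region n zs"
  shows "admissible n zs"
proof -
  have "sorted_wrt (\<lambda>z w. norm z > norm w) zs \<Longrightarrow> distinct zs" for zs :: "complex list"
    by (induct zs) auto
  then show ?thesis using assms by (auto simp: product_region_def admissible_def)
qed

lemma product_region_less: "product_region n zs \<Longrightarrow> i < j \<Longrightarrow> j < n \<Longrightarrow> norm (zs ! j) < norm (zs ! i)"
  by (auto simp: product_region_def sorted_wrt_iff_nth_less)

context bilinear_form_space
begin

text \<open>Each contraction removes one letter of size at most \<open>n + 1\<close>, so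
  annihilation cannot bring a very large word below the bound of a functional.\<close>

lemma keys_annih_word: "v \<in> Poly_Mapping.keys (annih_word s a n w) \<Longrightarrow> word_size w \<le> word_size v + int n + 1"
proof (induct w arbitrary: v)
  case (Cons l w)
  obtain t b j where l: "l = (t, b, j)" by (cases l)
  from Cons(2) consider "v \<in> Poly_Mapping.keys (smul (pairing s a n t b j) (bv w))"
    | "v \<in> Poly_Mapping.keys (prepend l (annih_word s a n w))"
    unfolding l annih_word.simps using Poly_Mapping.keys_add keys_smul by (meson UnE subsetD)
  then show ?case
  proof cases
    case 1
    then have "pairing s a n t b j \<noteq> 0" "v = w" by (auto simp: in_keys_iff lookup_single when_def split: if_splits)
    then show ?thesis by (auto simp: l pairing_def split: species.splits if_splits)
  next
    case 2
    then obtain u where "u \<in> Poly_Mapping.keys (annih_word s a n w)" "v = l # u"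
      using keys_lin[of "\<lambda>w. bv (l # w)" "annih_word s a n w"] by (auto simp: prepend_def)
    then show ?thesis using Cons(1) by fastforce
  qed
qed simp

text \<open>Creation enlarges words and annihilation shrinks them by a bounded amount. This closure
  property lets the induction absorb a mode of the first letter into the functional.\<close>

lemma bounded_linfun_fmode:
  assumes "bounded_linfun \<phi>"
  shows "bounded_linfun (\<lambda>w. \<phi> (fmode s a n w))"
proof -
  obtain K where phi: "linfun \<phi>" and K: "\<And>w. word_size w > K \<Longrightarrow> \<phi> (bv w) = 0" using assms by (auto simp: bounded_linfun_def)
  have "\<phi> (fmode s a n (bv w)) = 0" if w: "word_size w > K + \<bar>n\<bar> + 1" for w
  proof (cases "n < 0")
    case True
    have "\<phi> (bv ((s, b, nat (- n - 1)) # w)) = 0" for b using True w by (intro K) simp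
    then show ?thesis using True
      by (simp add: fmode_def create_def linfun_sum[OF phi] linfun_smul[OF phi])
  next
    case False
    have "\<phi> (annih_word s a (nat n) w) = 0"
    proof (rule linfun_eq_zeroI[OF phi])
      fix v assume "v \<in> Poly_Mapping.keys (annih_word s a (nat n) w)"
      from keys_annih_word[OF this] show "\<phi> (bv v) = 0" using False w by (intro K) simp
    qed
    then show ?thesis using False by (simp add: fmode_def annih_def)
  qed
  then show ?thesis using linfun_comp[OF phi linmap_fmode'] by (auto simp: bounded_linfun_def)
qed

text \<open>A very negative mode creates a letter that exceeds the bound on its own, so the cut is
  uniform in \<open>w\<close>.\<close>

lemma bounded_linfun_cut:
  assumes "bounded_linfun \<phi>"
  shows "\<exists>K. \<forall>n w. n < - K \<longrightarrow> \<phi> (fmode s a n w) = 0"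
proof -
  obtain K where phi: "linfun \<phi>" and K: "\<And>w. word_size w > K \<Longrightarrow> \<phi> (bv w) = 0" using assms by (auto simp: bounded_linfun_def)
  have "\<phi> (fmode s a n w) = 0" if n: "n < - max 0 K" for n w
  proof (rule linfun_eq_zeroI[OF linfun_comp[OF phi linmap_fmode']])
    fix v
    have n': "n < 0" "n < - K" using n by auto
    then have "\<phi> (bv ((s, b, nat (- n - 1)) # v)) = 0" for b using word_size_nonneg[of v] by (intro K) simp
    then show "\<phi> (fmode s a n (bv v)) = 0" using n'(1)
      by (simp add: fmode_def create_def linfun_sum[OF phi] linfun_smul[OF phi])
  qed
  then show ?thesis by blast
qed

text \<open>The bosonic pairing requires \<open>n = j + 1\<close>, the fermionic one
  \<open>n = j\<close>.\<close>

definition bos_shift :: "species \<Rightarrow> nat" where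
  "bos_shift s = (if s = Bos then 1 else 0)"

text \<open>The scalar part of the summand \<open>k = 0\<close> in the contraction series; by
  \<open>pairing_contract\<close> the other summands are binomial multiples of it.\<close>

definition contraction_coeff :: "'h letter \<Rightarrow> 'h letter \<Rightarrow> complex" where
  "contraction_coeff x y = fcoeff (snd (snd x)) (int (snd (snd y) + bos_shift (fst x))) *
     pairing (fst x) (fst (snd x)) (snd (snd y) + bos_shift (fst x)) (fst y) (fst (snd y)) (snd (snd y))"

definition contraction_order :: "'h letter \<Rightarrow> 'h letter \<Rightarrow> nat" where
  "contraction_order x y = snd (snd x) + snd (snd y) + bos_shift (fst x)"

text \<open>In the bosonic case the additional factor \<open>k + q + 1\<close> of the pairing is
  absorbed into the binomial coefficient, which raises \<open>q\<close> to
  \<open>q + 1\<close>.\<close>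

lemma pairing_contract:
  "fcoeff p (int (k + q + bos_shift s)) * fcoeff q (- 1 - int (k + q)) * pairing s a (k + q + bos_shift s) s b (k + q) =
     fcoeff p (int (q + bos_shift s)) * pairing s a (q + bos_shift s) s b q * of_nat (k + (p + q + bos_shift s) choose k)"
proof (cases s)
  case Fer
  then show ?thesis
    using choose_contract[of k q p] unfolding fcoeff_nat fcoeff_neg
    by (simp add: bos_shift_def pairing_def mult_ac add_ac)
next
  case Bos
  have "of_nat (Suc (k + q)) * of_nat (k + q choose q) = (of_nat (k + Suc q choose Suc q) * of_nat (Suc q) :: complex)"
    using Suc_times_binomial_eq[of "k + q" q] by (simp only: of_nat_mult[symmetric]) simp
  then have "of_nat (k + Suc q + p choose p) * (of_nat (Suc (k + q)) * of_nat (k + q choose q)) =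
    (of_nat (Suc q + p choose p) * of_nat (k + p + Suc q choose k) * of_nat (Suc q) :: complex)"
    using choose_contract[of k "Suc q" p] by (simp only: mult.assoc[symmetric])
  then have "((- 1) ^ p * form a b * lB) * (of_nat (k + Suc q + p choose p) * (of_nat (Suc (k + q)) * of_nat (k + q choose q))) =
    ((- 1) ^ p * form a b * lB) * (of_nat (Suc q + p choose p) * of_nat (k + p + Suc q choose k) * of_nat (Suc q) :: complex)"
    by (simp only:)
  then show ?thesis
    using Bos unfolding fcoeff_nat fcoeff_neg
    by (simp add: bos_shift_def pairing_def mult_ac add_ac del: of_nat_Suc binomial_Suc_Suc)
qed

lemma contraction_sum:
  assumes "norm z' < norm z"
  shows "((\<lambda>(n, n'). contraction z x z' y n n') has_sum contraction_coeff x y * (z - z') powi (- int (contraction_order x y) - 1)) UNIV"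
proof (cases "fst x = fst y")
  case False
  then have "contraction_coeff x y = 0" "contraction z x z' y n n' = 0" for n n' by (auto simp: contraction_coeff_def contraction_def pairing_def)
  then show ?thesis by (simp add: case_prod_beta')
next
  case True
  obtain s a p where x: "x = (s, a, p)" by (cases x)
  obtain b q where y: "y = (s, b, q)" using True x by (cases y) auto
  \<comment> \<open>The pairing ties \<open>n\<close> to \<open>n'\<close>, and
    \<open>fcoeff q n'\<close> vanishes for \<open>-1 - q < n' < 0\<close>; what remains is one
    sequence indexed by \<open>k\<close>.\<close>
  let ?g = "\<lambda>k. (int (k + q + bos_shift s), - 1 - int (k + q))"
  have inj: "inj ?g" by (auto simp: inj_def)
  have val: "contraction z x z' y (int (k + q + bos_shift s)) (- 1 - int (k + q)) =
    contraction_coeff x y * (of_nat (k + contraction_order x y choose k) * z' ^ k * z powi (- int k - int (contraction_order x y) - 1))" for k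
  proof -
    have "contraction z x z' y (int (k + q + bos_shift s)) (- 1 - int (k + q)) =
      (fcoeff p (int (k + q + bos_shift s)) * fcoeff q (- 1 - int (k + q)) * pairing s a (k + q + bos_shift s) s b (k + q)) *
      (z powi (- int (k + q + bos_shift s) - 1 - int p) * z' powi (1 + int (k + q) - 1 - int q))"
      unfolding contraction_def mode_coeff_def x y fst_conv snd_conv by (simp add: nat_add_distrib)
    also have "\<dots> = contraction_coeff x y * of_nat (k + contraction_order x y choose k) * (z powi (- int (k + q + bos_shift s) - 1 - int p) * z' powi (1 + int (k + q) - 1 - int q))"
      unfolding pairing_contract contraction_coeff_def contraction_order_def x y fst_conv snd_conv ..
    also have "- int (k + q + bos_shift s) - 1 - int p = - int k - int (contraction_order x y) - 1" by (simp add: contraction_order_def x y)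
    also have "1 + int (k + q) - 1 - int q = int k" by simp
    finally show ?thesis by (simp add: mult_ac)
  qed
  have zero: "contraction z x z' y n n' = 0" if "(n, n') \<notin> range ?g" for n n'
  proof (rule ccontr)
    assume nz: "contraction z x z' y n n' \<noteq> 0"
    then have n: "0 \<le> n" "n' < 0" and kn: "pairing s a (nat n) s b (nat (- n' - 1)) \<noteq> 0" and c: "fcoeff q n' \<noteq> 0"
      by (auto simp: contraction_def mode_coeff_def x y split: if_splits)
    have n': "nat (- n' - 1) \<ge> q" using fcoeff_eq_0[of q n'] n c by linarith
    have "nat n = nat (- n' - 1) + bos_shift s"
      using kn by (auto simp: pairing_def bos_shift_def split: species.splits if_splits)
    moreover obtain k where "nat (- n' - 1) = q + k" using n' le_Suc_ex by blast
    ultimately have "n' = - 1 - int (k + q)" "n = int (k + q + bos_shift s)" using n by linarith+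
    then have "(n, n') = ?g k" by simp
    then have "(n, n') \<in> range ?g" by (rule range_eqI)
    then show False using that by contradiction
  qed
  have "((\<lambda>k. contraction_coeff x y * (of_nat (k + contraction_order x y choose k) * z' ^ k * z powi (- int k - int (contraction_order x y) - 1)))
      has_sum contraction_coeff x y * (z - z') powi (- int (contraction_order x y) - 1)) UNIV"
    by (intro has_sum_cmult_right has_sum_neg_binomial assms)
  then have "((\<lambda>(n, n'). contraction z x z' y n n') has_sum contraction_coeff x y * (z - z') powi (- int (contraction_order x y) - 1)) (range ?g)"
    unfolding has_sum_reindex[OF inj] comp_def prod.case val .
  moreover have "((\<lambda>(n, n'). contraction z x z' y n n') has_sum contraction_coeff x y * (z - z') powi (- int (contraction_order x y) - 1)) (range ?g) \<longleftrightarrow>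
     ((\<lambda>(n, n'). contraction z x z' y n n') has_sum contraction_coeff x y * (z - z') powi (- int (contraction_order x y) - 1)) UNIV"
    by (rule has_sum_cong_neutral) (use zero in auto)
  ultimately show ?thesis by simp
qed

section \<open>Convergence and rationality of products of fields\<close>

lemma rational_on_mode_coeff: "i < n \<Longrightarrow> rational_on n (\<lambda>zs. mode_coeff x (zs ! i) k)"
  unfolding mode_coeff_def by (intro rational_on_mult rational_on_const rational_on_powi)

text \<open>One function \<open>f\<close> serves all points of the region, since rationality
  concerns the dependence on \<open>zs\<close>.\<close>

definition group_limit :: "nat \<Rightarrow> ('h fock \<Rightarrow> complex) \<Rightarrow> (nat \<times> 'h letter list) list \<Rightarrow>
    'h fock \<Rightarrow> (complex list \<Rightarrow> complex) \<Rightarrow> bool" where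
  "group_limit n \<phi> Gs m f \<longleftrightarrow> rational_on n f \<and> (\<forall>zs. product_region n zs \<longrightarrow> ((\<lambda>Ns. \<phi> (groups_op zs Gs Ns m)) has_sum f zs) (group_indices Gs))"

definition transport_limit :: "nat \<Rightarrow> ('h fock \<Rightarrow> complex) \<Rightarrow> nat \<Rightarrow> 'h letter \<Rightarrow> (nat \<times> 'h letter list) list \<Rightarrow>
    (nat \<times> 'h letter list) list \<Rightarrow> 'h fock \<Rightarrow> (complex list \<Rightarrow> complex) \<Rightarrow> bool" where
  "transport_limit n \<phi> i x Bs As m f \<longleftrightarrow> rational_on n f \<and>
     (\<forall>zs. product_region n zs \<longrightarrow> (transport zs \<phi> (zs ! i) x Bs As m has_sum f zs) (UNIV \<times> group_indices (Bs @ As)))"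

text \<open>Increasing indices mean decreasing absolute values in the product region, so a letter
  carried to the right meets only points for which \<open>contraction_sum\<close> applies.\<close>

definition wf_groups :: "nat \<Rightarrow> (nat \<times> 'h letter list) list \<Rightarrow> bool" where
  "wf_groups n Gs \<longleftrightarrow> sorted_wrt (<) (map fst Gs) \<and> (\<forall>G\<in>set Gs. fst G < n)"

text \<open>Every group counts one more than its letters, so that dropping an empty group is
  progress too.\<close>

definition gsize :: "(nat \<times> 'h letter list) list \<Rightarrow> nat" where
  "gsize Gs = (\<Sum>G\<leftarrow>Gs. Suc (length (snd G)))"

lemma gsize_simps [simp]: "gsize [] = 0" "gsize (G # Gs) = Suc (length (snd G)) + gsize Gs"
  "gsize (Gs @ Gs') = gsize Gs + gsize Gs'"
  by (simp_all add: gsize_def)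

lemma transport_limit_end:
  assumes phi: "bounded_linfun \<phi>" and i: "i < n" and "\<And>m. \<exists>f. group_limit n \<phi> Bs m f"
  shows "\<exists>f. transport_limit n \<phi> i x Bs [] m f"
proof -
  obtain B where B: "size_le B m" using size_le_exists by blast
  define F where "F k = (SOME f. group_limit n \<phi> Bs (fmode (fst x) (fst (snd x)) k m) f)" for k
  have F: "group_limit n \<phi> Bs (fmode (fst x) (fst (snd x)) k m) (F k)" for k
    unfolding F_def using assms(3) by (rule someI_ex)
  have "transport_limit n \<phi> i x Bs [] m (\<lambda>zs. \<Sum>k\<in>{0..B}. mode_coeff x (zs ! i) k * F k zs)"
    unfolding transport_limit_def append_Nil2
  proof (intro conjI allI impI)
    show "rational_on n (\<lambda>zs. \<Sum>k\<in>{0..B}. mode_coeff x (zs ! i) k * F k zs)"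
      using F i by (intro rational_on_sum rational_on_mult rational_on_mode_coeff) (auto simp: group_limit_def)
    fix zs assume "product_region n zs"
    then show "(transport zs \<phi> (zs ! i) x Bs [] m has_sum (\<Sum>k\<in>{0..B}. mode_coeff x (zs ! i) k * F k zs)) (UNIV \<times> group_indices Bs)"
      using F phi by (intro end_step) (auto simp: group_limit_def bounded_linfun_def fmode_eq_0[OF B])
  qed
  then show ?thesis by blast
qed

lemma transport_limit_move:
  assumes phi: "bounded_linfun \<phi>" and i: "i < i'" "i' < n"
    and Q: "transport_limit n \<phi> i x (Bs @ [(i', B)]) As m fQ"
    and H: "\<And>j. j < length B \<Longrightarrow> group_limit n \<phi> (Bs @ (i', delete_at j B) # As) m (fH j)"
  shows "transport_limit n \<phi> i x Bs ((i', B) # As) m (\<lambda>zs. ksigns (fst x) B * fQ zs +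
    (\<Sum>j<length B. ksigns (fst x) (take j B) * (contraction_coeff x (B ! j) * (zs ! i - zs ! i') powi (- int (contraction_order x (B ! j)) - 1)) * fH j zs))"
  unfolding transport_limit_def
proof (intro conjI allI impI)
  show "rational_on n (\<lambda>zs. ksigns (fst x) B * fQ zs +
    (\<Sum>j<length B. ksigns (fst x) (take j B) * (contraction_coeff x (B ! j) * (zs ! i - zs ! i') powi (- int (contraction_order x (B ! j)) - 1)) * fH j zs))"
    using Q H i by (intro rational_on_add rational_on_sum rational_on_mult rational_on_const rational_on_diff_powi) (auto simp: group_limit_def transport_limit_def)
  fix zs assume zs: "product_region n zs"
  show "(transport zs \<phi> (zs ! i) x Bs ((i', B) # As) m has_sum (ksigns (fst x) B * fQ zs +
    (\<Sum>j<length B. ksigns (fst x) (take j B) * (contraction_coeff x (B ! j) * (zs ! i - zs ! i') powi (- int (contraction_order x (B ! j)) - 1)) * fH j zs)))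
    (UNIV \<times> group_indices (Bs @ (i', B) # As))"
    using Q H phi zs by (intro move_step contraction_sum product_region_less[OF zs i]) (auto simp: group_limit_def transport_limit_def bounded_linfun_def)
qed

text \<open>Each move shifts a group from \<open>As\<close> to \<open>Bs\<close>, and each
  contraction deletes a letter, so all products that arise stay within the bound
  \<open>M\<close>.\<close>

lemma transport_limit_exists:
  assumes "\<And>Gs m. wf_groups n Gs \<Longrightarrow> gsize Gs \<le> M \<Longrightarrow> \<exists>f. group_limit n \<phi> Gs m f"
    and phi: "bounded_linfun \<phi>" and "i < n"
    and "wf_groups n (Bs @ As)" "gsize (Bs @ As) \<le> M" "\<forall>G\<in>set As. i < fst G"
  shows "\<exists>f. transport_limit n \<phi> i x Bs As m f"
  using assms(4-)
proof (induct As arbitrary: Bs)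
  case Nil
  then show ?case using assms(1) by (intro transport_limit_end[OF phi \<open>i < n\<close>]) auto
next
  case (Cons G As)
  obtain i' B where G: "G = (i', B)" by (cases G)
  obtain fQ where fQ: "transport_limit n \<phi> i x (Bs @ [(i', B)]) As m fQ"
    using Cons(1)[of "Bs @ [(i', B)]"] Cons(2-) by (auto simp: G)
  have "\<exists>f. group_limit n \<phi> (Bs @ (i', delete_at j B) # As) m f" if "j < length B" for j
    using Cons(2-) that by (intro assms(1)) (auto simp: G wf_groups_def length_delete_at)
  note ex = this
  define fH where "fH j = (SOME f. group_limit n \<phi> (Bs @ (i', delete_at j B) # As) m f)" for j
  have fH: "group_limit n \<phi> (Bs @ (i', delete_at j B) # As) m (fH j)" if "j < length B" for j
    unfolding fH_def using ex[OF that] by (rule someI_ex)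
  have "i < i'" "i' < n" using Cons(2-) by (auto simp: G wf_groups_def)
  from transport_limit_move[OF phi this fQ fH] show ?case unfolding G by blast
qed

lemma group_limit_split:
  assumes phi: "bounded_linfun \<phi>" and K: "\<And>k w. k < - K \<Longrightarrow> \<phi> (fmode (fst x) (fst (snd x)) k w) = 0" and i: "i < n"
    and F: "\<And>k. k \<in> {- K..-1} \<Longrightarrow> group_limit n (\<lambda>w. \<phi> (fmode (fst x) (fst (snd x)) k w)) ((i, A) # Gs) m (F k)"
    and Q: "transport_limit n \<phi> i x [(i, A)] Gs m fQ"
  shows "group_limit n \<phi> ((i, x # A) # Gs) m (\<lambda>zs. (\<Sum>k\<in>{- K..-1}. mode_coeff x (zs ! i) k * F k zs) + ksigns (fst x) A * fQ zs)"
  unfolding group_limit_def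
proof (intro conjI allI impI)
  show "rational_on n (\<lambda>zs. (\<Sum>k\<in>{- K..-1}. mode_coeff x (zs ! i) k * F k zs) + ksigns (fst x) A * fQ zs)"
    using F Q i by (intro rational_on_add rational_on_sum rational_on_mult rational_on_const rational_on_mode_coeff) (auto simp: group_limit_def transport_limit_def)
  fix zs assume "product_region n zs"
  then show "((\<lambda>Ns. \<phi> (groups_op zs ((i, x # A) # Gs) Ns m)) has_sum
     ((\<Sum>k\<in>{- K..-1}. mode_coeff x (zs ! i) k * F k zs) + ksigns (fst x) A * fQ zs)) (group_indices ((i, x # A) # Gs))"
    using F Q phi K by (intro split_step) (auto simp: group_limit_def transport_limit_def bounded_linfun_def)
qed

text \<open>The leading letter always disappears: its negative modes go into the functional, its
  nonnegative modes end in a contraction or in the vector. Hence \<open>gsize\<close> drops, with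
  \<open>\<phi>\<close> and \<open>m\<close> generalised.\<close>

theorem group_limit_exists: "wf_groups n Gs \<Longrightarrow> bounded_linfun \<phi> \<Longrightarrow> \<exists>f. group_limit n \<phi> Gs m f"
proof (induct "gsize Gs" arbitrary: \<phi> Gs m rule: less_induct)
  case less
  note phi = less(3)
  show ?case
  proof (cases Gs)
    case Nil
    have "group_limit n \<phi> Gs m (\<lambda>_. \<phi> m)"
      unfolding Nil group_limit_def using has_sum_finite[of "{[] :: int list list}" "\<lambda>Ns. \<phi> (groups_op _ [] Ns m)"] by auto
    then show ?thesis by blast
  next
    case (Cons G Gs')
    obtain i L where G: "G = (i, L)" by (cases G)
    have i: "i < n" and wf: "wf_groups n ((i, A) # Gs')" "wf_groups n Gs'" "\<forall>G\<in>set Gs'. i < fst G" for A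
      using less(2) by (auto simp: Cons G wf_groups_def)
    show ?thesis
    proof (cases L)
      case Nil
      obtain f where f: "group_limit n \<phi> Gs' m f" using less(1)[of Gs' \<phi> m] wf phi by (auto simp: Cons G Nil)
      have "((\<lambda>Ns. \<phi> (groups_op zs ((i, []) # Gs') Ns m)) has_sum f zs) (group_indices ((i, []) # Gs')) \<longleftrightarrow>
        ((\<lambda>Ns. \<phi> (groups_op zs Gs' Ns m)) has_sum f zs) (group_indices Gs')" for zs
        by (rule has_sum_reindex_bij_witness[of _ "\<lambda>Ns. [] # Ns" tl]) (auto simp: group_indices_Cons)
      then have "group_limit n \<phi> Gs m f" using f by (simp add: group_limit_def Cons G Nil)
      then show ?thesis by blast
    next
      case C: (Cons x A)
      obtain K where K: "\<And>k w. k < - K \<Longrightarrow> \<phi> (fmode (fst x) (fst (snd x)) k w) = 0"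
        using bounded_linfun_cut[OF phi, where s = "fst x" and a = "fst (snd x)"] by blast
      have "\<exists>f. group_limit n (\<lambda>w. \<phi> (fmode (fst x) (fst (snd x)) k w)) ((i, A) # Gs') m f" for k
        using wf by (intro less(1) bounded_linfun_fmode phi) (auto simp: Cons G C)
      note ex = this
      define F where "F k = (SOME f. group_limit n (\<lambda>w. \<phi> (fmode (fst x) (fst (snd x)) k w)) ((i, A) # Gs') m f)" for k
      have F: "group_limit n (\<lambda>w. \<phi> (fmode (fst x) (fst (snd x)) k w)) ((i, A) # Gs') m (F k)" for k
        unfolding F_def using ex by (rule someI_ex)
      obtain fQ where fQ: "transport_limit n \<phi> i x [(i, A)] Gs' m fQ"
        using transport_limit_exists[of n "gsize ((i, A) # Gs')" \<phi> i "[(i, A)]" Gs' x m] less(1) wf i phi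
        by (auto simp: Cons G C)
      from group_limit_split[OF phi K i F fQ] show ?thesis by (auto simp: Cons G C)
    qed
  qed
qed

section \<open>Iterates\<close>

definition iterate_region :: "complex list \<Rightarrow> bool" where
  "iterate_region zs \<longleftrightarrow> length zs = 2 \<and> norm (zs ! 1) > norm (zs ! 0 - zs ! 1) \<and> norm (zs ! 0 - zs ! 1) > 0"

text \<open>
  The sum over \<open>ns\<close> is over the individual modes of the inner vertex operator; collecting them
  by total exponent gives the iterate.
\<close>

definition iterate_group :: "complex list \<Rightarrow> ('h fock \<Rightarrow> complex) \<Rightarrow> 'h letter list \<Rightarrow> 'h letter list \<Rightarrow>
    'h fock \<Rightarrow> int list \<times> int \<Rightarrow> complex" where
  "iterate_group zs \<phi> A B m = (\<lambda>(ns, l). \<phi> (fvertex (group_op (zs ! 0 - zs ! 1) A ns (state B)) l m) * (zs ! 1) powi l)"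

abbreviation iterate_indices :: "'h letter list \<Rightarrow> (int list \<times> int) set" where
  "iterate_indices A \<equiv> {ns. length ns = length A} \<times> UNIV"

text \<open>In \<open>fvertex_create\<close> the box depends on the size of \<open>u\<close> and on
  the exponent. Under a functional that kills very negative modes the ranges depend only on the
  functional and on \<open>m\<close>, so they stay fixed while inner modes and exponents are
  summed.\<close>

lemma fvertex_create_functional:
  assumes phi: "linfun \<phi>" and K: "\<And>k w. k < - K \<Longrightarrow> \<phi> (fmode s a k w) = 0" and B: "size_le B m"
  shows "\<phi> (fvertex (create s a r u) l m) =
    (\<Sum>k\<in>{- K..-1}. fcoeff r k * \<phi> (fmode s a k (fvertex u (l + k + 1 + int r) m))) +
    (\<Sum>k\<in>{0..B}. fcoeff r k * \<phi> (fvertex (parity s u) (l + k + 1 + int r) (fmode s a k m)))"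
proof -
  obtain C where C: "size_le C u" using size_le_exists by blast
  define M where "M = max (max B K) (l + int (Suc r) + C + B)"
  have M: "B \<le> M" "l + int (Suc r) + C + B \<le> M" "K \<le> M" by (auto simp: M_def)
  let ?f = "\<lambda>k. fcoeff r k * \<phi> (fmode s a k (fvertex u (l + k + 1 + int r) m))"
  let ?g = "\<lambda>k. fcoeff r k * \<phi> (fvertex (parity s u) (l + k + 1 + int r) (fmode s a k m))"
  have "\<phi> (fvertex (create s a r u) l m) = (\<Sum>k\<in>{- M..M}. if k < 0 then ?f k else ?g k)"
    unfolding fvertex_create[OF B C M(1,2)] linfun_sum[OF phi] linfun_smul[OF phi] by (intro sum.cong) auto
  also have "\<dots> = (\<Sum>k\<in>{- K..-1} \<union> {0..B}. if k < 0 then ?f k else ?g k)"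
  proof (rule sum.mono_neutral_right)
    show "\<forall>k\<in>{- M..M} - ({- K..-1} \<union> {0..B}). (if k < 0 then ?f k else ?g k) = 0"
      using K by (auto simp: fmode_eq_0[OF B] linmap_zero[OF linmap_fvertex_right'] linfun_zero[OF phi])
  qed (use M in auto)
  also have "\<dots> = (\<Sum>k\<in>{- K..-1}. if k < 0 then ?f k else ?g k) + (\<Sum>k\<in>{0..B}. if k < 0 then ?f k else ?g k)"
    by (rule sum.union_disjoint) auto
  also have "\<dots> = sum ?f {- K..-1} + sum ?g {0..B}"
    by (intro arg_cong2[of _ _ _ _ "(+)"] sum.cong) auto
  finally show ?thesis .
qed

lemma parity_group_op: "length ns = length A \<Longrightarrow> parity s (group_op z A ns w) = smul (ksigns s A) (group_op z A ns (parity s w))"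
proof (induct ns A arbitrary: w rule: list_induct2)
  case (Cons n ns x A)
  show ?case
    by (simp add: Cons(2) mode_term_def parity_fmode linmap_smul[OF linmap_parity'] linmap_smul[OF linmap_fmode'] linmap_smul[OF linmap_group_op'] mult_ac)
qed simp

definition state_contraction :: "complex \<Rightarrow> 'h letter \<Rightarrow> 'h letter \<Rightarrow> int \<Rightarrow> complex" where
  "state_contraction z x y n = (if n < 0 then 0 else mode_coeff x z n * pairing (fst x) (fst (snd x)) (nat n) (fst y) (fst (snd y)) (snd (snd y)))"

lemma nonneg_term_state: "nonneg_term z x n (state B) = (\<Sum>j<length B. smul (ksigns (fst x) (take j B) * state_contraction z x (B ! j) n) (state (delete_at j B)))"
proof (cases "n < 0")
  case False
  have "annih (fst x) (fst (snd x)) (nat n) (state B) = (\<Sum>j<length B. smul (ksigns (fst x) (take j B) *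
     pairing (fst x) (fst (snd x)) (nat n) (fst (B ! j)) (fst (snd (B ! j))) (snd (snd (B ! j)))) (state (delete_at j B)))"
  proof (induct B)
    case (Cons y B)
    obtain t b q where y: "y = (t, b, q)" by (cases y)
    show ?case unfolding length_Cons sum.lessThan_Suc_shift
      by (simp add: y annih_create Cons linmap_sum[OF linmap_create'] linmap_smul[OF linmap_create'] smul.scale_sum_right mult_ac)
  qed simp
  then show ?thesis using False
    by (simp add: nonneg_term_def mode_term_def fmode_def state_contraction_def smul.scale_sum_right mult_ac)
qed (simp add: nonneg_term_def state_contraction_def)

text \<open>A single mode survives the pairing, and its value is the closed form of
  \<open>contraction_sum\<close> with \<open>z\<close> in place of \<open>z - z'\<close>. At z = z_1
  - z_2 the contractions of iterate and product coincide.\<close>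

lemma state_contraction_sum: "((\<lambda>n. state_contraction z x y n) has_sum contraction_coeff x y * z powi (- int (contraction_order x y) - 1)) UNIV"
proof -
  let ?n = "int (snd (snd y) + bos_shift (fst x))"
  have "state_contraction z x y n = 0" if "n \<noteq> ?n" for n
  proof (rule ccontr)
    assume "state_contraction z x y n \<noteq> 0"
    then have "0 \<le> n" "pairing (fst x) (fst (snd x)) (nat n) (fst y) (fst (snd y)) (snd (snd y)) \<noteq> 0"
      by (auto simp: state_contraction_def split: if_splits)
    then show False using that by (auto simp: pairing_def bos_shift_def split: species.splits if_splits)
  qed
  then have "((\<lambda>n. state_contraction z x y n) has_sum state_contraction z x y ?n) UNIV \<longleftrightarrow> ((\<lambda>n. state_contraction z x y n) has_sum state_contraction z x y ?n) {?n}"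
    by (intro has_sum_cong_neutral) auto
  moreover have "((\<lambda>n. state_contraction z x y n) has_sum state_contraction z x y ?n) {?n}"
    using has_sum_finite[of "{?n}" "\<lambda>n. state_contraction z x y n"] by simp
  moreover have "state_contraction z x y ?n = contraction_coeff x y * z powi (- int (contraction_order x y) - 1)"
  proof -
    have e: "- ?n - 1 - int (snd (snd x)) = - int (contraction_order x y) - 1" by (simp add: contraction_order_def)
    show ?thesis unfolding state_contraction_def mode_coeff_def contraction_coeff_def e by (simp add: mult_ac del: of_nat_add)
  qed
  ultimately show ?thesis by simp
qed

text \<open>A mode \<open>n < 0\<close> of \<open>x\<close> at \<open>x0\<close>, acting inside the
  state, creates a letter of index \<open>- n - 1\<close>, whose field at \<open>z\<close> has a
  mode \<open>k\<close> in turn. Summed over \<open>n\<close>, the coefficients form the Taylor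
  expansion of \<open>mode_coeff\<close> at \<open>z + x0\<close>.\<close>

lemma taylor_sum:
  assumes "norm x0 < norm z"
  shows "((\<lambda>n. if n < 0 then mode_coeff x x0 n * fcoeff (nat (- n - 1)) k * z powi (- k + n) else 0) has_sum mode_coeff x (z + x0) k) UNIV"
proof -
  define p where "p = snd (snd x)"
  let ?g = "\<lambda>i. - 1 - int (p + i)"
  let ?F = "\<lambda>n. if n < 0 then mode_coeff x x0 n * fcoeff (nat (- n - 1)) k * z powi (- k + n) else 0"
  define e where "e = - k - 1 - int p"
  have val: "?F (?g i) = fcoeff p k * ((of_int e gchoose i) * x0 ^ i * z powi (e - int i))" for i
  proof -
    \<comment> \<open>\<open>fcoeff p (?g i)\<close> is the binomial coefficient
      \<open>p + i choose p\<close>; trinomial revision then separates the factor depending on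
      \<open>i\<close>.\<close>
    have "fcoeff p (?g i) * fcoeff (p + i) k = fcoeff p k * (of_int e gchoose i)"
      using gbinomial_trinomial_revision[of p "p + i" "of_int (- k - 1) :: complex"]
      by (simp add: e_def algebra_simps)
    moreover have "- ?g i - 1 - int p = int i" "- k + ?g i = e - int i" "nat (- ?g i - 1) = p + i" "?g i < 0"
      by (auto simp: e_def)
    ultimately show ?thesis unfolding mode_coeff_def p_def[symmetric] by (simp only: if_True power_int_of_nat mult_ac)
  qed
  have inj: "inj ?g" by (auto simp: inj_def)
  have zero: "?F n = 0" if "n \<notin> range ?g" for n
  proof (rule ccontr)
    assume nz: "?F n \<noteq> 0"
    then have n: "n < 0" "fcoeff p n \<noteq> 0" by (auto simp: mode_coeff_def p_def split: if_splits)
    then have "- 1 - int p \<ge> n" using fcoeff_eq_0[of p n] by linarith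
    then have "n = ?g (nat (- 1 - int p - n))" by auto
    then show False using that by blast
  qed
  have "((\<lambda>i. fcoeff p k * ((of_int e gchoose i) * x0 ^ i * z powi (e - int i))) has_sum fcoeff p k * (z + x0) powi e) UNIV"
    by (intro has_sum_cmult_right has_sum_binomial assms)
  then have "(?F has_sum fcoeff p k * (z + x0) powi e) (range ?g)"
    unfolding has_sum_reindex[OF inj] comp_def val .
  moreover have "(?F has_sum fcoeff p k * (z + x0) powi e) (range ?g) \<longleftrightarrow> (?F has_sum fcoeff p k * (z + x0) powi e) UNIV"
    by (rule has_sum_cong_neutral) (use zero in auto)
  ultimately show ?thesis by (simp add: mode_coeff_def e_def p_def)
qed

text \<open>A negative inner mode creates a letter whose field surrounds the rest by its negative
  and nonnegative parts; a nonnegative inner mode contracts with \<open>B\<close>. The outcome is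
  the expression that \<open>group_limit_split\<close> and \<open>transport_limit_move\<close> give
  for the product.\<close>

lemma iterate_step:
  assumes phi: "bounded_linfun \<phi>" and K: "\<And>k w. k < - K \<Longrightarrow> \<phi> (fmode (fst x) (fst (snd x)) k w) = 0" and B: "size_le C m"
    and zs: "iterate_region zs"
    and neg: "\<And>k. (iterate_group zs (\<lambda>w. \<phi> (fmode (fst x) (fst (snd x)) k w)) A B m has_sum sN k) (iterate_indices A)"
    and pos: "\<And>k. (iterate_group zs \<phi> A B (fmode (fst x) (fst (snd x)) k m) has_sum sP k) (iterate_indices A)"
    and con: "\<And>j. j < length B \<Longrightarrow> (iterate_group zs \<phi> A (delete_at j B) m has_sum sH j) (iterate_indices A)"
  shows "(iterate_group zs \<phi> (x # A) B m has_sum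
     (\<Sum>k\<in>{- K..-1}. mode_coeff x (zs ! 0) k * sN k) + ksigns (fst x) A * (ksigns (fst x) B * (\<Sum>k\<in>{0..C}. mode_coeff x (zs ! 0) k * sP k) +
       (\<Sum>j<length B. ksigns (fst x) (take j B) * (contraction_coeff x (B ! j) * (zs ! 0 - zs ! 1) powi (- int (contraction_order x (B ! j)) - 1)) * sH j)))
     (iterate_indices (x # A))"
proof -
  have linfun: "linfun \<phi>" using phi by (simp add: bounded_linfun_def)
  obtain s a p where x: "x = (s, a, p)" by (cases x)
  define x0 z where "x0 = zs ! 0 - zs ! 1" and "z = zs ! 1"
  have z: "norm x0 < norm z" "z + x0 = zs ! 0" "z \<noteq> 0" "x0 \<noteq> 0" using zs by (auto simp: iterate_region_def x0_def z_def)
  have iterate_group_eq: "iterate_group zs \<psi> A' B' m' (ns, l) = \<psi> (fvertex (group_op x0 A' ns (state B')) l m') * z powi l" for \<psi> A' B' m' ns l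
    by (simp add: iterate_group_def x0_def z_def)
  define c where "c k = (\<lambda>n. if n < 0 then mode_coeff x x0 n * fcoeff (nat (- n - 1)) k * z powi (- k + n) else 0)" for k
  \<comment> \<open>Replacing \<open>l\<close> by \<open>l + k - n\<close> separates the power of
    \<open>z\<close> that goes with the modes \<open>k\<close> and \<open>n\<close> from an iterate
    with one letter less.\<close>
  have shift: "((\<lambda>(n, ns, l). c k n * I (ns, l + k - n)) has_sum mode_coeff x (zs ! 0) k * v) (UNIV \<times> iterate_indices A)"
    if "(I has_sum v) (iterate_indices A)" for I :: "int list \<times> int \<Rightarrow> complex" and k v
  proof -
    have 1: "((\<lambda>(n, q). c k n * I q) has_sum mode_coeff x (zs ! 0) k * v) (UNIV \<times> iterate_indices A)"
      using has_sum_prod[OF taylor_sum[OF z(1), of x k] that] by (simp add: c_def z(2))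
    show ?thesis
      by (rule has_sum_reindex_bij_witness[THEN iffD2, OF _ _ _ _ _ refl 1,
          of _ "\<lambda>(n, ns, l). (n, ns, l - k + n)" "\<lambda>(n, ns, l). (n, ns, l + k - n)"]) auto
  qed
  let ?N = "\<lambda>k. iterate_group zs (\<lambda>w. \<phi> (fmode s a k w)) A B m" and ?P = "\<lambda>k. iterate_group zs \<phi> A B (fmode s a k m)"
  define f where "f = (\<lambda>(n, ns, l). (\<Sum>k\<in>{- K..-1}. c k n * ?N k (ns, l + k - n)) +
     (ksigns s A * ksigns s B) * (\<Sum>k\<in>{0..C}. c k n * ?P k (ns, l + k - n)) +
     (\<Sum>j<length B. (ksigns s A * ksigns s (take j B)) * (state_contraction x0 x (B ! j) n * iterate_group zs \<phi> A (delete_at j B) m (ns, l))))"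
  have f: "(f has_sum (\<Sum>k\<in>{- K..-1}. mode_coeff x (zs ! 0) k * sN k) + (ksigns s A * ksigns s B) * (\<Sum>k\<in>{0..C}. mode_coeff x (zs ! 0) k * sP k) +
     (\<Sum>j<length B. (ksigns s A * ksigns s (take j B)) * (contraction_coeff x (B ! j) * x0 powi (- int (contraction_order x (B ! j)) - 1) * sH j))) (UNIV \<times> iterate_indices A)"
    unfolding f_def case_prod_beta'
  proof (intro has_sum_add has_sum_finite_sum has_sum_cmult_right)
    show "((\<lambda>q. c k (fst q) * ?N k (fst (snd q), snd (snd q) + k - fst q)) has_sum mode_coeff x (zs ! 0) k * sN k) (UNIV \<times> iterate_indices A)" for k
      using shift[OF neg[of k], of k] by (simp add: x case_prod_beta')
    show "((\<lambda>q. c k (fst q) * ?P k (fst (snd q), snd (snd q) + k - fst q)) has_sum mode_coeff x (zs ! 0) k * sP k) (UNIV \<times> iterate_indices A)" for k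
      using shift[OF pos[of k], of k] by (simp add: x case_prod_beta')
    show "((\<lambda>q. state_contraction x0 x (B ! j) (fst q) * iterate_group zs \<phi> A (delete_at j B) m (fst (snd q), snd (snd q))) has_sum
        contraction_coeff x (B ! j) * x0 powi (- int (contraction_order x (B ! j)) - 1) * sH j) (UNIV \<times> iterate_indices A)" if "j \<in> {..<length B}" for j
      using has_sum_prod[OF state_contraction_sum[of x0 x "B ! j"] con[of j]] that by (simp add: case_prod_beta')
  qed auto
  have "(iterate_group zs \<phi> (x # A) B m has_sum (\<Sum>k\<in>{- K..-1}. mode_coeff x (zs ! 0) k * sN k) + (ksigns s A * ksigns s B) * (\<Sum>k\<in>{0..C}. mode_coeff x (zs ! 0) k * sP k) +
     (\<Sum>j<length B. (ksigns s A * ksigns s (take j B)) * (contraction_coeff x (B ! j) * x0 powi (- int (contraction_order x (B ! j)) - 1) * sH j))) (iterate_indices (x # A))"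
  proof (rule has_sum_reindex_bij_witness[THEN iffD2, OF _ _ _ _ _ refl f,
      of _ "\<lambda>(n, ns, l). (n # ns, l)" "\<lambda>(ns, l). (hd ns, tl ns, l)"])
    fix q :: "int list \<times> int" assume "q \<in> iterate_indices (x # A)"
    then obtain n ns l where q: "q = (n # ns, l)" and ns: "length ns = length A"
      by (cases q) (auto simp: length_Suc_conv)
    show "(case case q of (ns, l) \<Rightarrow> (hd ns, tl ns, l) of (n, ns, l) \<Rightarrow> (n # ns, l)) = q"
      "(case q of (ns, l) \<Rightarrow> (hd ns, tl ns, l)) \<in> UNIV \<times> iterate_indices A"
      using q ns by auto
    let ?u = "group_op x0 A ns (state B)"
    show "f (case q of (ns, l) \<Rightarrow> (hd ns, tl ns, l)) = iterate_group zs \<phi> (x # A) B m q"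
    proof (cases "n < 0")
      case True
      define r where "r = nat (- n - 1)"
      have r: "int r = - n - 1" using True by (simp add: r_def)
      \<comment> \<open>Every mode, creating or annihilating, changes the parity by its species, so
        the inner state has a definite sign although its words differ in length.\<close>
      have parity: "parity s ?u = smul (ksigns s A * ksigns s B) ?u" by (simp add: parity_group_op[OF ns] parity_state linmap_smul[OF linmap_group_op'])
      have pz: "z powi l = z powi (- k + n) * z powi (l + k - n)" for k using z(3) by (simp flip: power_int_add)
      have "iterate_group zs \<phi> (x # A) B m q = mode_coeff x x0 n * \<phi> (fvertex (create s a r ?u) l m) * z powi l"
        using True by (simp add: q iterate_group_eq mode_term_def x fmode_def r_def
            linmap_smul[OF linmap_fvertex_left'] linfun_smul[OF linfun])
      also have "\<dots> = (\<Sum>k\<in>{- K..-1}. mode_coeff x x0 n * (fcoeff r k * \<phi> (fmode s a k (fvertex ?u (l + k - n) m))) * z powi l) +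
        (\<Sum>k\<in>{0..C}. mode_coeff x x0 n * (fcoeff r k * \<phi> (fvertex (parity s ?u) (l + k - n) (fmode s a k m))) * z powi l)"
        using K by (subst fvertex_create_functional[OF linfun _ B, of K])
          (auto simp: x r algebra_simps sum_distrib_left sum_distrib_right)
      also have "(\<Sum>k\<in>{- K..-1}. mode_coeff x x0 n * (fcoeff r k * \<phi> (fmode s a k (fvertex ?u (l + k - n) m))) * z powi l) =
        (\<Sum>k\<in>{- K..-1}. c k n * ?N k (ns, l + k - n))"
      proof (intro sum.cong refl)
        fix k
        show "mode_coeff x x0 n * (fcoeff r k * \<phi> (fmode s a k (fvertex ?u (l + k - n) m))) * z powi l = c k n * ?N k (ns, l + k - n)"
          unfolding pz[of k] iterate_group_eq c_def using True by (simp add: r_def mult_ac)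
      qed
      also have "(\<Sum>k\<in>{0..C}. mode_coeff x x0 n * (fcoeff r k * \<phi> (fvertex (parity s ?u) (l + k - n) (fmode s a k m))) * z powi l) =
        (ksigns s A * ksigns s B) * (\<Sum>k\<in>{0..C}. c k n * ?P k (ns, l + k - n))"
        unfolding sum_distrib_left
      proof (intro sum.cong refl)
        fix k
        show "mode_coeff x x0 n * (fcoeff r k * \<phi> (fvertex (parity s ?u) (l + k - n) (fmode s a k m))) * z powi l =
          (ksigns s A * ksigns s B) * (c k n * ?P k (ns, l + k - n))"
          unfolding pz[of k] iterate_group_eq c_def parity linmap_smul[OF linmap_fvertex_left'] linfun_smul[OF linfun] using True by (simp add: r_def mult_ac)
      qed
      finally show ?thesis using True by (simp add: q f_def state_contraction_def)
    next
      case False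
      have "iterate_group zs \<phi> (x # A) B m q = ksigns s A * \<phi> (fvertex (group_op x0 A ns (nonneg_term x0 x n (state B))) l m) * z powi l"
        using False by (simp add: q iterate_group_eq nonneg_term_def x
            linmap_smul[OF linmap_fvertex_left'] linfun_smul[OF linfun])
      also have "\<dots> = (\<Sum>j<length B. (ksigns s A * ksigns s (take j B)) * (state_contraction x0 x (B ! j) n * iterate_group zs \<phi> A (delete_at j B) m (ns, l)))"
        by (simp add: nonneg_term_state x iterate_group_eq linmap_sum[OF linmap_group_op'] linmap_smul[OF linmap_group_op']
          linmap_sum[OF linmap_fvertex_left'] linmap_smul[OF linmap_fvertex_left'] linfun_sum[OF linfun] linfun_smul[OF linfun] sum_distrib_left sum_distrib_right mult_ac)
      finally show ?thesis using False by (simp add: q f_def c_def)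
    qed
  qed auto
  then show ?thesis by (simp add: x x0_def distrib_left sum_distrib_left mult_ac add_ac)
qed

section \<open>Products of vertex operators\<close>

fun group_fields :: "(nat \<times> 'h letter list) list \<Rightarrow> int list \<Rightarrow> 'h fock \<Rightarrow> 'h fock" where
  "group_fields ((i, A) # Gs) (k # ks) m = ffield A k (group_fields Gs ks m)"
| "group_fields _ _ m = m"

fun group_power :: "complex list \<Rightarrow> (nat \<times> 'h letter list) list \<Rightarrow> int list \<Rightarrow> complex" where
  "group_power zs ((i, A) # Gs) (k # ks) = (zs ! i) powi k * group_power zs Gs ks"
| "group_power _ _ _ = 1"

text \<open>
  The mode indices that contribute to the coefficient of \<open>z\<^sub>1\<^bsup>k\<^sub>1\<^esup> z\<^sub>2\<^bsup>k\<^sub>2\<^esup> \<cdots>\<close>.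
\<close>

fun index_fibre :: "(nat \<times> 'h letter list) list \<Rightarrow> int list \<Rightarrow> int list list set" where
  "index_fibre ((i, A) # Gs) (k # ks) = (\<lambda>(ns, Ns). ns # Ns) ` (mode_indices A k \<times> index_fibre Gs ks)"
| "index_fibre [] [] = {[]}"
| "index_fibre _ _ = {}"

lemma ffield_has_sum:
  assumes phi: "linfun \<phi>" and "z \<noteq> 0"
  shows "((\<lambda>ns. \<phi> (group_op z A ns m)) has_sum z powi k * \<phi> (ffield A k m)) (mode_indices A k)"
proof -
  let ?S = "{ns \<in> mode_indices A k. fterm A ns m \<noteq> 0}"
  have eq: "\<phi> (group_op z A ns m) = z powi k * \<phi> (fterm A ns m)" if "ns \<in> mode_indices A k" for ns
    using that group_op_fterm[of ns A z m] assms(2) by (simp add: mode_indices_def linfun_smul[OF phi])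
  have "((\<lambda>ns. z powi k * \<phi> (fterm A ns m)) has_sum (\<Sum>ns\<in>?S. z powi k * \<phi> (fterm A ns m))) ?S"
    by (rule has_sum_finite[OF finite_supp])
  moreover have "((\<lambda>ns. z powi k * \<phi> (fterm A ns m)) has_sum (\<Sum>ns\<in>?S. z powi k * \<phi> (fterm A ns m))) ?S \<longleftrightarrow>
    ((\<lambda>ns. \<phi> (group_op z A ns m)) has_sum (\<Sum>ns\<in>?S. z powi k * \<phi> (fterm A ns m))) (mode_indices A k)"
    by (rule has_sum_cong_neutral) (auto simp: eq linfun_zero[OF phi])
  moreover have "(\<Sum>ns\<in>?S. z powi k * \<phi> (fterm A ns m)) = z powi k * \<phi> (ffield A k m)"
    by (simp add: ffield_def linfun_sum[OF phi] sum_distrib_left)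
  ultimately show ?thesis by simp
qed

text \<open>The sum is evaluated one group at a time; summability on the whole fibre turns the
  iterated sum into the sum. \<open>\<phi>\<close> is generalised because the outer group is
  absorbed into it.\<close>

lemma index_fibre_has_sum:
  assumes "linfun \<phi>" "length ks = length Gs" "\<forall>G\<in>set Gs. zs ! fst G \<noteq> 0"
    and "(\<lambda>Ns. \<phi> (groups_op zs Gs Ns m)) summable_on index_fibre Gs ks"
  shows "((\<lambda>Ns. \<phi> (groups_op zs Gs Ns m)) has_sum group_power zs Gs ks * \<phi> (group_fields Gs ks m)) (index_fibre Gs ks)"
  using assms
proof (induct Gs arbitrary: \<phi> ks)
  case Nil
  then show ?case using has_sum_finite[of "{[] :: int list list}" "\<lambda>Ns. \<phi> (groups_op zs [] Ns m)"] by simp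
next
  case (Cons G Gs)
  obtain i A where G: "G = (i, A)" by (cases G)
  obtain k ks' where ks: "ks = k # ks'" using Cons(3) by (cases ks) auto
  note phi = Cons(2)
  let ?f = "\<lambda>(ns, Ns). \<phi> (group_op (zs ! i) A ns (groups_op zs Gs Ns m))"
  have inj: "inj_on (\<lambda>(ns, Ns). ns # Ns) (mode_indices A k \<times> index_fibre Gs ks')" by (auto simp: inj_on_def)
  have summ: "?f summable_on mode_indices A k \<times> index_fibre Gs ks'"
    using Cons(5) unfolding G ks index_fibre.simps summable_on_reindex[OF inj]
    by (rule summable_on_cong[THEN iffD1, rotated]) auto
  have "(?f has_sum group_power zs Gs ks' * (zs ! i powi k * \<phi> (ffield A k (group_fields Gs ks' m)))) (mode_indices A k \<times> index_fibre Gs ks')"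
  proof (rule has_sum_SigmaI[OF _ _ summ])
    fix ns assume ns: "ns \<in> mode_indices A k"
    have "(\<lambda>Ns. \<phi> (group_op (zs ! i) A ns (groups_op zs Gs Ns m))) summable_on index_fibre Gs ks'"
      using summable_on_SigmaD1[OF summ ns] by simp
    then show "((\<lambda>Ns. ?f (ns, Ns)) has_sum group_power zs Gs ks' * \<phi> (group_op (zs ! i) A ns (group_fields Gs ks' m))) (index_fibre Gs ks')"
      using Cons(1)[OF linfun_comp[OF phi linmap_group_op'], of ks'] Cons(3,4) by (auto simp: ks)
  next
    show "((\<lambda>ns. group_power zs Gs ks' * \<phi> (group_op (zs ! i) A ns (group_fields Gs ks' m))) has_sum
      group_power zs Gs ks' * (zs ! i powi k * \<phi> (ffield A k (group_fields Gs ks' m)))) (mode_indices A k)"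
      using Cons(4) by (intro has_sum_cmult_right ffield_has_sum phi) (auto simp: G)
  qed
  then show ?case
    unfolding G ks index_fibre.simps group_fields.simps group_power.simps has_sum_reindex[OF inj]
    by (rule has_sum_cong[THEN iffD1, rotated, THEN back_subst[of "\<lambda>s. (_ has_sum s) _"]]) (auto simp: mult_ac)
qed

lemma index_fibre_group_indices: "length ks = length Gs \<Longrightarrow> Ns \<in> index_fibre Gs ks \<longleftrightarrow> Ns \<in> group_indices Gs \<and> ks = map2 (\<lambda>G ns. exponent (snd G) ns) Gs Ns"
proof (induct Gs arbitrary: ks Ns)
  case (Cons G Gs)
  obtain i A where G: "G = (i, A)" by (cases G)
  obtain k ks' where ks: "ks = k # ks'" using Cons(2) by (cases ks) auto
  show ?case
    using Cons(1)[of ks' "tl Ns"] Cons(2) by (cases Ns) (auto simp: G ks group_indices_Cons mode_indices_def image_iff)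
qed auto

text \<open>Each family of mode lists lies in exactly one fibre, that of its exponents, so the sum
  over modes becomes a sum over exponents, as \<open>product_term\<close> requires.\<close>

lemma group_has_sum:
  assumes phi: "linfun \<phi>" and nz: "\<forall>G\<in>set Gs. zs ! fst G \<noteq> 0"
    and H: "((\<lambda>Ns. \<phi> (groups_op zs Gs Ns m)) has_sum s) (group_indices Gs)"
  shows "((\<lambda>ks. group_power zs Gs ks * \<phi> (group_fields Gs ks m)) has_sum s) {ks. length ks = length Gs}"
proof (rule has_sum_SigmaD)
  let ?K = "{ks :: int list. length ks = length Gs}"
  have *: "((\<lambda>(ks, Ns). \<phi> (groups_op zs Gs Ns m)) has_sum s) (Sigma ?K (index_fibre Gs)) \<longleftrightarrow>
    ((\<lambda>Ns. \<phi> (groups_op zs Gs Ns m)) has_sum s) (group_indices Gs)"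
    by (rule has_sum_reindex_bij_witness[of _ "\<lambda>Ns. (map2 (\<lambda>G ns. exponent (snd G) ns) Gs Ns, Ns)" snd])
      (auto simp: index_fibre_group_indices group_indices_length)
  then show 1: "((\<lambda>(ks, Ns). \<phi> (groups_op zs Gs Ns m)) has_sum s) (Sigma ?K (index_fibre Gs))" using H by simp
  fix ks assume ks: "ks \<in> ?K"
  have "(\<lambda>Ns. \<phi> (groups_op zs Gs Ns m)) summable_on index_fibre Gs ks"
    using has_sum_imp_summable[OF H] by (rule summable_on_subset_banach) (use ks index_fibre_group_indices in auto)
  then show "((\<lambda>Ns. (\<lambda>(ks, Ns). \<phi> (groups_op zs Gs Ns m)) (ks, Ns)) has_sum group_power zs Gs ks * \<phi> (group_fields Gs ks m)) (index_fibre Gs ks)"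
    using index_fibre_has_sum[OF phi _ nz] ks by simp
qed

lemma polyfun_nth: "polyfun (Suc 0) P \<Longrightarrow> i < n \<Longrightarrow> polyfun n (\<lambda>zs. P [zs ! i])"
  by (induct rule: polyfun.induct) (auto intro: polyfun.intros)

lemma rational_on_nth: "rational_on (Suc 0) f \<Longrightarrow> i < n \<Longrightarrow> rational_on n (\<lambda>zs. f [zs ! i])"
proof -
  assume "rational_on (Suc 0) f" and i: "i < n"
  then obtain P Q where PQ: "polyfun (Suc 0) P" "polyfun (Suc 0) Q" "\<And>zs. admissible (Suc 0) zs \<Longrightarrow> Q zs \<noteq> 0 \<and> f zs = P zs / Q zs"
    by (auto simp: rational_on_def)
  have "admissible (Suc 0) [zs ! i]" if "admissible n zs" for zs
  proof -
    have "zs ! i \<in> set zs" "0 \<notin> set zs" using that i by (auto simp: admissible_def)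
    then have "zs ! i \<noteq> 0" by metis
    then show ?thesis by (simp add: admissible_def)
  qed
  then show ?thesis unfolding rational_on_def
    using PQ by (intro exI[of _ "\<lambda>zs. P [zs ! i]"] exI[of _ "\<lambda>zs. Q [zs ! i]"]) (auto intro: polyfun_nth i)
qed

text \<open>Both claims are proved in one induction on \<open>A\<close> because they must share
  \<open>f\<close>. \<open>B\<close> varies since contractions delete its letters,
  \<open>\<phi>\<close> and \<open>m\<close> since modes are absorbed into them.\<close>

theorem iterate_exists:
  "bounded_linfun \<phi> \<Longrightarrow> \<exists>f. group_limit 2 \<phi> [(0, A), (1, B)] m f \<and> (\<forall>zs. iterate_region zs \<longrightarrow> (iterate_group zs \<phi> A B m has_sum f zs) (iterate_indices A))"
proof (induct A arbitrary: \<phi> B m)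
  case Nil
  obtain f where f: "group_limit (Suc 0) \<phi> [(0, B)] m f"
    using group_limit_exists[OF _ Nil, of "Suc 0" "[(0, B)]" m] by (auto simp: wf_groups_def)
  \<comment> \<open>The one-point product region consists of all nonzero numbers, so the value at
    \<open>zs ! 1\<close> alone is available in both regions.\<close>
  have 1: "((\<lambda>Ns. \<phi> (groups_op [zs ! 1] [(0, B)] Ns m)) has_sum f [zs ! 1]) (group_indices [(0, B)])" if "zs ! 1 \<noteq> 0" for zs
    using f that by (auto simp: group_limit_def product_region_def)
  have "group_limit 2 \<phi> [(0, []), (1, B)] m (\<lambda>zs. f [zs ! 1])"
    unfolding group_limit_def
  proof (intro conjI allI impI)
    show "rational_on 2 (\<lambda>zs. f [zs ! 1])" using f by (intro rational_on_nth) (auto simp: group_limit_def)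
    fix zs assume "product_region 2 zs"
    then have "zs ! 1 \<noteq> 0" using nth_mem[of 1 zs] by (auto simp: product_region_def)
    moreover have "((\<lambda>Ns. \<phi> (groups_op zs [(0, []), (1, B)] Ns m)) has_sum f [zs ! 1]) (group_indices [(0, []), (1, B)]) \<longleftrightarrow>
      ((\<lambda>Ns. \<phi> (groups_op [zs ! 1] [(0, B)] Ns m)) has_sum f [zs ! 1]) (group_indices [(0, B)])"
      by (rule has_sum_reindex_bij_witness[of _ "\<lambda>Ns. [] # Ns" tl]) (auto simp: group_indices_Cons)
    ultimately show "((\<lambda>Ns. \<phi> (groups_op zs [(0, []), (1, B)] Ns m)) has_sum f [zs ! 1]) (group_indices [(0, []), (1, B)])"
      using 1 by blast
  qed
  moreover have "(iterate_group zs \<phi> [] B m has_sum f [zs ! 1]) (iterate_indices [])" if "iterate_region zs" for zs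
  proof -
    have nz: "zs ! 1 \<noteq> 0" using that by (auto simp: iterate_region_def)
    moreover have "((\<lambda>ks. group_power [zs ! 1] [(0, B)] ks * \<phi> (group_fields [(0, B)] ks m)) has_sum f [zs ! 1]) {ks. length ks = length [(0 :: nat, B)]}"
      using Nil 1[OF nz] nz by (intro group_has_sum) (auto simp: bounded_linfun_def)
    moreover have "(iterate_group zs \<phi> [] B m has_sum f [zs ! 1]) (iterate_indices []) \<longleftrightarrow>
      ((\<lambda>ks. group_power [zs ! 1] [(0, B)] ks * \<phi> (group_fields [(0, B)] ks m)) has_sum f [zs ! 1]) {ks. length ks = length [(0 :: nat, B)]}"
      by (rule has_sum_reindex_bij_witness[of _ "\<lambda>ks. ([], hd ks)" "\<lambda>(ns, l). [l]"])
        (auto simp: length_Suc_conv iterate_group_def fvertex_state)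
    ultimately show ?thesis by simp
  qed
  ultimately show ?case by blast
next
  case (Cons x A)
  note phi = Cons(2)
  let ?s = "fst x" and ?a = "fst (snd x)"
  let ?H = "\<lambda>\<phi> B m f. group_limit 2 \<phi> [(0, A), (1, B)] m f \<and> (\<forall>zs. iterate_region zs \<longrightarrow> (iterate_group zs \<phi> A B m has_sum f zs) (iterate_indices A))"
  obtain K where K: "\<And>k w. k < - K \<Longrightarrow> \<phi> (fmode ?s ?a k w) = 0"
    using bounded_linfun_cut[OF phi, where s = ?s and a = ?a] by blast
  obtain C where C: "size_le C m" using size_le_exists by blast
  define FN where "FN k = (SOME f. ?H (\<lambda>w. \<phi> (fmode ?s ?a k w)) B m f)" for k
  have FN: "?H (\<lambda>w. \<phi> (fmode ?s ?a k w)) B m (FN k)" for k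
    unfolding FN_def using Cons(1)[OF bounded_linfun_fmode[OF phi]] by (rule someI_ex)
  \<comment> \<open>\<open>ffield' k\<close> is the limit with the mode \<open>k\<close> applied to
    \<open>m\<close>: a function of the points, not a field.\<close>
  define ffield' where "ffield' k = (SOME f. ?H \<phi> B (fmode ?s ?a k m) f)" for k
  have ffield': "?H \<phi> B (fmode ?s ?a k m) (ffield' k)" for k
    unfolding ffield'_def using Cons(1)[OF phi] by (rule someI_ex)
  define FH where "FH j = (SOME f. ?H \<phi> (delete_at j B) m f)" for j
  have FH: "?H \<phi> (delete_at j B) m (FH j)" for j
    unfolding FH_def using Cons(1)[OF phi] by (rule someI_ex)
  have ends: "transport_limit 2 \<phi> 0 x [(0, A), (1, B)] [] m (\<lambda>zs. \<Sum>k\<in>{0..C}. mode_coeff x (zs ! 0) k * ffield' k zs)"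
    unfolding transport_limit_def append_Nil2
  proof (intro conjI allI impI)
    show "rational_on 2 (\<lambda>zs. \<Sum>k\<in>{0..C}. mode_coeff x (zs ! 0) k * ffield' k zs)"
      using ffield' by (intro rational_on_sum rational_on_mult rational_on_mode_coeff) (auto simp: group_limit_def)
    fix zs assume "product_region 2 zs"
    then show "(transport zs \<phi> (zs ! 0) x [(0, A), (1, B)] [] m has_sum (\<Sum>k\<in>{0..C}. mode_coeff x (zs ! 0) k * ffield' k zs)) (UNIV \<times> group_indices [(0, A), (1, B)])"
      using ffield' phi by (intro end_step) (auto simp: group_limit_def bounded_linfun_def fmode_eq_0[OF C])
  qed
  have "transport_limit 2 \<phi> 0 x ([(0, A)] @ [(1, B)]) [] m (\<lambda>zs. \<Sum>k\<in>{0..C}. mode_coeff x (zs ! 0) k * ffield' k zs)" using ends by simp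
  moreover have "group_limit 2 \<phi> ([(0, A)] @ (1, delete_at j B) # []) m (FH j)" for j using FH by simp
  ultimately have Q: "transport_limit 2 \<phi> 0 x [(0, A)] [(1, B)] m (\<lambda>zs. ksigns ?s B * (\<Sum>k\<in>{0..C}. mode_coeff x (zs ! 0) k * ffield' k zs) +
    (\<Sum>j<length B. ksigns ?s (take j B) * (contraction_coeff x (B ! j) * (zs ! 0 - zs ! 1) powi (- int (contraction_order x (B ! j)) - 1)) * FH j zs))"
    by (intro transport_limit_move phi) auto
  \<comment> \<open>One expression serves both claims: it is the value of
    \<open>group_limit_split\<close> applied to \<open>Q\<close> and also the value of
    \<open>iterate_step\<close>.\<close>
  let ?f = "\<lambda>zs. (\<Sum>k\<in>{- K..-1}. mode_coeff x (zs ! 0) k * FN k zs) + ksigns ?s A * (ksigns ?s B * (\<Sum>k\<in>{0..C}. mode_coeff x (zs ! 0) k * ffield' k zs) +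
    (\<Sum>j<length B. ksigns ?s (take j B) * (contraction_coeff x (B ! j) * (zs ! 0 - zs ! 1) powi (- int (contraction_order x (B ! j)) - 1)) * FH j zs))"
  have "group_limit 2 \<phi> [(0, x # A), (1, B)] m ?f"
    by (rule group_limit_split[OF phi K _ _ Q]) (use FN in auto)
  moreover have "(iterate_group zs \<phi> (x # A) B m has_sum ?f zs) (iterate_indices (x # A))" if "iterate_region zs" for zs
    using FN ffield' FH that by (intro iterate_step[OF phi K C]) auto
  ultimately show ?case by blast
qed

end

section \<open>Multilinear extension of the limits from words to arbitrary vectors\<close>

lemma vec_induct [case_names zero add smul basis]:
  assumes "P 0" "\<And>x y. P x \<Longrightarrow> P y \<Longrightarrow> P (x + y)" "\<And>c x. P x \<Longrightarrow> P (smul c x)"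
    and "\<And>w. w \<in> Poly_Mapping.keys m \<Longrightarrow> P (bv w)"
  shows "P m"
proof -
  have "P (\<Sum>w\<in>S. smul (Poly_Mapping.lookup m w) (bv w))" if "finite S" "S \<subseteq> Poly_Mapping.keys m" for S
    using that by (induct S rule: finite_induct) (auto intro: assms)
  from this[OF finite_keys subset_refl] show ?thesis by (simp flip: bv_expansion)
qed

context bilinear_form_space
begin

definition vertex_product :: "('h fock \<times> int) list \<Rightarrow> 'h fock \<Rightarrow> 'h fock" where
  "vertex_product uks m = foldr (\<lambda>(u, k). fvertex u k) uks m"

lemma linmap_vertex_product: "linmap f \<Longrightarrow> linmap (\<lambda>m. vertex_product uks (f m))"
  unfolding vertex_product_def by (induct uks) (auto intro!: linmap_fvertex_right)

lemma product_term_vertex_product: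
  "product_term fvertex \<phi> us m zs ks = \<phi> (vertex_product (zip us ks) m) * (\<Prod>i<length us. (zs ! i) powi (ks ! i))"
  by (simp add: product_term_def vertex_product_def)

lemma vertex_product_split:
  "length ks = Suc (length us + length us') \<Longrightarrow> vertex_product (zip (us @ u # us') ks) m =
     vertex_product (zip us (take (length us) ks)) (fvertex u (ks ! length us) (vertex_product (zip us' (drop (Suc (length us)) ks)) m))"
proof -
  assume l: "length ks = Suc (length us + length us')"
  define n where "n = length us"
  have n: "n < length ks" using l by (simp add: n_def)
  have "zip (us @ u # us') ks = zip us (take n ks) @ (u, ks ! n) # zip us' (drop (Suc n) ks)"
    by (subst id_take_nth_drop[OF n]) (use n in \<open>simp add: n_def\<close>)
  then show ?thesis by (simp add: vertex_product_def n_def)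
qed

definition product_limit :: "('h fock \<Rightarrow> complex) \<Rightarrow> 'h fock list \<Rightarrow>
    'h fock \<Rightarrow> (complex list \<Rightarrow> complex) \<Rightarrow> bool" where
  "product_limit \<phi> us m f \<longleftrightarrow> rational_on (length us) f \<and>
     (\<forall>zs. product_region (length us) zs \<longrightarrow> (product_term fvertex \<phi> us m zs has_sum f zs) {ks. length ks = length us})"

lemma product_limit_zero: "linfun \<phi> \<Longrightarrow> product_limit \<phi> (us @ 0 # us') m (\<lambda>_. 0)"
  by (auto simp: product_limit_def product_term_vertex_product vertex_product_split linmap_zero[OF linmap_fvertex_left'] linmap_zero[OF linmap_vertex_product[OF linmap_id]] linfun_zero
    intro!: has_sum_0)

lemma product_limit_add:
  assumes "linfun \<phi>" "product_limit \<phi> (us @ u # us') m f" "product_limit \<phi> (us @ v # us') m g"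
  shows "product_limit \<phi> (us @ (u + v) # us') m (\<lambda>zs. f zs + g zs)"
proof -
  let ?n = "length us + Suc (length us')"
  have "product_term fvertex \<phi> (us @ (u + v) # us') m zs ks =
    product_term fvertex \<phi> (us @ u # us') m zs ks + product_term fvertex \<phi> (us @ v # us') m zs ks" if "length ks = ?n" for zs ks
    using that by (simp add: product_term_vertex_product vertex_product_split linmap_add[OF linmap_fvertex_left'] linmap_add[OF linmap_vertex_product[OF linmap_id]]
      linfun_add[OF assms(1)] distrib_right)
  note eq = this
  have "((\<lambda>ks. product_term fvertex \<phi> (us @ u # us') m zs ks + product_term fvertex \<phi> (us @ v # us') m zs ks)
     has_sum (f zs + g zs)) {ks. length ks = ?n}" if "product_region ?n zs" for zs
    using assms(2,3) that by (intro has_sum_add) (auto simp: product_limit_def)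
  then have "(product_term fvertex \<phi> (us @ (u + v) # us') m zs has_sum f zs + g zs) {ks. length ks = ?n}"
    if "product_region ?n zs" for zs
    by (rule has_sum_cong[THEN iffD1, rotated]) (use that eq in auto)
  then show ?thesis using assms(2,3)
    by (auto simp: product_limit_def intro!: rational_on_add)
qed

lemma product_limit_smul:
  assumes "linfun \<phi>" "product_limit \<phi> (us @ u # us') m f"
  shows "product_limit \<phi> (us @ smul c u # us') m (\<lambda>zs. c * f zs)"
proof -
  let ?n = "length us + Suc (length us')"
  have "product_term fvertex \<phi> (us @ smul c u # us') m zs ks = c * product_term fvertex \<phi> (us @ u # us') m zs ks"
    if "length ks = ?n" for zs ks
    using that by (simp add: product_term_vertex_product vertex_product_split linmap_smul[OF linmap_fvertex_left'] linmap_smul[OF linmap_vertex_product[OF linmap_id]]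
      linfun_smul[OF assms(1)])
  note eq = this
  have "((\<lambda>ks. c * product_term fvertex \<phi> (us @ u # us') m zs ks) has_sum (c * f zs)) {ks. length ks = ?n}"
    if "product_region ?n zs" for zs
    using assms(2) that by (intro has_sum_cmult_right) (auto simp: product_limit_def)
  then have "(product_term fvertex \<phi> (us @ smul c u # us') m zs has_sum c * f zs) {ks. length ks = ?n}"
    if "product_region ?n zs" for zs
    by (rule has_sum_cong[THEN iffD1, rotated]) (use that eq in auto)
  then show ?thesis using assms(2)
    by (auto simp: product_limit_def intro!: rational_on_mult)
qed

lemma group_power_enumerate: "length ks = length As \<Longrightarrow>
    group_power zs (List.enumerate k As) ks = (\<Prod>i<length As. (zs ! (k + i)) powi (ks ! i))"
proof (induct As arbitrary: k ks)
  case (Cons A As)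
  then show ?case by (cases ks) (auto simp: prod.lessThan_Suc_shift simp del: prod.lessThan_Suc)
qed simp

lemma group_fields_enumerate: "length ks = length As \<Longrightarrow> group_fields (List.enumerate k As) ks m = vertex_product (zip (map bv As) ks) m"
proof (induct As arbitrary: k ks)
  case (Cons A As)
  then show ?case by (cases ks) (auto simp: vertex_product_def)
qed (simp add: vertex_product_def)

lemma group_limit_product_limit:
  assumes "linfun \<phi>" "group_limit (length As) \<phi> (List.enumerate 0 As) m f"
  shows "product_limit \<phi> (map bv As) m f"
  unfolding product_limit_def
proof (intro conjI allI impI)
  show "rational_on (length (map bv As)) f" using assms(2) by (simp add: group_limit_def)
  fix zs assume "product_region (length (map bv As)) zs"
  then have zs: "product_region (length As) zs" by simp
  have "\<forall>G\<in>set (List.enumerate 0 As). zs ! fst G \<noteq> 0"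
  proof
    fix G assume "G \<in> set (List.enumerate 0 As)"
    then have "fst G < length zs" using zs by (auto simp: product_region_def in_set_enumerate_eq)
    then show "zs ! fst G \<noteq> 0" using zs nth_mem[of "fst G" zs] by (auto simp: product_region_def)
  qed
  then have "((\<lambda>ks. group_power zs (List.enumerate 0 As) ks * \<phi> (group_fields (List.enumerate 0 As) ks m)) has_sum f zs) {ks. length ks = length (List.enumerate 0 As)}"
    using assms zs by (intro group_has_sum) (auto simp: group_limit_def)
  then have "((\<lambda>ks. group_power zs (List.enumerate 0 As) ks * \<phi> (group_fields (List.enumerate 0 As) ks m)) has_sum f zs) {ks. length ks = length As}"
    by simp
  then show "(product_term fvertex \<phi> (map bv As) m zs has_sum f zs) {ks. length ks = length (map bv As)}"
    unfolding length_map by (rule has_sum_cong[THEN iffD1, rotated])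
      (auto simp: group_power_enumerate group_fields_enumerate product_term_vertex_product mult.commute)
qed

lemma wf_enumerate: "wf_groups (length As) (List.enumerate 0 As)"
  by (auto simp: wf_groups_def in_set_enumerate_eq)

text \<open>The slots are reduced to words from the left: \<open>ws\<close> collects those already
  done, and linearity in the next slot reduces it to a word as well.\<close>

theorem product_limit_exists:
  assumes phi: "bounded_linfun \<phi>"
  shows "\<exists>f. product_limit \<phi> us m f"
proof -
  have linfun: "linfun \<phi>" using phi by (simp add: bounded_linfun_def)
  have "\<exists>f. product_limit \<phi> (map bv ws @ us) m f" for ws
  proof (induct us arbitrary: ws)
    case Nil
    then show ?case using group_limit_exists[OF wf_enumerate phi, of ws m] group_limit_product_limit[OF linfun] by auto
  next
    case (Cons u us)
    show ?case
    proof (rule vec_induct[of "\<lambda>u. \<exists>f. product_limit \<phi> (map bv ws @ u # us) m f"])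
      show "\<exists>f. product_limit \<phi> (map bv ws @ bv w # us) m f" for w
        using Cons[of "ws @ [w]"] by simp
    qed (blast intro: product_limit_zero[OF linfun] product_limit_add[OF linfun] product_limit_smul[OF linfun])+
  qed
  from this[of "[]"] show ?thesis by simp
qed

definition iterate_limit :: "('h fock \<Rightarrow> complex) \<Rightarrow> 'h fock \<Rightarrow> 'h fock \<Rightarrow>
    'h fock \<Rightarrow> (complex list \<Rightarrow> complex) \<Rightarrow> bool" where
  "iterate_limit \<phi> u v m f \<longleftrightarrow> product_limit \<phi> [u, v] m f \<and>
     (\<forall>zs. iterate_region zs \<longrightarrow> (iterate_term fvertex \<phi> u v m (zs ! 0) (zs ! 1) has_sum f zs) UNIV)"

lemma iterate_group_iterate:
  assumes phi: "linfun \<phi>" and zs: "iterate_region zs" and H: "(iterate_group zs \<phi> A B m has_sum s) (iterate_indices A)"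
  shows "(iterate_term fvertex \<phi> (bv A) (state B) m (zs ! 0) (zs ! 1) has_sum s) UNIV"
proof (rule has_sum_SigmaD)
  let ?f = "\<lambda>(p, ns). iterate_group zs \<phi> A B m (ns, snd p)"
  have "(?f has_sum s) (Sigma UNIV (\<lambda>p. mode_indices A (fst p))) \<longleftrightarrow> (iterate_group zs \<phi> A B m has_sum s) (iterate_indices A)"
    by (rule has_sum_reindex_bij_witness[of _ "\<lambda>(ns, l). ((exponent A ns, l), ns)" "\<lambda>(p, ns). (ns, snd p)"])
      (auto simp: mode_indices_def)
  then show "(?f has_sum s) (Sigma UNIV (\<lambda>p. mode_indices A (fst p)))" using H by simp
  fix p :: "int \<times> int"
  have "zs ! 0 - zs ! 1 \<noteq> 0" using zs by (auto simp: iterate_region_def)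
  then have "((\<lambda>ns. \<phi> (fvertex (group_op (zs ! 0 - zs ! 1) A ns (state B)) (snd p) m) * zs ! 1 powi snd p) has_sum
      (zs ! 0 - zs ! 1) powi fst p * \<phi> (fvertex (ffield A (fst p) (state B)) (snd p) m) * zs ! 1 powi snd p) (mode_indices A (fst p))"
    using ffield_has_sum[of "\<lambda>w. \<phi> (fvertex w (snd p) m)"] linfun_comp[OF phi linmap_fvertex_left']
    by (intro has_sum_cmult_left) auto
  then show "((\<lambda>ns. ?f (p, ns)) has_sum iterate_term fvertex \<phi> (bv A) (state B) m (zs ! 0) (zs ! 1) p) (mode_indices A (fst p))"
    by (simp add: iterate_group_def iterate_term_def case_prod_beta' mult_ac)
qed

definition basis_span :: "'h fock set" where
  "basis_span = {m. \<forall>w\<in>Poly_Mapping.keys m. \<forall>(s, b, j)\<in>set w. b \<in> Basis}"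

text \<open>The iterate is computed on \<open>state B\<close>, which agrees with \<open>bv B\<close>
  for words over the basis; this explains the assumption on \<open>v\<close>.\<close>

theorem iterate_limit_exists:
  assumes phi: "bounded_linfun \<phi>" and v: "v \<in> basis_span"
  shows "\<exists>f. iterate_limit \<phi> u v m f"
proof -
  have linfun: "linfun \<phi>" using phi by (simp add: bounded_linfun_def)
  have zero: "iterate_limit \<phi> 0 v m (\<lambda>_. 0)" "iterate_limit \<phi> u 0 m (\<lambda>_. 0)" for u v
    using product_limit_zero[OF linfun, of "[]" "[v]" m] product_limit_zero[OF linfun, of "[u]" "[]" m]
    by (auto simp: iterate_limit_def iterate_term_def case_prod_beta' linmap_zero[OF linmap_fvertex_left'] linmap_zero[OF linmap_fvertex_right'] linfun_zero[OF linfun] intro!: has_sum_0)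
  have add1: "iterate_limit \<phi> (x + y) v m (\<lambda>zs. f zs + g zs)" if "iterate_limit \<phi> x v m f" "iterate_limit \<phi> y v m g" for x y v f g
  proof -
    have "iterate_term fvertex \<phi> (x + y) v m z w = (\<lambda>p. iterate_term fvertex \<phi> x v m z w p + iterate_term fvertex \<phi> y v m z w p)" for z w
      by (simp add: fun_eq_iff iterate_term_def linmap_add[OF linmap_fvertex_left'] linfun_add[OF linfun] algebra_simps)
    then show ?thesis using that product_limit_add[OF linfun, of "[]" x "[v]" m f y g] by (auto simp: iterate_limit_def intro: has_sum_add)
  qed
  have add2: "iterate_limit \<phi> u (x + y) m (\<lambda>zs. f zs + g zs)" if "iterate_limit \<phi> u x m f" "iterate_limit \<phi> u y m g" for x y u f g
  proof -
    have "iterate_term fvertex \<phi> u (x + y) m z w = (\<lambda>p. iterate_term fvertex \<phi> u x m z w p + iterate_term fvertex \<phi> u y m z w p)" for z w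
      by (simp add: fun_eq_iff iterate_term_def linmap_add[OF linmap_fvertex_left'] linmap_add[OF linmap_fvertex_right'] linfun_add[OF linfun] algebra_simps)
    then show ?thesis using that product_limit_add[OF linfun, of "[u]" x "[]" m f y g] by (auto simp: iterate_limit_def intro: has_sum_add)
  qed
  have smul1: "iterate_limit \<phi> (smul c x) v m (\<lambda>zs. c * f zs)" if "iterate_limit \<phi> x v m f" for x c v f
  proof -
    have "iterate_term fvertex \<phi> (smul c x) v m z w = (\<lambda>p. c * iterate_term fvertex \<phi> x v m z w p)" for z w
      by (simp add: fun_eq_iff iterate_term_def linmap_smul[OF linmap_fvertex_left'] linfun_smul[OF linfun])
    then show ?thesis using that product_limit_smul[OF linfun, of "[]" x "[v]" m f c] by (auto simp: iterate_limit_def intro: has_sum_cmult_right)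
  qed
  have smul2: "iterate_limit \<phi> u (smul c x) m (\<lambda>zs. c * f zs)" if "iterate_limit \<phi> u x m f" for x c u f
  proof -
    have "iterate_term fvertex \<phi> u (smul c x) m z w = (\<lambda>p. c * iterate_term fvertex \<phi> u x m z w p)" for z w
      by (simp add: fun_eq_iff iterate_term_def linmap_smul[OF linmap_fvertex_left'] linmap_smul[OF linmap_fvertex_right'] linfun_smul[OF linfun])
    then show ?thesis using that product_limit_smul[OF linfun, of "[u]" x "[]" m f c] by (auto simp: iterate_limit_def intro: has_sum_cmult_right)
  qed
  have word: "\<exists>f. iterate_limit \<phi> (bv A) (bv B) m f" if "\<forall>(s, b, j)\<in>set B. b \<in> Basis" for A B
  proof -
    obtain f where f: "group_limit 2 \<phi> [(0, A), (1, B)] m f" "\<And>zs. iterate_region zs \<Longrightarrow> (iterate_group zs \<phi> A B m has_sum f zs) (iterate_indices A)"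
      using iterate_exists[OF phi, of A B m] by blast
    have "group_limit (length [A, B]) \<phi> (List.enumerate 0 [A, B]) m f" using f(1) by (simp add: numeral_2_eq_2)
    from group_limit_product_limit[OF linfun this] have "product_limit \<phi> [bv A, bv B] m f" by simp
    moreover have "(iterate_term fvertex \<phi> (bv A) (bv B) m (zs ! 0) (zs ! 1) has_sum f zs) UNIV" if "iterate_region zs" for zs
      using iterate_group_iterate[OF linfun that f(2)[OF that]] state_Basis[OF \<open>\<forall>(s, b, j)\<in>set B. b \<in> Basis\<close>] by simp
    ultimately show ?thesis by (auto simp: iterate_limit_def)
  qed
  have "\<exists>f. iterate_limit \<phi> u (bv B) m f" if "\<forall>(s, b, j)\<in>set B. b \<in> Basis" for B
    by (rule vec_induct[of "\<lambda>u. \<exists>f. iterate_limit \<phi> u (bv B) m f"])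
      (use zero add1 smul1 word[OF that] in blast)+
  then show ?thesis using v
    by (intro vec_induct[of "\<lambda>v. \<exists>f. iterate_limit \<phi> u v m f" v])
      (use zero add2 smul2 in \<open>auto simp: basis_span_def, blast+\<close>)
qed

end

section \<open>The module \<open>V\<close> as a space of words\<close>

lemma ring_of_type_algebra_simps [simp]:
  "carrier ring_of_type_algebra = UNIV" "x \<otimes>\<^bsub>ring_of_type_algebra\<^esub> y = x * y"
  "x \<oplus>\<^bsub>ring_of_type_algebra\<^esub> y = x + y" "\<one>\<^bsub>ring_of_type_algebra\<^esub> = 1" "\<zero>\<^bsub>ring_of_type_algebra\<^esub> = 0"
  by (simp_all add: ring_of_type_algebra_def)

lemma ring_ring_of_type_algebra: "ring (ring_of_type_algebra :: 'a :: ring_1 ring)"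
proof -
  have "\<exists>y. x + y = 0" for x :: 'a using add.right_inverse by blast
  then show ?thesis
    unfolding ring_of_type_algebra_def using add.right_inverse
    by unfold_locales (auto simp: algebra_simps Units_def)
qed

text \<open>A surjective homomorphism from a type class ring onto a record ring. Both quotient rings
  are reached by such maps from the free algebra, so their identities reduce to computations in the
  type class.\<close>

definition onto_hom :: "('a :: ring_1 \<Rightarrow> 'b) \<Rightarrow> 'b ring \<Rightarrow> bool" where
  "onto_hom h S \<longleftrightarrow> ring S \<and> (\<forall>x y. h (x + y) = h x \<oplus>\<^bsub>S\<^esub> h y) \<and> (\<forall>x y. h (x * y) = h x \<otimes>\<^bsub>S\<^esub> h y) \<and>
     h 1 = \<one>\<^bsub>S\<^esub> \<and> range h = carrier S"

lemma onto_hom_id: "onto_hom (\<lambda>x. x) (ring_of_type_algebra :: 'a :: ring_1 ring)"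
  by (simp add: onto_hom_def ring_ring_of_type_algebra)

locale onto =
  fixes h :: "'a :: ring_1 \<Rightarrow> 'b" and S (structure)
  assumes onto: "onto_hom h S"
begin

sublocale S: ring S using onto by (simp add: onto_hom_def)

lemma hom_carrier [simp]: "h x \<in> carrier S"
  using onto by (auto simp: onto_hom_def)

lemma hom_surj: "y \<in> carrier S \<Longrightarrow> \<exists>x. y = h x"
  using onto by (auto simp: onto_hom_def image_iff)

lemma hom_add: "h (x + y) = h x \<oplus> h y" and hom_mult: "h (x * y) = h x \<otimes> h y" and hom_one: "h 1 = \<one>"
  using onto by (auto simp: onto_hom_def)

lemma hom_zero: "h 0 = \<zero>"
  using hom_add[of 0 0] S.add.l_cancel_one[of "h 0" "h 0"] by simp

lemma hom_uminus: "h (- x) = \<ominus> h x"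
  using hom_add[of "- x" x] hom_zero S.minus_equality[of "h (- x)" "h x"] by simp

lemma hom_diff: "h (x - y) = h x \<ominus> h y"
  using hom_add[of x "- y"] by (simp add: hom_uminus a_minus_def)

lemma subgroup_image:
  assumes "0 \<in> K" "\<And>x y. x \<in> K \<Longrightarrow> y \<in> K \<Longrightarrow> x + y \<in> K" "\<And>x. x \<in> K \<Longrightarrow> - x \<in> K"
  shows "subgroup (h ` K) (add_monoid S)"
proof (rule S.add.subgroupI)
  show "h ` K \<subseteq> carrier S" "h ` K \<noteq> {}" using assms(1) by auto
  show "\<ominus> a \<in> h ` K" if "a \<in> h ` K" for a
    using that assms(3) by (auto simp: hom_uminus[symmetric])
  show "a \<oplus> b \<in> h ` K" if "a \<in> h ` K" "b \<in> h ` K" for a b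
    using that assms(2) by (auto simp: hom_add[symmetric])
qed

lemma ideal_image:
  assumes "0 \<in> K" "\<And>x y. x \<in> K \<Longrightarrow> y \<in> K \<Longrightarrow> x + y \<in> K" "\<And>x. x \<in> K \<Longrightarrow> - x \<in> K"
    and "\<And>x y. x \<in> K \<Longrightarrow> y * x \<in> K" "\<And>x y. x \<in> K \<Longrightarrow> x * y \<in> K"
  shows "ideal (h ` K) S"
proof (rule idealI[OF S.ring_axioms subgroup_image[OF assms(1-3)]])
  fix a x assume "a \<in> h ` K" "x \<in> carrier S"
  moreover from this obtain y where "x = h y" using hom_surj by blast
  moreover obtain k where "a = h k" "k \<in> K" using calculation by blast
  ultimately show "x \<otimes> a \<in> h ` K" "a \<otimes> x \<in> h ` K" using assms(4,5) by (auto simp: hom_mult[symmetric])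
qed

lemma quotient_onto:
  assumes "ideal I S"
  shows "onto_hom (\<lambda>x. I +> h x) (S Quot I)" "I +> h x = I +> h y \<longleftrightarrow> h (x - y) \<in> I"
proof -
  interpret I: ideal I S by fact
  show "onto_hom (\<lambda>x. I +> h x) (S Quot I)"
    unfolding onto_hom_def
  proof (intro conjI allI)
    show "ring (S Quot I)" by (rule I.quotient_is_ring)
    show "I +> h (x + y) = (I +> h x) \<oplus>\<^bsub>S Quot I\<^esub> (I +> h y)" for x y
      by (simp add: hom_add FactRing_def I.a_rcos_sum)
    show "I +> h (x * y) = (I +> h x) \<otimes>\<^bsub>S Quot I\<^esub> (I +> h y)" for x y
      by (simp add: hom_mult FactRing_def I.rcoset_mult_add)
    show "I +> h 1 = \<one>\<^bsub>S Quot I\<^esub>" by (simp add: hom_one FactRing_def)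
    show "range (\<lambda>x. I +> h x) = carrier (S Quot I)"
      using hom_surj by (fastforce simp: FactRing_def A_RCOSETS_def' image_iff)
  qed
  show "I +> h x = I +> h y \<longleftrightarrow> h (x - y) \<in> I"
    using S.quotient_eq_iff_same_a_r_cos[OF assms, of "h x" "h y"] by (simp add: hom_diff)
qed

end

context bilinear_form_space
begin

abbreviation hs :: "complex \<Rightarrow> 'h hhat \<Rightarrow> 'h hhat" where
  "hs \<equiv> hhat_scale scale"

abbreviation FR :: "'h hhat free_algebra ring" where
  "FR \<equiv> ring_of_type_algebra"

text \<open>
  All elements of the iterated quotients are written as images of elements of the free algebra.
\<close>

definition to_T :: "'h hhat free_algebra \<Rightarrow> 'h hhat free_algebra set" where
  "to_T x = tensor_ideal hs +>\<^bsub>FR\<^esub> x"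

definition to_N :: "'h hhat free_algebra \<Rightarrow> 'h hhat free_algebra set set" where
  "to_N x = N_ideal +>\<^bsub>T\<^esub> to_T x"

definition to_V :: "'h hhat free_algebra \<Rightarrow> 'h hhat free_algebra set set set" where
  "to_V x = V_kernel +>\<^bsub>N\<^esub> to_N x"

definition free_mode :: "species \<Rightarrow> 'h \<Rightarrow> int \<Rightarrow> 'h hhat free_algebra" where
  "free_mode s a k = free_gen (Poly_Mapping.single (s, k) a, 0, 0)"

definition free_kB :: "'h hhat free_algebra" where
  "free_kB = free_gen (0, 1, 0)"

definition free_kF :: "'h hhat free_algebra" where
  "free_kF = free_gen (0, 0, 1)"

lemma mode_simps: "t_mode s a k = to_T (free_mode s a k)" "t_kB = to_T free_kB" "t_kF = to_T free_kF" "t_scalar c = to_T (free_scalar c)"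
  "n_mode s a k = to_N (free_mode s a k)" "n_kB = to_N free_kB" "n_kF = to_N free_kF" "n_scalar c = to_N (free_scalar c)"
  by (simp_all add: t_mode_def t_kB_def t_kF_def t_scalar_def n_mode_def n_kB_def n_kF_def n_scalar_def
    to_T_def to_N_def free_mode_def free_kB_def free_kF_def tensor_gen_def tensor_scalar_def)

definition tensor_gens :: "'h hhat free_algebra set" where
  "tensor_gens = {free_gen (x + y) - free_gen x - free_gen y | x y. True} \<union>
      {free_gen (hs c x) - free_scalar c * free_gen x | c x. True}"

lemma tensor_ideal_tensor_gens: "tensor_ideal hs = genideal FR tensor_gens"
  by (simp add: tensor_ideal_def tensor_gens_def)

lemma TI: "ideal (tensor_ideal hs) FR"
  unfolding tensor_ideal_tensor_gens by (rule ring.genideal_ideal[OF ring_ring_of_type_algebra]) simp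

lemma to_T_onto: "onto_hom to_T T"
  using onto.quotient_onto(1)[OF onto.intro[OF onto_hom_id] TI]
  by (simp add: T_def tensor_algebra_def to_T_def[abs_def])

interpretation to_T: onto to_T T
  by (rule onto.intro[OF to_T_onto])

lemma to_T_eq_iff: "to_T x = to_T y \<longleftrightarrow> x - y \<in> tensor_ideal hs"
  using onto.quotient_onto(2)[OF onto.intro[OF onto_hom_id] TI] by (simp add: to_T_def)

lemmas to_T_hom = to_T.hom_add[symmetric] to_T.hom_mult[symmetric] to_T.hom_diff[symmetric]

lemma N_relations_carrier: "N_relations \<subseteq> carrier T"
proof
  fix r assume "r \<in> N_relations"
  then show "r \<in> carrier T"
    by cases (simp_all add: gcomm_def mode_simps to_T_hom)
qed

lemma NI: "ideal N_ideal T"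
  unfolding N_ideal_def by (rule to_T.S.genideal_ideal[OF N_relations_carrier])

lemma to_N_onto: "onto_hom to_N N"
  using to_T.quotient_onto(1)[OF NI] by (simp add: N_def to_N_def[abs_def])

lemma to_N_eq_iff: "to_N x = to_N y \<longleftrightarrow> to_T (x - y) \<in> N_ideal"
  using to_T.quotient_onto(2)[OF NI] by (simp add: to_N_def)

interpretation to_N: onto to_N N
  by (rule onto.intro[OF to_N_onto])

lemmas to_N_hom = to_N.hom_add[symmetric] to_N.hom_mult[symmetric] to_N.hom_diff[symmetric]

lemma vac_action_to_N: "vac_action h c \<Longrightarrow> \<exists>x. h = to_N x"
  by (induct rule: vac_action.induct) (auto simp: mode_simps to_N_hom)

definition kernel_gens :: "'h hhat free_algebra set set set" where
  "kernel_gens = {y \<otimes>\<^bsub>N\<^esub> h \<ominus>\<^bsub>N\<^esub> y \<otimes>\<^bsub>N\<^esub> n_scalar c | y h c. y \<in> carrier N \<and> vac_action h c}"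

lemma kernel_gens_carrier: "kernel_gens \<subseteq> carrier N"
proof
  fix k assume "k \<in> kernel_gens"
  then obtain y h c where k: "k = y \<otimes>\<^bsub>N\<^esub> h \<ominus>\<^bsub>N\<^esub> y \<otimes>\<^bsub>N\<^esub> n_scalar c" "y \<in> carrier N" "vac_action h c"
    by (auto simp: kernel_gens_def)
  then obtain x where "h = to_N x" using vac_action_to_N by blast
  then show "k \<in> carrier N" using k by (simp add: mode_simps)
qed

lemma VK_subgroup: "abelian_subgroup V_kernel N"
  unfolding V_kernel_def kernel_gens_def[symmetric]
  by (intro abelian_subgroupI3 additive_subgroupI to_N.S.add.generate_is_subgroup kernel_gens_carrier to_N.S.abelian_group_axioms)

interpretation VK: abelian_subgroup V_kernel N
  by (rule VK_subgroup)

lemma to_V_eq_iff: "to_V x = to_V y \<longleftrightarrow> to_N (x - y) \<in> V_kernel"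
proof -
  have "to_V x = to_V y \<longleftrightarrow> to_N x \<in> V_kernel +>\<^bsub>N\<^esub> to_N y"
    unfolding to_V_def by (metis VK.a_rcos_self VK.a_repr_independence' to_N.hom_carrier)
  then show ?thesis
    using VK.a_rcos_module_minus[OF to_N.S.ring_axioms, of "to_N y" "to_N x"] by (simp add: to_N.hom_diff)
qed

lemma kernel_gens_mult:
  assumes k: "k \<in> kernel_gens"
  shows "to_N z \<otimes>\<^bsub>N\<^esub> k \<in> kernel_gens"
proof -
  obtain y h c where kd: "k = y \<otimes>\<^bsub>N\<^esub> h \<ominus>\<^bsub>N\<^esub> y \<otimes>\<^bsub>N\<^esub> n_scalar c" and y: "y \<in> carrier N" and h: "vac_action h c"
    using k by (auto simp: kernel_gens_def)
  obtain y' h' where "y = to_N y'" "h = to_N h'" using to_N.hom_surj[OF y] vac_action_to_N[OF h] by auto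
  then have "to_N z \<otimes>\<^bsub>N\<^esub> k = (to_N z \<otimes>\<^bsub>N\<^esub> y) \<otimes>\<^bsub>N\<^esub> h \<ominus>\<^bsub>N\<^esub> (to_N z \<otimes>\<^bsub>N\<^esub> y) \<otimes>\<^bsub>N\<^esub> n_scalar c"
    by (simp add: kd mode_simps to_N_hom algebra_simps)
  moreover have "to_N z \<otimes>\<^bsub>N\<^esub> y \<in> carrier N" using y by simp
  ultimately show ?thesis unfolding kernel_gens_def using h by blast
qed

text \<open>\<open>V_kernel\<close> is defined as an additive span. Left multiplication maps its
  generators to generators, so it is a left ideal, and this makes the action of N on cosets well
  defined.\<close>

lemma VK_mult: "k \<in> V_kernel \<Longrightarrow> to_N z \<otimes>\<^bsub>N\<^esub> k \<in> V_kernel"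
  unfolding V_kernel_def kernel_gens_def[symmetric]
proof (induct rule: generate.induct)
  case one
  show ?case using to_N.S.r_null[of "to_N z"] generate.one[of "add_monoid N" kernel_gens] by simp
  case (incl h)
  then show ?case by (intro generate.incl kernel_gens_mult)
next
  case (inv k)
  then have "k \<in> carrier N" using kernel_gens_carrier by blast
  then have "to_N z \<otimes>\<^bsub>N\<^esub> (inv\<^bsub>add_monoid N\<^esub> k) = inv\<^bsub>add_monoid N\<^esub> (to_N z \<otimes>\<^bsub>N\<^esub> k)"
    using to_N.S.r_minus[of "to_N z" k] by (simp add: a_inv_def)
  then show ?case using generate.inv[OF kernel_gens_mult[OF inv], of "add_monoid N" z] by (simp only:)
next
  case (eng k1 k2)
  have "k1 \<in> carrier N" "k2 \<in> carrier N"
    using eng to_N.S.add.generate_incl[OF kernel_gens_carrier] by auto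
  then have "to_N z \<otimes>\<^bsub>N\<^esub> (k1 \<otimes>\<^bsub>add_monoid N\<^esub> k2) = (to_N z \<otimes>\<^bsub>N\<^esub> k1) \<otimes>\<^bsub>add_monoid N\<^esub> (to_N z \<otimes>\<^bsub>N\<^esub> k2)"
    by (simp add: to_N.S.r_distr)
  then show ?case using generate.eng[OF eng(2,4)] by simp
qed

lemma carrier_V: "carrier V = range to_V"
  using to_N.hom_surj by (fastforce simp: V_def A_RCOSETS_def' to_V_def image_iff)

lemma V_add: "to_V x \<oplus>\<^bsub>V\<^esub> to_V y = to_V (x + y)"
  by (simp add: V_def to_V_def VK.a_rcos_sum to_N.hom_add)

lemma V_zero: "\<zero>\<^bsub>V\<^esub> = to_V 0"
  using VK.a_subgroup VK.a_rcos_const[of "to_N 0"] by (simp add: V_def to_V_def to_N.hom_zero VK.zero_closed)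

lemma to_V_mem: "v \<in> to_V x \<Longrightarrow> \<exists>y. v = to_N y \<and> to_V y = to_V x"
proof -
  assume v: "v \<in> to_V x"
  then have "v \<in> carrier N" unfolding to_V_def using VK.a_elemrcos_carrier to_N.hom_carrier by blast
  then obtain y where y: "v = to_N y" using to_N.hom_surj by blast
  have "to_V x = to_V y" using v unfolding to_V_def y by (intro VK.a_repr_independence') auto
  then show ?thesis using y by auto
qed

text \<open>The union in \<open>N_act\<close> runs over all representatives of a coset; by
  \<open>VK_mult\<close> they all give the same coset, so the union collapses.\<close>

lemma N_act_to_V: "N_act (to_N z) (to_V x) = to_V (z * x)"
proof -
  have "V_kernel +>\<^bsub>N\<^esub> (to_N z \<otimes>\<^bsub>N\<^esub> v) = to_V (z * x)" if v: "v \<in> to_V x" for v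
  proof -
    obtain y where y: "v = to_N y" "to_V y = to_V x" using to_V_mem[OF v] by auto
    then have "to_N (y - x) \<in> V_kernel" by (simp add: to_V_eq_iff)
    from VK_mult[OF this, of z] have "to_V (z * y) = to_V (z * x)"
      by (simp add: to_V_eq_iff to_N_hom right_diff_distrib)
    then show ?thesis by (simp add: y to_V_def to_N_hom)
  qed
  moreover have "to_N x \<in> to_V x" unfolding to_V_def by (rule VK.a_rcos_self) simp
  ultimately show ?thesis unfolding N_act_def by blast
qed

lemma smul_free_scalar: "smul c x = free_scalar c * x"
  by (simp add: smul_def free_scalar_def mult_map_scale_conv_mult)

lemma V_smult: "c \<odot>\<^bsub>V\<^esub> to_V x = to_V (smul c x)"
  by (simp add: V_def mode_simps N_act_to_V smul_free_scalar)

lemma vac_to_V: "vac = to_V 1"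
  by (simp add: vac_def to_V_def to_N.hom_one)

lemma mode_op_to_V: "mode_op (s, a, k) (to_V x) = to_V (free_mode s a k * x)"
  by (simp add: mode_simps N_act_to_V)

section \<open>The free algebra acting on words; the relations of N and the kernel of V under this
  action\<close>

definition gen_act :: "'h hhat \<Rightarrow> 'h fock \<Rightarrow> 'h fock" where
  "gen_act u m = (\<Sum>k\<in>Poly_Mapping.keys (fst u). fmode (fst k) (Poly_Mapping.lookup (fst u) k) (snd k) m) +
     smul (fst (snd u) * lB + snd (snd u) * lF) m"

definition frep :: "'h hhat free_algebra \<Rightarrow> 'h fock \<Rightarrow> 'h fock" where
  "frep x m = lin (\<lambda>w. foldr gen_act (letters w) m) x"

lemma linmap_gen_act [linmap_intros]: "linmap f \<Longrightarrow> linmap (\<lambda>m. gen_act u (f m))"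
  unfolding gen_act_def by (intro linmap_intros)

lemma linmap_foldr_gen_act: "linmap f \<Longrightarrow> linmap (\<lambda>m. foldr gen_act us (f m))"
  by (induct us) (auto intro: linmap_intros)

lemma linmap_frep_left: "linmap f \<Longrightarrow> linmap (\<lambda>x. frep (f x) m)"
  unfolding frep_def by (intro linmap_intros)

lemma linmap_frep_right: "linmap f \<Longrightarrow> linmap (\<lambda>m. frep x (f m))"
  unfolding frep_def lin_def by (intro linmap_intros linmap_foldr_gen_act)

lemmas linmap_frep_left' = linmap_frep_left[OF linmap_id] and linmap_frep_right' = linmap_frep_right[OF linmap_id]

lemma linmap_mult_right: "linmap f \<Longrightarrow> linmap (\<lambda>x. f x * (y :: 'h hhat free_algebra))"
  by (simp add: linmap_def distrib_right smul_free_scalar mult.assoc)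

lemma free_scalar_commute: "free_scalar c * x = x * (free_scalar c :: 'h hhat free_algebra)"
proof -
  have "x * free_scalar c = smul c x"
  proof (rule linmap_eqI[where m = x and f = "\<lambda>x :: 'h hhat free_algebra. x * free_scalar c" and g = "smul c"])
    show "linmap (\<lambda>x :: 'h hhat free_algebra. x * free_scalar c)" by (rule linmap_mult_right[OF linmap_id])
    show "linmap (smul c)" by (rule linmap_smulI[OF linmap_id])
  qed (simp add: free_scalar_def mult_single smul_single)
  then show ?thesis by (simp add: smul_free_scalar)
qed

lemma linmap_mult_left: "linmap f \<Longrightarrow> linmap (\<lambda>x. (y :: 'h hhat free_algebra) * f x)"
  by (simp add: linmap_def distrib_left smul_free_scalar free_scalar_commute mult.assoc[symmetric])
     (simp add: mult.assoc free_scalar_commute)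

lemma frep_mult: "frep (x * y) m = frep x (frep y m)"
proof (rule linmap_eqI[where m = x and f = "\<lambda>x. frep (x * y) m" and g = "\<lambda>x. frep x (frep y m)"])
  show "linmap (\<lambda>x. frep (x * y) m)" "linmap (\<lambda>x. frep x (frep y m))"
    by (intro linmap_frep_left linmap_mult_right linmap_id)+
  fix v :: "'h hhat word"
  show "frep (bv v * y) m = frep (bv v) (frep y m)"
  proof (rule linmap_eqI[where m = y and f = "\<lambda>y. frep (bv v * y) m" and g = "\<lambda>y. frep (bv v) (frep y m)"])
    show "linmap (\<lambda>y. frep (bv v * y) m)" "linmap (\<lambda>y. frep (bv v) (frep y m))"
      by (intro linmap_frep_left linmap_frep_right linmap_mult_left linmap_id)+
    show "frep (bv v * bv w) m = frep (bv v) (frep (bv w) m)" for w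
      by (simp add: frep_def mult_single plus_word_def)
  qed
qed

lemma frep_free_gen: "frep (free_gen u) m = gen_act u m"
  by (simp add: frep_def free_gen_def)

lemma frep_free_scalar: "frep (free_scalar c) m = smul c m"
proof -
  have "free_scalar c = smul c (bv (0 :: 'h hhat word))" unfolding free_scalar_def smul_single by simp
  moreover have "frep (bv 0) m = m" unfolding frep_def lin_bv zero_word_def by simp
  ultimately show ?thesis by (simp only: linmap_smul[OF linmap_frep_left'])
qed

lemma frep_one: "frep 1 m = m"
  using frep_free_scalar[of 1 m] by (simp add: free_scalar_def)

lemma gen_act_superset: "finite S \<Longrightarrow> Poly_Mapping.keys (fst u) \<subseteq> S \<Longrightarrow>
   gen_act u m = (\<Sum>k\<in>S. fmode (fst k) (Poly_Mapping.lookup (fst u) k) (snd k) m) + smul (fst (snd u) * lB + snd (snd u) * lF) m"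
  unfolding gen_act_def by (intro arg_cong2[of _ _ _ _ "(+)"] sum.mono_neutral_left) (auto simp: in_keys_iff fmode_zero)

lemma gen_act_add: "gen_act (u + v) m = gen_act u m + gen_act v m"
proof -
  let ?S = "Poly_Mapping.keys (fst u) \<union> Poly_Mapping.keys (fst v)"
  have "Poly_Mapping.keys (fst (u + v)) \<subseteq> ?S" using Poly_Mapping.keys_add[of "fst u" "fst v"] by simp
  then show ?thesis
    by (simp add: gen_act_superset[of ?S] lookup_add fmode_add sum.distrib algebra_simps)
qed

lemma lookup_map_scale: "Poly_Mapping.lookup (Poly_Mapping.map (scale c) f) k = scale c (Poly_Mapping.lookup f k)"
  by (simp add: Poly_Mapping.map.rep_eq when_def)

lemma gen_act_scale: "gen_act (hs c u) m = smul c (gen_act u m)"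
proof -
  have "Poly_Mapping.keys (fst (hs c u)) \<subseteq> Poly_Mapping.keys (fst u)"
    by (auto simp: hhat_scale_def case_prod_beta' in_keys_iff lookup_map_scale)
  then show ?thesis
    by (subst gen_act_superset[OF finite_keys]) (auto simp: gen_act_def hhat_scale_def case_prod_beta' lookup_map_scale fmode_scale
      smul.scale_right_distrib smul.scale_sum_right algebra_simps)
qed

lemma frep_gens: "frep (free_mode s a k) m = fmode s a k m" "frep free_kB m = smul lB m" "frep free_kF m = smul lF m"
  by (auto simp: free_mode_def free_kB_def free_kF_def frep_free_gen gen_act_def fmode_zero)

lemmas frep_simps = linmap_add[OF linmap_frep_left'] linmap_diff[OF linmap_frep_left'] frep_mult frep_gens frep_free_scalar

definition frep_kernel :: "'h hhat free_algebra set" where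
  "frep_kernel = {x. \<forall>m. frep x m = 0}"

lemma frep_kernel_closed: "0 \<in> frep_kernel" "x \<in> frep_kernel \<Longrightarrow> y \<in> frep_kernel \<Longrightarrow> x + y \<in> frep_kernel" "x \<in> frep_kernel \<Longrightarrow> - x \<in> frep_kernel"
  "x \<in> frep_kernel \<Longrightarrow> z * x \<in> frep_kernel" "x \<in> frep_kernel \<Longrightarrow> x * z \<in> frep_kernel"
  by (auto simp: frep_kernel_def frep_simps linmap_zero[OF linmap_frep_left'] linmap_minus[OF linmap_frep_left'] linmap_zero[OF linmap_frep_right'])

lemma TI_frep_kernel: "tensor_ideal hs \<subseteq> frep_kernel"
  unfolding tensor_ideal_tensor_gens
proof (rule ring.genideal_minimal[OF ring_ring_of_type_algebra])
  show "ideal frep_kernel FR" using onto.ideal_image[OF onto.intro[OF onto_hom_id], of frep_kernel] frep_kernel_closed by auto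
  have "free_gen (x + y) - free_gen x - free_gen y \<in> frep_kernel" for x y
    unfolding frep_kernel_def by (simp only: mem_Collect_eq frep_simps frep_free_gen gen_act_add) simp
  moreover have "free_gen (hs c x) - free_scalar c * free_gen x \<in> frep_kernel" for c x
    unfolding frep_kernel_def by (simp only: mem_Collect_eq frep_simps frep_free_gen gen_act_scale) simp
  ultimately show "tensor_gens \<subseteq> frep_kernel" unfolding tensor_gens_def by blast
qed

text \<open>Bosonic zero modes act by 0 and central elements by scalars; the relations between a
  nonnegative and a negative mode are instances of \<open>annih_create\<close>.\<close>

lemma N_relations_frep_kernel: "N_relations \<subseteq> to_T ` frep_kernel"
proof
  fix r assume "r \<in> N_relations"
  then show "r \<in> to_T ` frep_kernel"
  proof cases
    case (B_zero k a b)
    have "free_mode Bos a k * free_mode Bos b 0 - free_mode Bos b 0 * free_mode Bos a k \<in> frep_kernel"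
      by (simp add: frep_kernel_def frep_simps fmode_def linmap_zero[OF linmap_create'] linmap_zero[OF linmap_annih'])
    then show ?thesis by (simp add: B_zero gcomm_def mode_simps to_T_hom)
  next
    case (F_zero a k b)
    have "free_mode Fer a k * free_mode Bos b 0 - free_mode Bos b 0 * free_mode Fer a k \<in> frep_kernel"
      by (simp add: frep_kernel_def frep_simps fmode_def linmap_zero[OF linmap_create'] linmap_zero[OF linmap_annih'])
    then show ?thesis by (simp add: F_zero gcomm_def mode_simps to_T_hom)
  next
    case (B_B m n a b)
    have "pairing Bos a (nat m) Bos b (nat (- n - 1)) = of_int m * form a b * (if m + n = 0 then 1 else 0) * lB"
      using B_B by (auto simp: pairing_def nat_eq_iff)
    then have "free_mode Bos a m * free_mode Bos b n - free_mode Bos b n * free_mode Bos a m - free_scalar (of_int m * form a b * (if m + n = 0 then 1 else 0)) * free_kB \<in> frep_kernel"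
      using B_B by (simp add: frep_kernel_def frep_simps fmode_def annih_create ksign_def)
    then show ?thesis by (simp add: B_B gcomm_def mode_simps to_T_hom)
  next
    case (F_F m n a b)
    have "pairing Fer a (nat m) Fer b (nat (- n - 1)) = form a b * (if m + n + 1 = 0 then 1 else 0) * lF"
      using F_F by (auto simp: pairing_def nat_eq_iff)
    then have "free_mode Fer a m * free_mode Fer b n + free_mode Fer b n * free_mode Fer a m - free_scalar (form a b * (if m + n + 1 = 0 then 1 else 0)) * free_kF \<in> frep_kernel"
      using F_F by (simp add: frep_kernel_def frep_simps fmode_def annih_create ksign_def)
    then show ?thesis by (simp add: F_F gcomm_def mode_simps to_T_hom)
  next
    case (B_F m n a b)
    have "free_mode Bos a m * free_mode Fer b n - free_mode Fer b n * free_mode Bos a m \<in> frep_kernel"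
      using B_F(2) by (auto simp: frep_kernel_def frep_simps fmode_def annih_create ksign_def pairing_def)
    then show ?thesis by (simp add: B_F gcomm_def mode_simps to_T_hom)
  qed (auto simp: gcomm_def mode_simps to_T_hom frep_kernel_def frep_simps linmap_smul[OF linmap_fmode'] mult.commute intro!: imageI)
qed

lemma NI_frep_kernel: "to_T x \<in> N_ideal \<Longrightarrow> x \<in> frep_kernel"
proof -
  have "N_ideal \<subseteq> to_T ` frep_kernel" unfolding N_ideal_def
    by (rule to_T.S.genideal_minimal[OF to_T.ideal_image[OF frep_kernel_closed] N_relations_frep_kernel])
  moreover assume "to_T x \<in> N_ideal"
  ultimately obtain z where z: "to_T x = to_T z" "z \<in> frep_kernel" by auto
  then have xz: "x - z \<in> frep_kernel" using TI_frep_kernel to_T_eq_iff by auto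
  show ?thesis using frep_kernel_closed(2)[OF xz z(2)] by simp
qed

text \<open>A left ideal, whereas \<open>frep_kernel\<close> is two-sided: it belongs to the left
  module V, the other to the algebra N.\<close>

definition vac_kernel :: "'h hhat free_algebra set" where
  "vac_kernel = {x. frep x (bv []) = 0}"

lemma vac_kernel_closed: "0 \<in> vac_kernel" "x \<in> vac_kernel \<Longrightarrow> y \<in> vac_kernel \<Longrightarrow> x + y \<in> vac_kernel" "x \<in> vac_kernel \<Longrightarrow> - x \<in> vac_kernel" "x \<in> vac_kernel \<Longrightarrow> z * x \<in> vac_kernel"
  by (auto simp: vac_kernel_def frep_simps linmap_zero[OF linmap_frep_left'] linmap_minus[OF linmap_frep_left'] linmap_zero[OF linmap_frep_right'])

lemma vac_action_frep: "vac_action h c \<Longrightarrow> \<exists>x. h = to_N x \<and> frep x (bv []) = smul c (bv [])"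
proof (induct rule: vac_action.induct)
  case (mode n s a)
  then show ?case by (intro exI[of _ "free_mode s a n"]) (simp add: mode_simps frep_simps fmode_def)
next
  case (add g c h d)
  then obtain x y where "g = to_N x" "h = to_N y" "frep x (bv []) = smul c (bv [])" "frep y (bv []) = smul d (bv [])" by blast
  then show ?case by (intro exI[of _ "x + y"]) (simp add: to_N.hom_add frep_simps smul.scale_left_distrib)
next
  case (mult g c h d)
  then obtain x y where "g = to_N x" "h = to_N y" "frep x (bv []) = smul c (bv [])" "frep y (bv []) = smul d (bv [])" by blast
  then show ?case by (intro exI[of _ "x * y"]) (simp add: to_N.hom_mult frep_simps linmap_smul[OF linmap_frep_right'] mult.commute)
qed (use mode_simps frep_simps in \<open>metis+\<close>)

text \<open>A generator \<open>y h - y c\<close> kills the empty word because \<open>h\<close> acts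
  on it by \<open>c\<close>. Two representatives of the same element of N differ by something that
  acts as 0.\<close>

lemma VK_vac_kernel: "to_N x \<in> V_kernel \<Longrightarrow> x \<in> vac_kernel"
proof -
  have sub: "subgroup (to_N ` vac_kernel) (add_monoid N)" by (rule to_N.subgroup_image[OF vac_kernel_closed(1-3)])
  have "kernel_gens \<subseteq> to_N ` vac_kernel"
  proof
    fix k assume "k \<in> kernel_gens"
    then obtain y h c where kd: "k = y \<otimes>\<^bsub>N\<^esub> h \<ominus>\<^bsub>N\<^esub> y \<otimes>\<^bsub>N\<^esub> n_scalar c" and y: "y \<in> carrier N" and h: "vac_action h c"
      by (auto simp: kernel_gens_def)
    obtain y' where y': "y = to_N y'" using to_N.hom_surj[OF y] by auto
    obtain x where x: "h = to_N x" "frep x (bv []) = smul c (bv [])" using vac_action_frep[OF h] by auto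
    have "y' * x - y' * free_scalar c \<in> vac_kernel" using x by (simp add: vac_kernel_def frep_simps)
    then show "k \<in> to_N ` vac_kernel" by (simp add: kd y' x mode_simps to_N_hom)
  qed
  then have "V_kernel \<subseteq> to_N ` vac_kernel"
    unfolding V_kernel_def kernel_gens_def[symmetric] by (rule to_N.S.add.generate_subgroup_incl[OF _ sub])
  moreover assume "to_N x \<in> V_kernel"
  ultimately obtain z where z: "to_N x = to_N z" "z \<in> vac_kernel" by auto
  then have "x - z \<in> frep_kernel" using NI_frep_kernel to_N_eq_iff by auto
  then have xz: "x - z \<in> vac_kernel" by (simp add: frep_kernel_def vac_kernel_def)
  show ?thesis using vac_kernel_closed(2)[OF xz z(2)] by simp
qed

text \<open>
  The free algebra modulo \<open>L\<close> is \<open>V\<close>.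
\<close>

definition L :: "'h hhat free_algebra set" where
  "L = {x. to_N x \<in> V_kernel}"

lemma to_V_eq_L: "to_V x = to_V y \<longleftrightarrow> x - y \<in> L"
  by (simp add: to_V_eq_iff L_def)

lemma NI_L: "to_T x \<in> N_ideal \<Longrightarrow> x * y \<in> L"
proof -
  interpret NI: ideal N_ideal T by (rule NI)
  assume "to_T x \<in> N_ideal"
  then have "to_T (x * y) \<in> N_ideal" by (simp add: to_T.hom_mult NI.I_r_closed)
  then have "to_N (x * y) = to_N 0" by (simp add: to_N_eq_iff)
  then show ?thesis by (simp add: L_def to_N.hom_zero)
qed

lemma TI_L: "x \<in> tensor_ideal hs \<Longrightarrow> x * y \<in> L"
proof -
  interpret NI: ideal N_ideal T by (rule NI)
  assume "x \<in> tensor_ideal hs"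
  then have "to_T x = \<zero>\<^bsub>T\<^esub>" using to_T_eq_iff[of x 0] by (simp add: to_T.hom_zero)
  then show ?thesis by (intro NI_L) simp
qed

lemma relation_L: "to_T x \<in> N_relations \<Longrightarrow> x * y \<in> L"
  using NI_L to_T.S.genideal_self[OF N_relations_carrier] by (auto simp: N_ideal_def)

lemma vac_L: "vac_action (to_N x) c \<Longrightarrow> x - free_scalar c \<in> L"
proof -
  assume "vac_action (to_N x) c"
  then have "to_N 1 \<otimes>\<^bsub>N\<^esub> to_N x \<ominus>\<^bsub>N\<^esub> to_N 1 \<otimes>\<^bsub>N\<^esub> n_scalar c \<in> kernel_gens"
    unfolding kernel_gens_def using to_N.hom_carrier[of 1] by blast
  then have "to_N (x - free_scalar c) \<in> kernel_gens" by (simp add: mode_simps to_N_hom)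
  then show ?thesis unfolding L_def V_kernel_def kernel_gens_def[symmetric] by (simp add: generate.incl)
qed

end

section \<open>Reduction of the vectors of V to lifted words\<close>

context bilinear_form_space
begin

lemma to_V_add_cong: "to_V x = to_V x' \<Longrightarrow> to_V y = to_V y' \<Longrightarrow> to_V (x + y) = to_V (x' + y')"
  by (metis V_add)

lemma to_V_smul_cong: "to_V x = to_V x' \<Longrightarrow> to_V (smul c x) = to_V (smul c x')"
  by (metis V_smult)

lemma to_V_mult_cong: "to_V x = to_V x' \<Longrightarrow> to_V (z * x) = to_V (z * x')"
  by (metis N_act_to_V)

definition fock_lift_word :: "'h letter list \<Rightarrow> 'h hhat free_algebra" where
  "fock_lift_word w = foldr (\<lambda>(s, a, j) x. free_mode s a (- int j - 1) * x) w 1"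

definition fock_lift :: "'h fock \<Rightarrow> 'h hhat free_algebra" where
  "fock_lift = lin fock_lift_word"

lemma linmap_fock_lift: "linmap f \<Longrightarrow> linmap (\<lambda>m. fock_lift (f m))"
  unfolding fock_lift_def by (intro linmap_intros)

lemmas linmap_fock_lift' = linmap_fock_lift[OF linmap_id]

lemma fock_lift_Nil: "fock_lift (bv []) = 1"
  by (simp add: fock_lift_def fock_lift_word_def)

lemma fock_lift_prepend: "fock_lift (prepend (s, b, j) m) = free_mode s b (- int j - 1) * fock_lift m"
proof (rule linmap_eqI[where m = m and f = "\<lambda>m. fock_lift (prepend (s, b, j) m)" and g = "\<lambda>m. free_mode s b (- int j - 1) * fock_lift m"])
  show "linmap (\<lambda>m. free_mode s b (- int j - 1) * fock_lift m)" using linmap_comp[OF linmap_mult_left[OF linmap_id] linmap_fock_lift'] by simp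
  show "linmap (\<lambda>m. fock_lift (prepend (s, b, j) m))" by (intro linmap_fock_lift linmap_prepend linmap_id)
qed (simp add: fock_lift_def fock_lift_word_def)

lemma to_V_lin:
  assumes "linmap f" "\<And>w. to_V (x * fock_lift (bv w)) = to_V (fock_lift (f (bv w)))"
  shows "to_V (x * fock_lift m) = to_V (fock_lift (f m))"
proof (rule vec_induct[of "\<lambda>m. to_V (x * fock_lift m) = to_V (fock_lift (f m))"])
  show "to_V (x * fock_lift 0) = to_V (fock_lift (f 0))" by (simp add: linmap_zero[OF linmap_fock_lift'] linmap_zero[OF assms(1)])
  show "to_V (x * fock_lift (m + m')) = to_V (fock_lift (f (m + m')))"
    if "to_V (x * fock_lift m) = to_V (fock_lift (f m))" "to_V (x * fock_lift m') = to_V (fock_lift (f m'))" for m m'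
    using to_V_add_cong[OF that] by (simp add: linmap_add[OF linmap_fock_lift'] linmap_add[OF assms(1)] distrib_left)
  show "to_V (x * fock_lift (smul c m)) = to_V (fock_lift (f (smul c m)))" if "to_V (x * fock_lift m) = to_V (fock_lift (f m))" for c m
    using to_V_smul_cong[OF that] by (simp add: linmap_smul[OF linmap_fock_lift'] linmap_smul[OF assms(1)] linmap_smul[OF linmap_mult_left[OF linmap_id]])
qed (rule assms(2))

lemma relation_comm: "to_T (x - y) \<in> N_relations \<Longrightarrow> to_V (x * z) = to_V (y * z)"
  using relation_L[of "x - y" z] by (simp add: to_V_eq_L left_diff_distrib)

text \<open>Central elements are carried through the negative modes to the vacuum, where
  \<open>vac_action\<close> turns them into scalars.\<close>

lemma central_to_V:
  "to_V (free_kB * fock_lift m) = to_V (fock_lift (smul lB m))" "to_V (free_kF * fock_lift m) = to_V (fock_lift (smul lF m))"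
proof -
  have *: "to_V (g * fock_lift m) = to_V (fock_lift (smul c m))"
    if comm: "\<And>s a k. to_T (free_mode s a k * g - g * free_mode s a k) \<in> N_relations" and vac: "vac_action (to_N g) c" for g c
  proof (rule to_V_lin)
    fix w
    show "to_V (g * fock_lift (bv w)) = to_V (fock_lift (smul c (bv w)))"
    proof (induct w)
      case Nil
      then show ?case using vac_L[OF vac] by (simp add: fock_lift_Nil linmap_smul[OF linmap_fock_lift'] to_V_eq_L smul_free_scalar)
    next
      case (Cons l w)
      obtain s a j where l: "l = (s, a, j)" by (cases l)
      let ?g = "free_mode s a (- int j - 1)"
      have "to_V (g * fock_lift (prepend l (bv w))) = to_V (g * ?g * fock_lift (bv w))" by (simp add: l fock_lift_prepend mult.assoc del: prepend_bv)
      also have "\<dots> = to_V (?g * (g * fock_lift (bv w)))"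
        using relation_comm[OF comm, of s a "- int j - 1" "fock_lift (bv w)"] by (simp add: mult.assoc)
      also have "\<dots> = to_V (?g * fock_lift (smul c (bv w)))" by (rule to_V_mult_cong[OF Cons])
      also have "\<dots> = to_V (fock_lift (smul c (prepend l (bv w))))"
        by (simp add: l fock_lift_prepend linmap_smul[OF linmap_fock_lift'] linmap_smul[OF linmap_mult_left[OF linmap_id]] del: prepend_bv)
      finally show ?case by simp
    qed
  qed (rule linmap_smulI[OF linmap_id])
  show "to_V (free_kB * fock_lift m) = to_V (fock_lift (smul lB m))"
    using N_relations.mode_kB vac_action.kB by (intro *) (auto simp: gcomm_def mode_simps to_T_hom)
  show "to_V (free_kF * fock_lift m) = to_V (fock_lift (smul lF m))"
    using N_relations.mode_kF vac_action.kF by (intro *) (auto simp: gcomm_def mode_simps to_T_hom)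
qed

lemma comm_to_V: "to_V (free_mode s a (int n) * (free_mode t b (- int j - 1) * fock_lift m)) =
    to_V (smul (pairing s a n t b j) (fock_lift m) + smul (ksign s t) (free_mode t b (- int j - 1) * (free_mode s a (int n) * fock_lift m)))"
proof -
  let ?k = "- int j - 1"
  have k: "?k < 0" "?k \<noteq> 0" by auto
  \<comment> \<open>The relation may be listed with the two modes in either order; bosonic zero
    modes, for instance, stand on the right in the relations of N.\<close>
  have plain: "to_V (free_mode s a (int n) * free_mode t b ?k * fock_lift m) = to_V (free_mode t b ?k * free_mode s a (int n) * fock_lift m)"
    if "to_T (free_mode s a (int n) * free_mode t b ?k - free_mode t b ?k * free_mode s a (int n)) \<in> N_relations \<or>
      to_T (free_mode t b ?k * free_mode s a (int n) - free_mode s a (int n) * free_mode t b ?k) \<in> N_relations"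
    using that relation_comm by metis
  show ?thesis
  proof (cases s)
    case Bos
    show ?thesis
    proof (cases t)
      case t: Bos
      show ?thesis
      proof (cases "n = 0")
        case True
        then show ?thesis using plain N_relations.B_zero[OF k(2), of b a] Bos t
          by (simp add: gcomm_def mode_simps to_T_hom pairing_def ksign_def mult.assoc)
      next
        case False
        let ?c = "of_int (int n) * form a b * (if int n + ?k = 0 then 1 else 0)"
        have "gcomm False False (t_mode Bos a (int n)) (t_mode Bos b ?k) \<ominus>\<^bsub>T\<^esub> t_scalar ?c \<otimes>\<^bsub>T\<^esub> t_kB \<in> N_relations"
          using False by (intro N_relations.B_B) auto
        then have "to_T (free_mode Bos a (int n) * free_mode Bos b ?k - (free_mode Bos b ?k * free_mode Bos a (int n) + free_scalar ?c * free_kB)) \<in> N_relations"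
          by (simp add: gcomm_def mode_simps to_T_hom diff_diff_eq)
        from relation_comm[OF this, of "fock_lift m"]
        have "to_V (free_mode Bos a (int n) * free_mode Bos b ?k * fock_lift m) = to_V (free_mode Bos b ?k * free_mode Bos a (int n) * fock_lift m + smul ?c (free_kB * fock_lift m))"
          by (simp add: distrib_right smul_free_scalar mult.assoc)
        also have "\<dots> = to_V (free_mode Bos b ?k * free_mode Bos a (int n) * fock_lift m + smul ?c (fock_lift (smul lB m)))"
          by (intro to_V_add_cong to_V_smul_cong central_to_V refl)
        also have "smul ?c (fock_lift (smul lB m)) = smul (pairing Bos a n Bos b j) (fock_lift m)"
          using False by (auto simp: linmap_smul[OF linmap_fock_lift'] pairing_def)
        finally show ?thesis using Bos t by (simp add: ksign_def mult.assoc add.commute)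
      qed
    next
      case t: Fer
      show ?thesis
      proof (cases "n = 0")
        case True
        then show ?thesis using plain N_relations.F_zero[of b "?k" a] Bos t
          by (simp add: gcomm_def mode_simps to_T_hom pairing_def ksign_def mult.assoc)
      next
        case False
        then show ?thesis using plain N_relations.B_F[of "int n" ?k a b] Bos t
          by (simp add: gcomm_def mode_simps to_T_hom pairing_def ksign_def mult.assoc)
      qed
    qed
  next
    case Fer
    show ?thesis
    proof (cases t)
      case t: Bos
      then show ?thesis using plain N_relations.B_F[of ?k "int n" b a] Fer
        by (simp add: gcomm_def mode_simps to_T_hom pairing_def ksign_def mult.assoc)
    next
      case t: Fer
      let ?c = "form a b * (if int n + ?k + 1 = 0 then 1 else 0)"
      have "gcomm True True (t_mode Fer a (int n)) (t_mode Fer b ?k) \<ominus>\<^bsub>T\<^esub> t_scalar ?c \<otimes>\<^bsub>T\<^esub> t_kF \<in> N_relations"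
        by (intro N_relations.F_F) auto
      then have "to_T (free_mode Fer a (int n) * free_mode Fer b ?k - (- (free_mode Fer b ?k * free_mode Fer a (int n)) + free_scalar ?c * free_kF)) \<in> N_relations"
        by (simp add: gcomm_def mode_simps to_T_hom algebra_simps)
      from relation_comm[OF this, of "fock_lift m"]
      have "to_V (free_mode Fer a (int n) * free_mode Fer b ?k * fock_lift m) = to_V (- (free_mode Fer b ?k * free_mode Fer a (int n) * fock_lift m) + smul ?c (free_kF * fock_lift m))"
        by (simp add: distrib_right smul_free_scalar mult.assoc left_diff_distrib)
      also have "\<dots> = to_V (- (free_mode Fer b ?k * free_mode Fer a (int n) * fock_lift m) + smul ?c (fock_lift (smul lF m)))"
        by (intro to_V_add_cong to_V_smul_cong central_to_V refl)
      also have "smul ?c (fock_lift (smul lF m)) = smul (pairing Fer a n Fer b j) (fock_lift m)"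
        by (auto simp: linmap_smul[OF linmap_fock_lift'] pairing_def)
      finally show ?thesis using Fer t by (simp add: ksign_def mult.assoc add.commute)
    qed
  qed
qed

lemma annih_to_V: "to_V (free_mode s a (int n) * fock_lift m) = to_V (fock_lift (annih s a n m))"
proof (rule to_V_lin[OF linmap_annih'])
  fix w
  show "to_V (free_mode s a (int n) * fock_lift (bv w)) = to_V (fock_lift (annih s a n (bv w)))"
  proof (induct w)
    case Nil
    have "vac_action (to_N (free_mode s a (int n))) 0" using vac_action.mode[of "int n" s a] by (simp add: mode_simps)
    from vac_L[OF this] show ?case by (simp add: fock_lift_Nil linmap_zero[OF linmap_fock_lift'] to_V_eq_L free_scalar_def)
  next
    case (Cons l w)
    obtain t b j where l: "l = (t, b, j)" by (cases l)
    have "to_V (free_mode s a (int n) * fock_lift (prepend l (bv w))) =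
      to_V (smul (pairing s a n t b j) (fock_lift (bv w)) + smul (ksign s t) (free_mode t b (- int j - 1) * (free_mode s a (int n) * fock_lift (bv w))))"
      using comm_to_V[of s a n t b j "bv w"] by (simp add: l fock_lift_prepend del: prepend_bv)
    also have "\<dots> = to_V (smul (pairing s a n t b j) (fock_lift (bv w)) + smul (ksign s t) (free_mode t b (- int j - 1) * fock_lift (annih s a n (bv w))))"
      by (intro to_V_add_cong to_V_smul_cong to_V_mult_cong Cons refl)
    also have "\<dots> = to_V (fock_lift (annih s a n (prepend l (bv w))))"
      by (simp add: l annih_prepend linmap_add[OF linmap_fock_lift'] linmap_smul[OF linmap_fock_lift'] fock_lift_prepend del: prepend_bv)
    finally show ?case by simp
  qed
qed

lemma free_gen_add: "to_V (free_gen (u + v) * y) = to_V (free_gen u * y + free_gen v * y)"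
proof -
  have "free_gen (u + v) - free_gen u - free_gen v \<in> tensor_ideal hs"
    unfolding tensor_ideal_tensor_gens
    by (rule subsetD[OF ring.genideal_self[OF ring_ring_of_type_algebra]], simp, unfold tensor_gens_def, blast)
  from TI_L[OF this, of y] show ?thesis by (simp add: to_V_eq_L algebra_simps)
qed

lemma free_gen_scale: "to_V (free_gen (hs c u) * y) = to_V (smul c (free_gen u * y))"
proof -
  have "free_gen (hs c u) - free_scalar c * free_gen u \<in> tensor_ideal hs"
    unfolding tensor_ideal_tensor_gens
    by (rule subsetD[OF ring.genideal_self[OF ring_ring_of_type_algebra]], simp, unfold tensor_gens_def, blast)
  from TI_L[OF this, of y] show ?thesis by (simp add: to_V_eq_L left_diff_distrib smul_free_scalar mult.assoc)
qed

lemma map_scale_zero [simp]: "Poly_Mapping.map (scale c) 0 = 0"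
  by (rule poly_mapping_eqI) (simp add: lookup_map_scale)

lemma free_mode_add: "to_V (free_mode s (a + b) k * y) = to_V (free_mode s a k * y + free_mode s b k * y)"
  using free_gen_add[of "(Poly_Mapping.single (s, k) a, 0, 0)" "(Poly_Mapping.single (s, k) b, 0, 0)" y]
  by (simp add: free_mode_def single_add)

lemma free_mode_scale: "to_V (free_mode s (scale c a) k * y) = to_V (smul c (free_mode s a k * y))"
  using free_gen_scale[of c "(Poly_Mapping.single (s, k) a, 0, 0)" y]
  by (simp add: free_mode_def hhat_scale_def)

lemma free_mode_sum: "to_V (free_mode s (\<Sum>b\<in>S. scale (r b) b) k * y) = to_V (\<Sum>b\<in>S. smul (r b) (free_mode s b k * y))"
proof (induct S rule: infinite_finite_induct)
  case (insert b S)
  then show ?case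
    using free_mode_add[of s "scale (r b) b" "\<Sum>b\<in>S. scale (r b) b" k y]
      to_V_add_cong[OF free_mode_scale[of s "r b" b k y] insert(3)] by simp
qed (use free_mode_scale[of s 0 0 k y] in simp_all)

text \<open>\<open>fock_lift_prepend\<close> treats raw letters; the linearity relations, valid in
  V, replace \<open>a\<close> by its basis expansion as in \<open>create\<close>.\<close>

lemma create_to_V: "to_V (free_mode s a (- int j - 1) * fock_lift m) = to_V (fock_lift (create s a j m))"
proof -
  have "to_V (free_mode s a (- int j - 1) * fock_lift m) = to_V (\<Sum>b\<in>Basis. smul (representation Basis a b) (free_mode s b (- int j - 1) * fock_lift m))"
    using free_mode_sum[of s "representation Basis a" Basis] by (simp add: rep_sum)
  also have "\<dots> = to_V (fock_lift (create s a j m))"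
    by (simp add: create_def linmap_sum[OF linmap_fock_lift'] linmap_smul[OF linmap_fock_lift'] fock_lift_prepend)
  finally show ?thesis .
qed

lemma fmode_to_V: "to_V (free_mode s a k * fock_lift m) = to_V (fock_lift (fmode s a k m))"
proof (cases "k < 0")
  case True
  then have "- int (nat (- k - 1)) - 1 = k" by simp
  then show ?thesis using create_to_V[of s a "nat (- k - 1)" m] True by (simp only: fmode_def if_True)
next
  case False
  then have "int (nat k) = k" by simp
  then show ?thesis using annih_to_V[of s a "nat k" m] False by (simp only: fmode_def if_False)
qed

text \<open>The claim is additive and homogeneous in \<open>u\<close>, so single modes and the two
  central elements suffice; \<open>Q\<close> packages it for the induction over the finitely
  supported component.\<close>

lemma gen_act_to_V: "to_V (free_gen u * fock_lift m) = to_V (fock_lift (gen_act u m))"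
proof -
  define Q where "Q u \<longleftrightarrow> (\<forall>m. to_V (free_gen u * fock_lift m) = to_V (fock_lift (gen_act u m)))" for u
  have Qadd: "Q (u + v)" if "Q u" "Q v" for u v
    unfolding Q_def
  proof
    fix m
    have "to_V (free_gen (u + v) * fock_lift m) = to_V (free_gen u * fock_lift m + free_gen v * fock_lift m)" by (rule free_gen_add)
    also have "\<dots> = to_V (fock_lift (gen_act u m) + fock_lift (gen_act v m))" using that by (intro to_V_add_cong) (simp_all only: Q_def)
    finally show "to_V (free_gen (u + v) * fock_lift m) = to_V (fock_lift (gen_act (u + v) m))" by (simp only: gen_act_add linmap_add[OF linmap_fock_lift'])
  qed
  have Qscale: "Q (hs c u)" if "Q u" for c u
    unfolding Q_def
  proof
    fix m
    have "to_V (free_gen (hs c u) * fock_lift m) = to_V (smul c (free_gen u * fock_lift m))" by (rule free_gen_scale)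
    also have "\<dots> = to_V (smul c (fock_lift (gen_act u m)))" using that by (intro to_V_smul_cong) (simp_all only: Q_def)
    finally show "to_V (free_gen (hs c u) * fock_lift m) = to_V (fock_lift (gen_act (hs c u) m))" by (simp only: gen_act_scale linmap_smul[OF linmap_fock_lift'])
  qed
  have Qs: "Q (Poly_Mapping.single (s, k) a, 0, 0)" for s k a
    unfolding Q_def using fmode_to_V[of s a k] frep_gens(1)[of s a k] by (simp add: frep_free_gen free_mode_def)
  have Qc: "Q (0, 1, 0)" "Q (0, 0, 1)"
    unfolding Q_def using central_to_V frep_gens(2,3) by (simp_all add: frep_free_gen free_kB_def free_kF_def)
  have Qf: "Q (f, 0, 0)" for f :: "species \<times> int \<Rightarrow>\<^sub>0 'h"
  proof (induct f rule: Poly_Mapping.update_induct)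
    case const
    have "Q (hs 0 (0, 1, 0))" by (rule Qscale[OF Qc(1)])
    then show ?case by (simp add: hhat_scale_def)
  next
    case (update f k a)
    have "Poly_Mapping.update k a f = f + Poly_Mapping.single k a"
      using update by (intro poly_mapping_eqI) (auto simp: lookup_update lookup_add lookup_single in_keys_iff when_def)
    then show ?case using Qadd[OF update(3) Qs[of "fst k" "snd k" a]] by simp
  qed
  have "Q ((fst u, 0, 0) + hs (fst (snd u)) (0, 1, 0) + hs (snd (snd u)) (0, 0, 1))"
    by (intro Qadd Qscale Qf Qc)
  then show ?thesis by (cases u) (simp add: Q_def hhat_scale_def)
qed

lemma frep_to_V: "to_V (x * fock_lift m) = to_V (fock_lift (frep x m))"
proof (rule vec_induct[of "\<lambda>x. to_V (x * fock_lift m) = to_V (fock_lift (frep x m))"])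
  show "to_V (0 * fock_lift m) = to_V (fock_lift (frep 0 m))" by (simp add: linmap_zero[OF linmap_frep_left'] linmap_zero[OF linmap_fock_lift'])
  show "to_V ((x + y) * fock_lift m) = to_V (fock_lift (frep (x + y) m))"
    if "to_V (x * fock_lift m) = to_V (fock_lift (frep x m))" "to_V (y * fock_lift m) = to_V (fock_lift (frep y m))" for x y
    using to_V_add_cong[OF that] by (simp add: linmap_add[OF linmap_frep_left'] linmap_add[OF linmap_fock_lift'] distrib_right)
  show "to_V (smul c x * fock_lift m) = to_V (fock_lift (frep (smul c x) m))" if "to_V (x * fock_lift m) = to_V (fock_lift (frep x m))" for c x
    using to_V_smul_cong[OF that] by (simp add: linmap_smul[OF linmap_frep_left'] linmap_smul[OF linmap_fock_lift'] linmap_smul[OF linmap_mult_right[OF linmap_id]])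
  fix w :: "'h hhat word"
  obtain ls where w: "w = Word ls" by (cases w)
  have "to_V (bv (Word ls) * fock_lift m) = to_V (fock_lift (frep (bv (Word ls)) m))"
  proof (induct ls)
    case Nil
    have "bv (Word []) = (1 :: 'h hhat free_algebra)" by (simp flip: zero_word_def)
    then show ?case by (simp add: frep_one)
  next
    case (Cons u ls)
    have e: "bv (Word (u # ls)) = free_gen u * bv (Word ls)"
      by (simp add: free_gen_def mult_single plus_word_def)
    show ?case unfolding e mult.assoc to_V_mult_cong[OF Cons] gen_act_to_V frep_mult frep_free_gen ..
  qed
  then show "to_V (bv w * fock_lift m) = to_V (fock_lift (frep (bv w) m))" by (simp add: w)
qed

lemma to_V_fock_lift: "to_V x = to_V (fock_lift (frep x (bv [])))"
  using frep_to_V[of x "bv []"] by (simp add: fock_lift_Nil)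

text \<open>The kernel of V kills the empty word, which gives one direction. For the other, every
  vector of V is recovered from its action on the empty word by
  \<open>to_V_fock_lift\<close>.\<close>

theorem to_V_eq_frep: "to_V x = to_V y \<longleftrightarrow> frep x (bv []) = frep y (bv [])"
proof
  assume "to_V x = to_V y"
  then have "x - y \<in> vac_kernel" using VK_vac_kernel by (simp add: to_V_eq_iff)
  then show "frep x (bv []) = frep y (bv [])" by (simp add: vac_kernel_def linmap_diff[OF linmap_frep_left'])
next
  assume "frep x (bv []) = frep y (bv [])"
  then have "to_V (fock_lift (frep x (bv []))) = to_V (fock_lift (frep y (bv [])))" by simp
  then show "to_V x = to_V y" using trans[OF to_V_fock_lift trans[OF _ to_V_fock_lift[symmetric]]] by blast
qed

end

context bilinear_form_space
begin

lemma carrier_to_V [simp]: "to_V x \<in> carrier V"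
  by (simp add: carrier_V)

lemma carrier_VE: "v \<in> carrier V \<Longrightarrow> \<exists>x. v = to_V x"
  by (auto simp: carrier_V)

section \<open>Transfer of the vertex operator map\<close>

text \<open>The choice of representative is immaterial by \<open>to_V_eq_frep\<close>.\<close>

definition to_fock :: "'h hhat free_algebra set set set \<Rightarrow> 'h fock" where
  "to_fock v = frep (SOME x. v = to_V x) (bv [])"

definition of_fock :: "'h fock \<Rightarrow> 'h hhat free_algebra set set set" where
  "of_fock m = to_V (fock_lift m)"

lemma to_fock_to_V: "to_fock (to_V x) = frep x (bv [])"
proof -
  have "to_V x = to_V (SOME y. to_V x = to_V y)" by (rule someI[of _ x]) simp
  then show ?thesis unfolding to_fock_def by (simp add: to_V_eq_frep)
qed

lemma of_fock_carrier [simp]: "of_fock m \<in> carrier V"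
  by (simp add: of_fock_def)

lemma of_fock_to_fock: "v \<in> carrier V \<Longrightarrow> of_fock (to_fock v) = v"
  using carrier_VE[of v] to_V_fock_lift by (auto simp: to_fock_to_V of_fock_def)

lemma to_fock_inj: "u \<in> carrier V \<Longrightarrow> v \<in> carrier V \<Longrightarrow> to_fock u = to_fock v \<Longrightarrow> u = v"
  using of_fock_to_fock by metis

lemma V_eq_iff: "u \<in> carrier V \<Longrightarrow> v \<in> carrier V \<Longrightarrow> u = v \<longleftrightarrow> to_fock u = to_fock v"
  using to_fock_inj by blast

lemma V_closed: "u \<in> carrier V \<Longrightarrow> v \<in> carrier V \<Longrightarrow> u \<oplus>\<^bsub>V\<^esub> v \<in> carrier V"
  "v \<in> carrier V \<Longrightarrow> c \<odot>\<^bsub>V\<^esub> v \<in> carrier V" "\<zero>\<^bsub>V\<^esub> \<in> carrier V" "vac \<in> carrier V"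
  "v \<in> carrier V \<Longrightarrow> mode_op x v \<in> carrier V"
  by (cases x; auto dest!: carrier_VE simp: V_add V_smult V_zero vac_to_V mode_op_to_V simp del: mode_op.simps)+

lemma to_fock_add: "u \<in> carrier V \<Longrightarrow> v \<in> carrier V \<Longrightarrow> to_fock (u \<oplus>\<^bsub>V\<^esub> v) = to_fock u + to_fock v"
  and to_fock_smult: "v \<in> carrier V \<Longrightarrow> to_fock (c \<odot>\<^bsub>V\<^esub> v) = smul c (to_fock v)"
  and to_fock_zero: "to_fock \<zero>\<^bsub>V\<^esub> = 0"
  and to_fock_vac: "to_fock vac = bv []"
  and to_fock_mode_op: "v \<in> carrier V \<Longrightarrow> to_fock (mode_op (s, a, k) v) = fmode s a k (to_fock v)"
  by (auto dest!: carrier_VE simp: V_add V_smult V_zero vac_to_V mode_op_to_V to_fock_to_V frep_simps frep_one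
      linmap_zero[OF linmap_frep_left'] linmap_smul[OF linmap_frep_left'] simp del: mode_op.simps)

lemma module_V: "Module.module complex_ring V"
proof (rule moduleI)
  show "cring complex_ring" by (rule cring_from_type_algebra)
  show "abelian_group V"
  proof (rule abelian_groupI)
    fix x assume "x \<in> carrier V"
    then obtain y where "x = to_V y" by (auto dest: carrier_VE)
    then have "to_V (- y) \<oplus>\<^bsub>V\<^esub> x = \<zero>\<^bsub>V\<^esub>" by (simp add: V_add V_zero)
    then show "\<exists>y\<in>carrier V. y \<oplus>\<^bsub>V\<^esub> x = \<zero>\<^bsub>V\<^esub>" using carrier_to_V by blast
  qed (simp_all add: V_eq_iff V_closed to_fock_add to_fock_zero add_ac)
qed (simp_all add: V_eq_iff V_closed to_fock_add to_fock_smult smul.scale_left_distrib smul.scale_right_distrib)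

interpretation V: Module.module complex_ring V
  by (rule module_V)

lemma to_fock_minus: "v \<in> carrier V \<Longrightarrow> to_fock (\<ominus>\<^bsub>V\<^esub> v) = - to_fock v"
  using to_fock_add[of "\<ominus>\<^bsub>V\<^esub> v" v] by (simp add: V.l_neg to_fock_zero eq_neg_iff_add_eq_0)

lemma to_fock_diff: "u \<in> carrier V \<Longrightarrow> v \<in> carrier V \<Longrightarrow> to_fock (u \<ominus>\<^bsub>V\<^esub> v) = to_fock u - to_fock v"
  by (simp add: a_minus_def to_fock_add to_fock_minus)

lemma to_fock_finsum: "(\<And>i. i \<in> S \<Longrightarrow> f i \<in> carrier V) \<Longrightarrow> to_fock (finsum V f S) = (\<Sum>i\<in>S. to_fock (f i))"
proof (induct S rule: infinite_finite_induct)
  case (insert i S)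
  then have "finsum V f (insert i S) = f i \<oplus>\<^bsub>V\<^esub> finsum V f S" by (intro V.finsum_insert) auto
  then show ?case using insert by (simp add: to_fock_add V.finsum_closed Pi_def)
qed (simp_all add: to_fock_zero)

lemma basis_span_iff: "m \<in> basis_span \<longleftrightarrow> Poly_Mapping.keys m \<subseteq> {w. \<forall>(s, b, j)\<in>set w. b \<in> Basis}"
  by (auto simp: basis_span_def)

lemma basis_span_closed: "0 \<in> basis_span" "x \<in> basis_span \<Longrightarrow> y \<in> basis_span \<Longrightarrow> x + y \<in> basis_span" "x \<in> basis_span \<Longrightarrow> smul c x \<in> basis_span" "bv [] \<in> basis_span"
  unfolding basis_span_iff using Poly_Mapping.keys_add[of x y] keys_smul[of c x] by (blast | simp)+

lemma basis_span_sum: "(\<And>i. i \<in> S \<Longrightarrow> f i \<in> basis_span) \<Longrightarrow> sum f S \<in> basis_span"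
  by (induct S rule: infinite_finite_induct) (auto intro: basis_span_closed)

lemma basis_span_lin: "m \<in> basis_span \<Longrightarrow> (\<And>w. \<forall>(s, b, j)\<in>set w. b \<in> Basis \<Longrightarrow> f w \<in> basis_span) \<Longrightarrow> lin f m \<in> basis_span"
  unfolding lin_def by (intro basis_span_sum basis_span_closed(3)) (unfold basis_span_def, blast)

lemma basis_span_prepend: "m \<in> basis_span \<Longrightarrow> b \<in> Basis \<Longrightarrow> prepend (s, b, j) m \<in> basis_span"
  unfolding prepend_def by (rule basis_span_lin) (auto simp: basis_span_def)

lemma basis_span_fmode: "m \<in> basis_span \<Longrightarrow> fmode s a k m \<in> basis_span"
proof -
  assume m: "m \<in> basis_span"
  have "annih_word s a n w \<in> basis_span" if "\<forall>(s, b, j)\<in>set w. b \<in> Basis" for n w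
    using that
  proof (induct w)
    case (Cons l w)
    then have "bv w \<in> basis_span" by (auto simp: basis_span_def)
    then show ?case using Cons by (cases l) (auto intro!: basis_span_closed(2,3) basis_span_prepend)
  qed (simp add: basis_span_closed)
  then show ?thesis
    using m by (auto simp: fmode_def create_def annih_def intro!: basis_span_sum basis_span_closed(3) basis_span_prepend basis_span_lin)
qed

lemma basis_span_ffield: "m \<in> basis_span \<Longrightarrow> ffield A p m \<in> basis_span"
proof -
  have "normal_op A ns m \<in> basis_span" if "m \<in> basis_span" for ns m
    using that by (induct A ns m rule: normal_op.induct) (auto intro!: basis_span_fmode basis_span_closed(3))
  then show "m \<in> basis_span \<Longrightarrow> ffield A p m \<in> basis_span"
    unfolding ffield_def fterm_def by (intro basis_span_sum basis_span_closed(3)) auto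
qed

lemma basis_span_fvertex: "m \<in> basis_span \<Longrightarrow> fvertex u p m \<in> basis_span"
  unfolding fvertex_def lin_def by (intro basis_span_sum basis_span_closed(3) basis_span_ffield)

lemma basis_span_fderivation: "m \<in> basis_span \<Longrightarrow> fderivation m \<in> basis_span"
proof -
  assume m: "m \<in> basis_span"
  have "deriv_word w \<in> basis_span" if "\<forall>(s, b, j)\<in>set w. b \<in> Basis" for w
    using that
  proof (induct w)
    case (Cons l w)
    obtain s b j where l: "l = (s, b, j)" by (cases l)
    have "bv ((s, b, Suc j) # w) \<in> basis_span" using Cons(2) by (auto simp: basis_span_def l)
    then show ?case using Cons by (auto simp: l intro!: basis_span_closed(2,3) basis_span_prepend simp del: of_nat_Suc)
  qed (simp add: basis_span_closed)
  then show ?thesis unfolding fderivation_def using m by (intro basis_span_lin)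
qed

lemma basis_span_frep: "m \<in> basis_span \<Longrightarrow> frep x m \<in> basis_span"
proof -
  assume m: "m \<in> basis_span"
  have "foldr gen_act us m \<in> basis_span" for us
    using m by (induct us) (auto simp: gen_act_def intro!: basis_span_closed(2,3) basis_span_sum basis_span_fmode)
  then show ?thesis unfolding frep_def lin_def by (intro basis_span_sum basis_span_closed(3))
qed

lemma to_fock_basis_span: "v \<in> carrier V \<Longrightarrow> to_fock v \<in> basis_span"
  by (auto dest!: carrier_VE simp: to_fock_to_V basis_span_frep basis_span_closed)

text \<open>Lifting a word and letting it act on the empty word expands every letter in the basis;
  hence the round trip is the identity on \<open>basis_span\<close>.\<close>

lemma to_fock_of_fock_bv: "to_fock (of_fock (bv A)) = state A"
proof -
  have "frep (fock_lift_word A) (bv []) = state A"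
  proof (induct A)
    case (Cons l A)
    obtain s a j where "l = (s, a, j)" by (cases l)
    then show ?case using Cons by (simp add: fock_lift_word_def frep_simps fmode_def)
  qed (simp add: fock_lift_word_def frep_one)
  then show ?thesis by (simp add: of_fock_def to_fock_to_V fock_lift_def)
qed

lemma of_fock_add: "of_fock (x + y) = of_fock x \<oplus>\<^bsub>V\<^esub> of_fock y" and of_fock_smul: "of_fock (smul c x) = c \<odot>\<^bsub>V\<^esub> of_fock x"
  and of_fock_zero: "of_fock 0 = \<zero>\<^bsub>V\<^esub>"
  by (simp_all add: of_fock_def V_add V_smult V_zero linmap_add[OF linmap_fock_lift'] linmap_smul[OF linmap_fock_lift'] linmap_zero[OF linmap_fock_lift'])

lemma linmap_to_fock_of_fock: "linmap (\<lambda>m. to_fock (of_fock m))"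
  by (simp add: linmap_def of_fock_add of_fock_smul to_fock_add to_fock_smult)

lemma to_fock_of_fock: "m \<in> basis_span \<Longrightarrow> to_fock (of_fock m) = m"
proof (rule linmap_eqI[where f = "\<lambda>m. to_fock (of_fock m)" and g = "\<lambda>m. m"])
  fix w assume "m \<in> basis_span" "w \<in> Poly_Mapping.keys m"
  then show "to_fock (of_fock (bv w)) = bv w" by (subst to_fock_of_fock_bv) (auto simp: basis_span_def intro!: state_Basis)
qed (auto intro: linmap_to_fock_of_fock linmap_id)

text \<open>The paper's letter \<open>(s, a, m)\<close> with \<open>m > 0\<close> is the letter \<open>(s, a, m - 1)\<close> here.\<close>

definition lower :: "(species \<times> 'h \<times> nat) list \<Rightarrow> 'h letter list" where
  "lower ws = map (\<lambda>(s, a, m). (s, a, m - 1)) ws"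

definition raise :: "'h letter list \<Rightarrow> (species \<times> 'h \<times> nat) list" where
  "raise A = map (\<lambda>(s, a, j). (s, a, Suc j)) A"

lemma raise_spanning: "raise A \<in> spanning_words" and lower_raise [simp]: "lower (raise A) = A"
  by (auto simp: raise_def lower_def spanning_words_def comp_def case_prod_beta')

lemma word_vec_of_fock: "ws \<in> spanning_words \<Longrightarrow> word_vec ws = of_fock (bv (lower ws))"
proof (induct ws)
  case Nil
  then show ?case by (simp add: word_vec_def lower_def of_fock_def fock_lift_Nil vac_to_V)
next
  case (Cons x ws)
  obtain s a m where x: "x = (s, a, m)" by (cases x)
  have "m > 0" "ws \<in> spanning_words" using Cons(2) by (auto simp: spanning_words_def x)
  then have "word_vec (x # ws) = mode_op (s, a, - int m) (of_fock (bv (lower ws)))"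
    using Cons(1) by (simp add: word_vec_def x del: mode_op.simps)
  also have "\<dots> = to_V (free_mode s a (- int (m - 1) - 1) * fock_lift (bv (lower ws)))"
    using \<open>m > 0\<close> by (simp add: of_fock_def mode_op_to_V of_nat_diff del: mode_op.simps)
  also have "\<dots> = of_fock (bv (lower (x # ws)))"
    by (simp add: of_fock_def lower_def x fock_lift_prepend[symmetric])
  finally show ?case .
qed

lemma word_weight_wt: "ws \<in> spanning_words \<Longrightarrow> word_weight ws = wt (lower ws)"
  by (induct ws) (auto simp: word_weight_def wt_def lower_def letter_wt_def spanning_words_def of_nat_diff)

section \<open>Normal ordering by sorting and its signs\<close>

fun normal_modes :: "(species \<times> 'h \<times> int) list \<Rightarrow> 'h fock \<Rightarrow> 'h fock" where
  "normal_modes ((s, a, k) # ms) m = (if k < 0 then fmode s a k (normal_modes ms m) else smul (ksigns s ms) (normal_modes ms (fmode s a k m)))"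
| "normal_modes [] m = m"

lemma ksigns_map2: "length ns = length A \<Longrightarrow> ksigns s (map2 (\<lambda>(s, a, j) n. (s, a, n)) A ns) = ksigns s A"
  by (induct ns A rule: list_induct2) auto

lemma normal_modes_normal_op: "length ns = length A \<Longrightarrow> normal_modes (map2 (\<lambda>(s, a, j) n. (s, a, n)) A ns) m = normal_op A ns m"
  by (induct ns A arbitrary: m rule: list_induct2) (auto simp: ksigns_map2 split: prod.splits)

definition fmode3 :: "species \<times> 'h \<times> int \<Rightarrow> 'h fock \<Rightarrow> 'h fock" where
  "fmode3 x = fmode (fst x) (fst (snd x)) (snd (snd x))"

lemma linmap_fmode3: "linmap (fmode3 x)"
  unfolding fmode3_def by (rule linmap_fmode')

lemma fmode3_fmode3: "snd (snd x) \<ge> 0 \<Longrightarrow> snd (snd y) \<ge> 0 \<Longrightarrow> fmode3 x (fmode3 y m) = smul (ksign (fst x) (fst y)) (fmode3 y (fmode3 x m))"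
  using annih_annih[of "fst x" "fst (snd x)" "nat (snd (snd x))" "fst y" "fst (snd y)" "nat (snd (snd y))" m]
  by (simp add: fmode3_def fmode_def)

lemma fmode3_foldr: "snd (snd x) \<ge> 0 \<Longrightarrow> \<forall>y\<in>set ys. snd (snd y) \<ge> 0 \<Longrightarrow>
    fmode3 x (foldr fmode3 ys m) = smul (ksigns (fst x) ys) (foldr fmode3 ys (fmode3 x m))"
proof (induct ys)
  case (Cons y ys)
  then show ?case
    using fmode3_fmode3[of x y "foldr fmode3 ys m"] by (simp add: linmap_smul[OF linmap_fmode3])
qed simp

lemma mode_rank_0: "mode_rank x = 0 \<longleftrightarrow> snd (snd x) < 0"
  by (cases x) auto

text \<open>Sorted insertion puts \<open>x\<close> in front of all entries of equal or higher rank.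
  These are nonnegative modes too, so \<open>x\<close> can be carried on to the far right with one
  sign per entry.\<close>

lemma foldr_insort:
  assumes "snd (snd x) \<ge> 0" "sorted (map mode_rank ys)"
  shows "foldr fmode3 (insort_key mode_rank x ys) m =
    smul (ksigns (fst x) (filter (\<lambda>y. \<not> mode_rank y < mode_rank x) ys)) (foldr fmode3 ys (fmode3 x m))"
  using assms(2)
proof (induct ys)
  case (Cons y ys)
  show ?case
  proof (cases "mode_rank x \<le> mode_rank y")
    case True
    then have all: "\<forall>z\<in>set (y # ys). mode_rank x \<le> mode_rank z" using Cons(2) by auto
    then have "filter (\<lambda>y. \<not> mode_rank y < mode_rank x) (y # ys) = y # ys"
      by (intro filter_True) auto
    moreover have "\<forall>z\<in>set (y # ys). snd (snd z) \<ge> 0"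
    proof
      fix z assume "z \<in> set (y # ys)"
      then have "mode_rank x \<le> mode_rank z" using all by blast
      moreover have "mode_rank x \<noteq> 0" using assms(1) by (simp add: mode_rank_0 del: mode_rank.simps)
      ultimately have "mode_rank z \<noteq> 0" by simp
      then show "snd (snd z) \<ge> 0" by (simp add: mode_rank_0 del: mode_rank.simps)
    qed
    ultimately show ?thesis
      using True fmode3_foldr[OF assms(1), of "y # ys" m] by (simp del: foldr.simps filter.simps) simp
  next
    case False
    then show ?thesis using Cons by (simp add: linmap_smul[OF linmap_fmode3])
  qed
qed simp

text \<open>Inversions split into those involving the first entry and those among the rest.\<close>

lemma normal_sign_Cons: "normal_sign (x # ms) = ksigns (fst x) (filter (\<lambda>y. mode_rank y < mode_rank x) ms) * normal_sign ms"
proof -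
  let ?P = "\<lambda>ms i j. i < j \<and> j < length ms \<and> fst (ms ! i) = Fer \<and> fst (ms ! j) = Fer \<and> mode_rank (ms ! i) > mode_rank (ms ! j)"
  let ?A = "{j. j < length ms \<and> fst x = Fer \<and> fst (ms ! j) = Fer \<and> mode_rank (ms ! j) < mode_rank x}"
  let ?B = "{(i, j). ?P ms i j}"
  have finB: "finite ?B" by (rule finite_subset[of _ "{..<length ms} \<times> {..<length ms}"]) auto
  have "{(i, j). ?P (x # ms) i j} = (\<lambda>j. (0, Suc j)) ` ?A \<union> (\<lambda>(i, j). (Suc i, Suc j)) ` ?B" (is "_ = ?C \<union> ?D")
  proof -
    have "(i, j) \<in> {(i, j). ?P (x # ms) i j} \<longleftrightarrow> (i, j) \<in> ?C \<union> ?D" for i j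
      by (cases i; cases j) (auto simp: image_iff simp del: mode_rank.simps)
    then show ?thesis by auto
  qed
  then have "card {(i, j). ?P (x # ms) i j} = card ?C + card ?D"
    using finB by (subst card_Un_disjoint[symmetric]) auto
  also have "card ?C = card ?A" by (rule card_image) (auto simp: inj_on_def)
  also have "card ?D = card ?B" by (rule card_image) (auto simp: inj_on_def)
  finally have "normal_sign (x # ms) = (- 1) ^ card ?A * normal_sign ms"
    unfolding normal_sign_def by (simp only: power_add)
  moreover have "card ?A = (if fst x = Fer then length (filter (\<lambda>y. fst y = Fer \<and> mode_rank y < mode_rank x) ms) else 0)"
    by (simp add: length_filter_conv_card del: mode_rank.simps)
  moreover have "ksigns (fst x) (filter (\<lambda>y. mode_rank y < mode_rank x) ms) =
    (- 1) ^ (if fst x = Fer then length (filter (\<lambda>y. fst y = Fer \<and> mode_rank y < mode_rank x) ms) else 0)"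
    by (induct ms) (auto simp: ksign_def simp del: mode_rank.simps)
  ultimately show ?thesis by simp
qed

lemma ksigns_mset: "mset xs = mset ys \<Longrightarrow> ksigns s xs = ksigns s ys"
  unfolding ksigns_def prod_mset_prod_list[symmetric] mset_map by simp

lemma ksigns_filter: "ksigns s (filter P xs) * ksigns s (filter (\<lambda>y. \<not> P y) xs) = ksigns s xs"
  by (induct xs) (auto simp: mult_ac)

text \<open>For a nonnegative first mode two signs meet: sorting pulls it past the entries of lower
  rank, and \<open>foldr_insort\<close> carries it past the others. Together it passes the whole
  rest of the list, as \<open>normal_modes\<close> prescribes.\<close>

lemma normal_modes_sort: "smul (normal_sign ms) (foldr fmode3 (sort_key mode_rank ms) m) = normal_modes ms m"
proof (induct ms arbitrary: m)
  case Nil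
  then show ?case by (simp add: normal_sign_def)
next
  case (Cons x ms)
  obtain s a k where x: "x = (s, a, k)" by (cases x)
  show ?case
  proof (cases "k < 0")
    case True
    then have r: "mode_rank x = 0" by (simp add: x)
    then have "insort_key mode_rank x (sort_key mode_rank ms) = x # sort_key mode_rank ms"
      by (intro insort_is_Cons) (auto simp del: mode_rank.simps)
    moreover have "normal_sign (x # ms) = normal_sign ms" by (simp add: normal_sign_Cons r del: mode_rank.simps)
    ultimately show ?thesis
      using True Cons[of m] by (simp add: x linmap_smul[OF linmap_fmode', symmetric] fmode3_def del: mode_rank.simps)
  next
    case False
    have "ksigns s (filter (\<lambda>y. \<not> mode_rank y < mode_rank x) (sort_key mode_rank ms)) =
      ksigns s (filter (\<lambda>y. \<not> mode_rank y < mode_rank x) ms)"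
      by (rule ksigns_mset) (simp del: mode_rank.simps)
    then have "smul (normal_sign (x # ms)) (foldr fmode3 (sort_key mode_rank (x # ms)) m) =
      smul (ksigns s ms * normal_sign ms) (foldr fmode3 (sort_key mode_rank ms) (fmode3 x m))"
      using foldr_insort[of x "sort_key mode_rank ms" m] False ksigns_filter[of s "\<lambda>y. mode_rank y < mode_rank x" ms]
      by (simp add: normal_sign_Cons x[THEN arg_cong[of _ _ fst], simplified] mult_ac x[THEN arg_cong[of _ _ "snd"], simplified]
         del: mode_rank.simps)
    moreover have "fmode3 x m = fmode s a k m" by (simp add: fmode3_def x)
    ultimately show ?thesis using False Cons[of "fmode s a k m"] by (simp add: x del: mode_rank.simps flip: smul.scale_scale)
  qed
qed

lemma to_fock_foldr: "v \<in> carrier V \<Longrightarrow> foldr mode_op ms v \<in> carrier V \<and> to_fock (foldr mode_op ms v) = foldr fmode3 ms (to_fock v)"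
proof (induct ms)
  case (Cons x ms)
  then show ?case by (cases x) (simp add: V_closed to_fock_mode_op fmode3_def del: mode_op.simps)
qed simp

lemma to_fock_normal_ordered: "v \<in> carrier V \<Longrightarrow> to_fock (normal_ordered ms v) = normal_modes ms (to_fock v)"
  and normal_ordered_closed: "v \<in> carrier V \<Longrightarrow> normal_ordered ms v \<in> carrier V"
  by (simp_all add: normal_ordered_def to_fock_foldr to_fock_smult normal_modes_sort V_closed del: mode_op.simps)

lemma mode_indices_lower: "ws \<in> spanning_words \<Longrightarrow>
  ns \<in> mode_indices (lower ws) p \<longleftrightarrow> length ns = length ws \<and> (\<Sum>i<length ws. - (ns ! i) - int (snd (snd (ws ! i)))) = p"
proof -
  assume ws: "ws \<in> spanning_words"
  have "exponent (lower ws) ns = (\<Sum>i<length ws. - (ns ! i) - int (snd (snd (ws ! i))))" if "length ns = length ws"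
    using that ws
  proof (induct ns ws rule: list_induct2)
    case (Cons n ns x ws)
    then have "snd (snd x) > 0" "ws \<in> spanning_words" by (auto simp: spanning_words_def)
    then show ?case using Cons
      by (cases x) (simp add: lower_def sum.lessThan_Suc_shift of_nat_diff del: sum.lessThan_Suc)
  qed (simp add: lower_def)
  then show ?thesis by (auto simp: mode_indices_def lower_def)
qed

lemma to_fock_field_product_term:
  assumes "v \<in> carrier V" "length ns = length ws"
  shows "to_fock (field_product_term ws v ns) = fterm (lower ws) ns (to_fock v)" "field_product_term ws v ns \<in> carrier V"
proof -
  have c: "(\<Prod>i<length ws. of_int (- (ns ! i) - 1) gchoose (snd (snd (ws ! i)) - 1)) = coeff_prod (lower ws) ns"
    using assms(2)
  proof (induct ns ws rule: list_induct2)
    case (Cons n ns x ws)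
    then show ?case
      by (cases x) (simp add: lower_def prod.lessThan_Suc_shift del: prod.lessThan_Suc)
  qed (simp add: lower_def)
  have "map2 (\<lambda>(s, a, m) n. (s, a, n)) ws ns = map2 (\<lambda>(s, a, j) n. (s, a, n)) (lower ws) ns"
    using assms(2) by (induct ns ws rule: list_induct2) (auto simp: lower_def)
  moreover have "normal_modes (map2 (\<lambda>(s, a, j) n. (s, a, n)) (lower ws) ns) m = normal_op (lower ws) ns m" for m
    using assms(2) by (intro normal_modes_normal_op) (simp add: lower_def)
  ultimately show "to_fock (field_product_term ws v ns) = fterm (lower ws) ns (to_fock v)"
    unfolding field_product_term_def c
    by (simp add: to_fock_smult normal_ordered_closed[OF assms(1)] to_fock_normal_ordered[OF assms(1)] fterm_def)
  show "field_product_term ws v ns \<in> carrier V"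
    unfolding field_product_term_def by (intro V_closed normal_ordered_closed assms(1))
qed

lemma to_fock_field_product:
  assumes v: "v \<in> carrier V" and ws: "ws \<in> spanning_words"
  shows "field_product ws p v \<in> carrier V" "to_fock (field_product ws p v) = ffield (lower ws) p (to_fock v)"
proof -
  let ?S = "{ns. length ns = length ws \<and> (\<Sum>i<length ws. - (ns ! i) - int (snd (snd (ws ! i)))) = p \<and>
     field_product_term ws v ns \<noteq> \<zero>\<^bsub>V\<^esub>}"
  have nz: "field_product_term ws v ns = \<zero>\<^bsub>V\<^esub> \<longleftrightarrow> fterm (lower ws) ns (to_fock v) = 0" if "length ns = length ws" for ns
    using to_fock_field_product_term[OF v that] by (simp add: V_eq_iff V_closed to_fock_zero)
  have S: "?S = {ns \<in> mode_indices (lower ws) p. fterm (lower ws) ns (to_fock v) \<noteq> 0}"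
    using nz by (auto simp: mode_indices_lower[OF ws])
  have c: "field_product_term ws v ns \<in> carrier V" if "ns \<in> ?S" for ns
    using that by (intro to_fock_field_product_term(2)[OF v]) auto
  show "field_product ws p v \<in> carrier V"
    unfolding field_product_def using c by (intro V.finsum_closed) auto
  have "to_fock (field_product ws p v) = (\<Sum>ns\<in>?S. to_fock (field_product_term ws v ns))"
    unfolding field_product_def using c by (rule to_fock_finsum)
  also have "\<dots> = (\<Sum>ns\<in>?S. fterm (lower ws) ns (to_fock v))"
    by (intro sum.cong refl to_fock_field_product_term(1)[OF v]) auto
  finally show "to_fock (field_product ws p v) = ffield (lower ws) p (to_fock v)" by (simp only: S ffield_def)
qed

definition vertex_V :: "'h hhat free_algebra set set set \<Rightarrow> int \<Rightarrow> 'h hhat free_algebra set set set \<Rightarrow> 'h hhat free_algebra set set set" where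
  "vertex_V u p v = of_fock (fvertex (to_fock u) p (to_fock v))"

lemma to_fock_vertex_V: "v \<in> carrier V \<Longrightarrow> to_fock (vertex_V u p v) = fvertex (to_fock u) p (to_fock v)"
  by (simp add: vertex_V_def to_fock_of_fock basis_span_fvertex to_fock_basis_span)

lemma vertex_V_is_vertex_map: "is_vertex_map vertex_V"
  unfolding is_vertex_map_def
proof (intro allI ballI conjI)
  fix p v assume v: "v \<in> carrier V"
  show YVc: "vertex_V u p v \<in> carrier V" for u by (simp add: vertex_V_def)
  show "vertex_V (u \<oplus>\<^bsub>V\<^esub> u') p v = vertex_V u p v \<oplus>\<^bsub>V\<^esub> vertex_V u' p v" if "u \<in> carrier V" "u' \<in> carrier V" for u u'
    using that v by (simp add: V_eq_iff V_closed YVc to_fock_vertex_V to_fock_add linmap_add[OF linmap_fvertex_left'])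
  show "vertex_V (c \<odot>\<^bsub>V\<^esub> u) p v = c \<odot>\<^bsub>V\<^esub> vertex_V u p v" if "u \<in> carrier V" for c u
    using that v by (simp add: V_eq_iff V_closed YVc to_fock_vertex_V to_fock_smult linmap_smul[OF linmap_fvertex_left'])
  show "vertex_V (word_vec ws) p v = field_product ws p v" if "ws \<in> spanning_words" for ws
    using that v by (simp add: V_eq_iff to_fock_field_product YVc to_fock_vertex_V word_vec_of_fock to_fock_of_fock_bv fvertex_state)
qed

text \<open>\<open>vertex_map\<close> is chosen by \<open>SOME\<close>, so any candidate has to be
  compared with \<open>vertex_V\<close>: they agree on the spanning vectors and hence, by linearity
  in \<open>u\<close>, everywhere.\<close>

lemma vertex_map_unique:
  assumes Y: "is_vertex_map Y" and u: "u \<in> carrier V" and v: "v \<in> carrier V"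
  shows "Y u p v = vertex_V u p v"
proof -
  have Yc: "\<And>u. u \<in> carrier V \<Longrightarrow> Y u p v \<in> carrier V"
    and Ya: "\<And>u u'. u \<in> carrier V \<Longrightarrow> u' \<in> carrier V \<Longrightarrow> Y (u \<oplus>\<^bsub>V\<^esub> u') p v = Y u p v \<oplus>\<^bsub>V\<^esub> Y u' p v"
    and Ys: "\<And>c u. u \<in> carrier V \<Longrightarrow> Y (c \<odot>\<^bsub>V\<^esub> u) p v = c \<odot>\<^bsub>V\<^esub> Y u p v"
    and Yw: "\<And>ws. ws \<in> spanning_words \<Longrightarrow> Y (word_vec ws) p v = field_product ws p v"
    if "is_vertex_map Y" for Y
    using that v unfolding is_vertex_map_def by blast+
  note vertex_V = vertex_V_is_vertex_map
  have "Y (of_fock m) p v = vertex_V (of_fock m) p v" for m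
  proof (rule vec_induct[of "\<lambda>m. Y (of_fock m) p v = vertex_V (of_fock m) p v"])
    have "of_fock 0 = 0 \<odot>\<^bsub>V\<^esub> of_fock 0" using of_fock_smul[of 0 0] by simp
    then have "Y (of_fock 0) p v = 0 \<odot>\<^bsub>V\<^esub> Y (of_fock 0) p v" "vertex_V (of_fock 0) p v = 0 \<odot>\<^bsub>V\<^esub> vertex_V (of_fock 0) p v"
      using Ys[OF Y, of "of_fock 0" 0] Ys[OF vertex_V, of "of_fock 0" 0] by simp_all
    moreover have "0 \<odot>\<^bsub>V\<^esub> x = \<zero>\<^bsub>V\<^esub>" if "x \<in> carrier V" for x
      using that by (simp add: V_eq_iff V_closed to_fock_smult to_fock_zero)
    ultimately show "Y (of_fock 0) p v = vertex_V (of_fock 0) p v" using Yc[OF Y] Yc[OF vertex_V] by simp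
    show "Y (of_fock (x + y)) p v = vertex_V (of_fock (x + y)) p v" if "Y (of_fock x) p v = vertex_V (of_fock x) p v" "Y (of_fock y) p v = vertex_V (of_fock y) p v" for x y
      using that by (simp add: of_fock_add Ya[OF Y] Ya[OF vertex_V])
    show "Y (of_fock (smul c x)) p v = vertex_V (of_fock (smul c x)) p v" if "Y (of_fock x) p v = vertex_V (of_fock x) p v" for c x
      using that by (simp add: of_fock_smul Ys[OF Y] Ys[OF vertex_V])
    show "Y (of_fock (bv w)) p v = vertex_V (of_fock (bv w)) p v" for w
      using word_vec_of_fock[OF raise_spanning, of w] Yw[OF Y raise_spanning, of w] Yw[OF vertex_V raise_spanning, of w] by simp
  qed
  then show ?thesis using of_fock_to_fock[OF u] by metis
qed

lemma vertex_map_vertex_V: "u \<in> carrier V \<Longrightarrow> v \<in> carrier V \<Longrightarrow> vertex_map u p v = vertex_V u p v"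
  unfolding vertex_map_def by (rule vertex_map_unique[OF someI[of is_vertex_map, OF vertex_V_is_vertex_map]])

lemma vertex_map_closed: "u \<in> carrier V \<Longrightarrow> v \<in> carrier V \<Longrightarrow> vertex_map u p v \<in> carrier V"
  by (simp add: vertex_map_vertex_V vertex_V_def)

lemma to_fock_vertex_map: "u \<in> carrier V \<Longrightarrow> v \<in> carrier V \<Longrightarrow> to_fock (vertex_map u p v) = fvertex (to_fock u) p (to_fock v)"
  by (simp add: vertex_map_vertex_V to_fock_vertex_V)

section \<open>The grading of V and the operators of weight and derivation\<close>

definition hom_wt :: "rat \<Rightarrow> 'h fock \<Rightarrow> bool" where
  "hom_wt n m \<longleftrightarrow> (\<forall>w\<in>Poly_Mapping.keys m. wt w = n)"

lemma hom_wt_closed: "hom_wt n 0" "hom_wt n x \<Longrightarrow> hom_wt n y \<Longrightarrow> hom_wt n (x + y)" "hom_wt n x \<Longrightarrow> hom_wt n (smul c x)"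
  "hom_wt n (bv w) \<longleftrightarrow> wt w = n"
  unfolding hom_wt_def using Poly_Mapping.keys_add[of x y] keys_smul[of c x] by (blast | simp)+

lemma hom_wt_uminus: "hom_wt n x \<Longrightarrow> hom_wt n (- x)"
  using hom_wt_closed(3)[of n x "- 1"] by simp

lemma hom_wt_state: "hom_wt (wt A) (state A)"
proof (induct A)
  case (Cons l A)
  obtain s a j where l: "l = (s, a, j)" by (cases l)
  have "hom_wt (wt (l # A)) (prepend (s, b, j) (state A))" for b
    using Cons keys_lin[of "\<lambda>w. bv ((s, b, j) # w)" "state A"]
    by (auto simp: hom_wt_def prepend_def l wt_def letter_wt_def)
  then have "hom_wt (wt (l # A)) (smul c (prepend (s, b, j) (state A)))" for b c
    by (rule hom_wt_closed(3))
  moreover have "hom_wt n (sum f S)" if "\<And>i. i \<in> S \<Longrightarrow> hom_wt n (f i)" for n f and S :: "'h set"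
    using that by (induct S rule: infinite_finite_induct) (auto intro: hom_wt_closed)
  ultimately show ?case by (simp add: l create_def)
qed (simp add: hom_wt_closed(4))

lemma to_fock_word_vec: "ws \<in> spanning_words \<Longrightarrow> to_fock (word_vec ws) = state (lower ws)" "ws \<in> spanning_words \<Longrightarrow> word_vec ws \<in> carrier V"
  by (simp_all add: word_vec_of_fock to_fock_of_fock_bv)

text \<open>Spanning vectors of weight \<open>n\<close> expand into words of weight
  \<open>n\<close>; conversely, after \<open>raise\<close>, each word of \<open>to_fock v\<close>
  yields a spanning vector.\<close>

lemma V_grade_iff: "v \<in> V_grade n \<longleftrightarrow> v \<in> carrier V \<and> hom_wt n (to_fock v)"
proof
  have inv: "inv\<^bsub>add_monoid V\<^esub> h = \<ominus>\<^bsub>V\<^esub> h" for h by (simp add: a_inv_def)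
  assume "v \<in> V_grade n"
  then show "v \<in> carrier V \<and> hom_wt n (to_fock v)"
    unfolding V_grade_def
  proof (induct rule: generate.induct)
    case one
    then show ?case by (simp add: V_closed to_fock_zero hom_wt_closed)
  next
    case (incl h)
    then show ?case using hom_wt_state
      by (auto simp: V_closed to_fock_word_vec to_fock_smult word_weight_wt intro!: hom_wt_closed)
  next
    case (inv h)
    then show ?case using hom_wt_state unfolding \<open>\<And>h. inv\<^bsub>add_monoid V\<^esub> h = \<ominus>\<^bsub>V\<^esub> h\<close>
      by (auto simp: V_closed to_fock_word_vec to_fock_smult to_fock_minus word_weight_wt intro!: hom_wt_closed hom_wt_uminus)
  next
    case (eng x y)
    then show ?case by (simp add: V_closed to_fock_add hom_wt_closed)
  qed
next
  assume v: "v \<in> carrier V \<and> hom_wt n (to_fock v)"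
  have "of_fock (\<Sum>w\<in>S. smul (Poly_Mapping.lookup (to_fock v) w) (bv w)) \<in> V_grade n" if "finite S" "S \<subseteq> Poly_Mapping.keys (to_fock v)" for S
    using that
  proof (induct S rule: finite_induct)
    case empty
    then show ?case using generate.one[of "add_monoid V"] by (simp add: of_fock_zero V_grade_def)
  next
    case (insert w S)
    have "of_fock (smul (Poly_Mapping.lookup (to_fock v) w) (bv w)) = Poly_Mapping.lookup (to_fock v) w \<odot>\<^bsub>V\<^esub> word_vec (raise w)"
      using word_vec_of_fock[OF raise_spanning, of w] by (simp add: of_fock_smul)
    moreover have "word_weight (raise w) = n" using insert(4) v word_weight_wt[OF raise_spanning, of w] by (auto simp: hom_wt_def)
    ultimately have "of_fock (smul (Poly_Mapping.lookup (to_fock v) w) (bv w)) \<in> V_grade n"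
      unfolding V_grade_def using raise_spanning by (intro generate.incl) blast
    then show ?case
      using insert generate.eng[of _ "add_monoid V"] by (simp add: of_fock_add V_grade_def)
  qed
  from this[OF finite_keys subset_refl] show "v \<in> V_grade n"
    using v by (simp flip: bv_expansion add: of_fock_to_fock)
qed

definition wt_part :: "rat \<Rightarrow> 'h fock \<Rightarrow> 'h fock" where
  "wt_part n = lin (\<lambda>w. if wt w = n then bv w else 0)"

lemma linmap_wt_part: "linmap (wt_part n)"
  unfolding wt_part_def by (rule linmap_lin)

lemma lookup_wt_part: "Poly_Mapping.lookup (wt_part n m) w = (if wt w = n then Poly_Mapping.lookup m w else 0)"
proof -
  have "Poly_Mapping.lookup (wt_part n m) w = (\<Sum>v\<in>Poly_Mapping.keys m. if v = w then (if wt w = n then Poly_Mapping.lookup m w else 0) else 0)"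
    unfolding wt_part_def lin_def lookup_sum by (intro sum.cong) (auto simp: lookup_single when_def)
  then show ?thesis by (auto simp: in_keys_iff)
qed

lemma keys_wt_part: "Poly_Mapping.keys (wt_part n m) = {w \<in> Poly_Mapping.keys m. wt w = n}"
  by (auto simp: in_keys_iff lookup_wt_part split: if_splits)

lemma wt_part_hom_wt: "hom_wt k m \<Longrightarrow> wt_part n m = (if n = k then m else 0)"
  by (rule poly_mapping_eqI) (auto simp: lookup_wt_part hom_wt_def in_keys_iff)

lemma wt_part_nz: "{n. wt_part n m \<noteq> 0} = wt ` Poly_Mapping.keys m"
  by (auto simp: keys_eq_empty[symmetric] keys_wt_part simp del: keys_eq_empty)

text \<open>With \<open>c\<close> constantly 1 this recovers \<open>m\<close>, with
  \<open>c = of_rat\<close> it is \<open>fweight m\<close>; one identity serves the decomposition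
  and the weight operator.\<close>

lemma sum_wt_part: "(\<Sum>n\<in>{n. wt_part n m \<noteq> 0}. smul (c n) (wt_part n m)) = lin (\<lambda>w. smul (c (wt w)) (bv w)) m"
proof (rule poly_mapping_eqI)
  fix w
  have "Poly_Mapping.lookup (\<Sum>n\<in>{n. wt_part n m \<noteq> 0}. smul (c n) (wt_part n m)) w =
    (\<Sum>n\<in>wt ` Poly_Mapping.keys m. if n = wt w then c (wt w) * Poly_Mapping.lookup m w else 0)"
    unfolding lookup_sum wt_part_nz by (intro sum.cong) (auto simp: lookup_wt_part)
  also have "\<dots> = c (wt w) * Poly_Mapping.lookup m w" by (auto simp: in_keys_iff)
  also have "\<dots> = (\<Sum>v\<in>Poly_Mapping.keys m. if v = w then c (wt w) * Poly_Mapping.lookup m w else 0)"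
    by (auto simp: in_keys_iff)
  also have "\<dots> = Poly_Mapping.lookup (lin (\<lambda>w. smul (c (wt w)) (bv w)) m) w"
    unfolding lin_def lookup_sum by (intro sum.cong) (auto simp: lookup_single when_def)
  finally show "Poly_Mapping.lookup (\<Sum>n\<in>{n. wt_part n m \<noteq> 0}. smul (c n) (wt_part n m)) w =
    Poly_Mapping.lookup (lin (\<lambda>w. smul (c (wt w)) (bv w)) m) w" .
qed

lemma wt_half_ints: "wt w \<in> half_ints"
proof (induct w)
  case (Cons l w)
  have "2 * letter_wt l \<in> \<int>" by (auto simp: letter_wt_def algebra_simps)
  then show ?case using Cons by (auto simp: half_ints_def wt_def distrib_left)
qed (simp add: half_ints_def wt_def)

lemma decomposition_wt_part:
  assumes v: "v \<in> carrier V"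
  shows "is_decomposition V V_grade v (\<lambda>n. of_fock (wt_part n (to_fock v)))"
proof -
  have M: "wt_part n (to_fock v) \<in> basis_span" for n using to_fock_basis_span[OF v] by (auto simp: basis_span_def keys_wt_part)
  have nz: "{n. of_fock (wt_part n (to_fock v)) \<noteq> \<zero>\<^bsub>V\<^esub>} = {n. wt_part n (to_fock v) \<noteq> 0}"
    by (simp add: V_eq_iff V_closed to_fock_of_fock M to_fock_zero)
  have "to_fock (finsum V (\<lambda>n. of_fock (wt_part n (to_fock v))) {n. wt_part n (to_fock v) \<noteq> 0}) = (\<Sum>n\<in>{n. wt_part n (to_fock v) \<noteq> 0}. smul 1 (wt_part n (to_fock v)))"
    by (subst to_fock_finsum) (simp_all add: to_fock_of_fock M)
  also have "\<dots> = to_fock v" unfolding sum_wt_part by (simp add: lin_def flip: bv_expansion)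
  finally have "v = finsum V (\<lambda>n. of_fock (wt_part n (to_fock v))) {n. wt_part n (to_fock v) \<noteq> 0}"
    using v by (simp add: V_eq_iff V.finsum_closed)
  moreover have "wt_part n (to_fock v) = 0" if "n \<notin> half_ints" for n
  proof -
    have "n \<notin> wt ` Poly_Mapping.keys (to_fock v)" using that wt_half_ints by blast
    then show ?thesis unfolding wt_part_nz[symmetric] by simp
  qed
  ultimately show ?thesis
    unfolding is_decomposition_def nz
    by (auto simp: V_grade_iff to_fock_of_fock M hom_wt_def keys_wt_part of_fock_zero wt_part_nz)
qed

text \<open>Projecting a decomposition to weight \<open>n\<close> isolates the single summand
  \<open>f n\<close>.\<close>

lemma decomposition_unique:
  assumes v: "v \<in> carrier V" and f: "is_decomposition V V_grade v f"
  shows "f = (\<lambda>n. of_fock (wt_part n (to_fock v)))"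
proof
  fix n
  have fc: "f k \<in> carrier V \<and> hom_wt k (to_fock (f k))" for k
    using f by (cases "k \<in> half_ints") (auto simp: is_decomposition_def V_grade_iff V_closed to_fock_zero hom_wt_closed)
  let ?S = "{n. f n \<noteq> \<zero>\<^bsub>V\<^esub>}"
  have fin: "finite ?S" "v = finsum V f ?S" using f by (auto simp: is_decomposition_def)
  have "to_fock v = (\<Sum>k\<in>?S. to_fock (f k))" using fin(2) to_fock_finsum[of ?S f] fc by simp
  then have "wt_part n (to_fock v) = (\<Sum>k\<in>?S. wt_part n (to_fock (f k)))" by (simp add: linmap_sum[OF linmap_wt_part])
  also have "\<dots> = (\<Sum>k\<in>?S. if k = n then to_fock (f n) else 0)"
  proof (intro sum.cong refl)
    show "wt_part n (to_fock (f k)) = (if k = n then to_fock (f n) else 0)" for k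
      using fc[of k] wt_part_hom_wt[of k "to_fock (f k)" n] by simp
  qed
  also have "\<dots> = to_fock (f n)" using fin(1) by (auto simp: to_fock_zero)
  finally show "f n = of_fock (wt_part n (to_fock v))" using fc by (simp add: of_fock_to_fock)
qed

lemma weight_op_to_fock: "v \<in> carrier V \<Longrightarrow> to_fock (weight_op V V_grade v) = fweight (to_fock v) \<and> weight_op V V_grade v \<in> carrier V"
proof -
  assume v: "v \<in> carrier V"
  have the: "(THE f. is_decomposition V V_grade v f) = (\<lambda>n. of_fock (wt_part n (to_fock v)))"
    using decomposition_wt_part[OF v] decomposition_unique[OF v] by (rule the_equality)
  have M: "wt_part n (to_fock v) \<in> basis_span" for n using to_fock_basis_span[OF v] by (auto simp: basis_span_def keys_wt_part)
  have nz: "{n. of_fock (wt_part n (to_fock v)) \<noteq> \<zero>\<^bsub>V\<^esub>} = {n. wt_part n (to_fock v) \<noteq> 0}"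
    by (simp add: V_eq_iff V_closed to_fock_of_fock M to_fock_zero)
  have "to_fock (weight_op V V_grade v) = (\<Sum>n\<in>{n. wt_part n (to_fock v) \<noteq> 0}. smul (of_rat n) (wt_part n (to_fock v)))"
    unfolding weight_op_def the Let_def nz by (subst to_fock_finsum) (simp_all add: V_closed to_fock_smult to_fock_of_fock M)
  then show ?thesis
    unfolding weight_op_def the Let_def by (auto simp: sum_wt_part fweight_def V_closed intro!: V.finsum_closed)
qed

lemma fvertex_vac: "u \<in> basis_span \<Longrightarrow> p \<le> 0 \<Longrightarrow> fvertex u p (bv []) = (if p = 0 then u else 0)"
proof (rule linmap_eqI[where f = "\<lambda>u. fvertex u p (bv [])" and g = "\<lambda>u. if p = 0 then u else 0"])
  fix w assume "u \<in> basis_span" "p \<le> 0" "w \<in> Poly_Mapping.keys u"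
  then show "fvertex (bv w) p (bv []) = (if p = 0 then bv w else 0)"
    using state_Basis[of w] by (auto simp: ffield_vac basis_span_def)
qed (auto intro: linmap_fvertex_left' linmap_intros)

text \<open>By \<open>D_fvertex_left\<close> the coefficient of x in Y(u, x)1 is the constant
  coefficient of Y(Du, x)1, which the creation property evaluates to Du.\<close>

lemma D_op_to_fock:
  assumes u: "u \<in> carrier V"
  shows "to_fock (D_op V vertex_map vac u) = fderivation (to_fock u)" "D_op V vertex_map vac u \<in> carrier V"
proof -
  have "D_op V vertex_map vac u = of_int 1 \<odot>\<^bsub>V\<^esub> vertex_map u 1 vac" by (simp add: D_op_def fderiv_def)
  then show "D_op V vertex_map vac u \<in> carrier V" "to_fock (D_op V vertex_map vac u) = fderivation (to_fock u)"
    using u fvertex_vac[OF basis_span_fderivation[OF to_fock_basis_span[OF u]], of 0] D_fvertex_left[of "to_fock u" 0 "bv []"]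
    by (simp_all add: V_closed vertex_map_closed to_fock_smult to_fock_vertex_map to_fock_vac)
qed

text \<open>A fermionic letter of size \<open>j + 1\<close> has weight \<open>j + 1/2\<close>, so
  the factor 2 is attained at \<open>j = 0\<close>.\<close>

lemma word_size_wt: "of_int (word_size w) \<le> 2 * wt w"
proof (induct w)
  case (Cons l w)
  have "(1 :: rat) + of_nat k \<le> 2 + 2 * of_nat k - 1" for k by simp
  then show ?case using Cons by (auto simp: wt_def letter_wt_def algebra_simps)
qed (simp add: wt_def)

text \<open>The functional sees finitely many weights, and a large size forces a large
  weight.\<close>

lemma graded_dual_bounded_linfun:
  assumes "\<phi> \<in> graded_dual V V_grade"
  shows "bounded_linfun (\<lambda>m. \<phi> (of_fock m))"
proof -
  have add: "\<And>u v. u \<in> carrier V \<Longrightarrow> v \<in> carrier V \<Longrightarrow> \<phi> (u \<oplus>\<^bsub>V\<^esub> v) = \<phi> u + \<phi> v"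
    and smul: "\<And>c v. v \<in> carrier V \<Longrightarrow> \<phi> (c \<odot>\<^bsub>V\<^esub> v) = c * \<phi> v"
    and fin: "finite {n \<in> half_ints. \<exists>v\<in>V_grade n. \<phi> v \<noteq> 0}" (is "finite ?S")
    using assms by (auto simp: graded_dual_def)
  have "linfun (\<lambda>m. \<phi> (of_fock m))" by (simp add: linfun_def of_fock_add of_fock_smul add smul)
  moreover have "\<exists>K. \<forall>w :: 'h letter list. word_size w > K \<longrightarrow> \<phi> (of_fock (bv w)) = 0"
  proof (intro exI allI impI)
    fix w :: "'h letter list" assume w: "word_size w > \<lfloor>2 * Max (insert 0 ?S)\<rfloor>"
    show "\<phi> (of_fock (bv w)) = 0"
    proof (rule ccontr)
      assume nz: "\<phi> (of_fock (bv w)) \<noteq> 0"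
      have "of_fock (bv w) \<in> V_grade (wt w)" by (simp add: V_grade_iff to_fock_of_fock_bv hom_wt_state)
      then have "wt w \<in> ?S" using nz wt_half_ints by blast
      then have "wt w \<le> Max (insert 0 ?S)" using fin by (intro Max_ge) auto
      then have "of_int (word_size w) \<le> 2 * Max (insert 0 ?S)" using word_size_wt[of w] by linarith
      then show False using w by (simp add: le_floor_iff[symmetric])
    qed
  qed
  ultimately show ?thesis by (simp add: bounded_linfun_def)
qed

section \<open>Transfer of the axioms to V\<close>

lemma foldr_vertex_map:
  "set us \<subseteq> carrier V \<Longrightarrow> v \<in> carrier V \<Longrightarrow> length ks = length us \<Longrightarrow>
    foldr (\<lambda>(u, k) w. vertex_map u k w) (zip us ks) v \<in> carrier V \<and>
    to_fock (foldr (\<lambda>(u, k) w. vertex_map u k w) (zip us ks) v) = vertex_product (zip (map to_fock us) ks) (to_fock v)"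
proof (induct us arbitrary: ks)
  case (Cons u us)
  then show ?case by (cases ks) (simp_all add: vertex_product_def vertex_map_closed to_fock_vertex_map)
qed (simp add: vertex_product_def)

lemma product_term_to_fock:
  assumes "set us \<subseteq> carrier V" "v \<in> carrier V" "length ks = length us"
  shows "product_term vertex_map \<phi> us v zs ks = product_term fvertex (\<lambda>m. \<phi> (of_fock m)) (map to_fock us) (to_fock v) zs ks"
proof -
  have "foldr (\<lambda>(u, k) w. vertex_map u k w) (zip us ks) v = of_fock (vertex_product (zip (map to_fock us) ks) (to_fock v))"
    using foldr_vertex_map[OF assms] of_fock_to_fock by metis
  then show ?thesis by (simp add: product_term_vertex_product) (simp add: product_term_def)
qed

lemma iterate_term_to_fock:
  assumes "u1 \<in> carrier V" "u2 \<in> carrier V" "v \<in> carrier V"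
  shows "iterate_term vertex_map \<phi> u1 u2 v z1 z2 = iterate_term fvertex (\<lambda>m. \<phi> (of_fock m)) (to_fock u1) (to_fock u2) (to_fock v) z1 z2"
proof
  fix p :: "int \<times> int"
  obtain k l where p: "p = (k, l)" by (cases p)
  have "vertex_map (vertex_map u1 k u2) l v = of_fock (fvertex (fvertex (to_fock u1) k (to_fock u2)) l (to_fock v))"
    using assms of_fock_to_fock[of "vertex_map (vertex_map u1 k u2) l v"] by (simp add: vertex_map_closed to_fock_vertex_map)
  then show "iterate_term vertex_map \<phi> u1 u2 v z1 z2 p = iterate_term fvertex (\<lambda>m. \<phi> (of_fock m)) (to_fock u1) (to_fock u2) (to_fock v) z1 z2 p"
    by (simp add: iterate_term_def p)
qed

lemma length_2_list: "length zs = 2 \<Longrightarrow> zs = [zs ! 0, zs ! 1]"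
  by (auto simp: numeral_2_eq_2 length_Suc_conv)

theorem graded_mosva_V: "graded_mosva V V_grade vertex_map vac"
proof (intro graded_mosva.intro module_V graded_mosva_axioms.intro)
  fix n :: rat assume "n \<in> half_ints"
  show "submodule (V_grade n) complex_ring V"
    by (rule V.submoduleI) (auto simp: V_grade_iff V_closed to_fock_zero to_fock_minus to_fock_add to_fock_smult intro: hom_wt_closed hom_wt_uminus)
next
  fix v assume "v \<in> carrier V"
  then show "\<exists>!f. is_decomposition V V_grade v f"
    using decomposition_wt_part decomposition_unique by blast
next
  show "vac \<in> carrier V" by (rule V_closed)
next
  show "\<exists>N. \<forall>n\<in>half_ints. n < N \<longrightarrow> V_grade n = {\<zero>\<^bsub>V\<^esub>}"
  \<comment> \<open>Twice the weight is at least the size, which is nonnegative, so 0 serves as the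
    bound.\<close>
  proof (intro exI[of _ 0] ballI impI)
    fix n :: rat assume n: "n < 0"
    have "v = \<zero>\<^bsub>V\<^esub>" if "v \<in> carrier V" "hom_wt n (to_fock v)" for v
    proof -
      have "w \<notin> Poly_Mapping.keys (to_fock v)" for w
        using that(2) n word_size_wt[of w] word_size_nonneg[of w] by (auto simp: hom_wt_def)
      then have "Poly_Mapping.keys (to_fock v) = {}" by blast
      then show ?thesis using that(1) by (simp add: V_eq_iff V_closed to_fock_zero)
    qed
    then show "V_grade n = {\<zero>\<^bsub>V\<^esub>}" by (auto simp: V_grade_iff V_closed to_fock_zero hom_wt_closed)
  qed
next
  fix u v p assume uv: "u \<in> carrier V" "v \<in> carrier V"
  note uv = uv weight_op_to_fock[OF uv(1)] weight_op_to_fock[OF uv(2)] weight_op_to_fock[OF vertex_map_closed[OF uv, of p]]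
  show "weight_op V V_grade (vertex_map u p v) \<ominus>\<^bsub>V\<^esub> vertex_map u p (weight_op V V_grade v) =
     of_int p \<odot>\<^bsub>V\<^esub> vertex_map u p v \<oplus>\<^bsub>V\<^esub> vertex_map (weight_op V V_grade u) p v"
    using uv by (simp add: V_eq_iff V_closed vertex_map_closed V.minus_closed to_fock_diff to_fock_add to_fock_smult to_fock_vertex_map fweight_fvertex)
next
  fix v p assume v: "v \<in> carrier V"
  then show "vertex_map vac p v = (if p = 0 then v else \<zero>\<^bsub>V\<^esub>)"
    by (simp add: V_eq_iff V_closed vertex_map_closed to_fock_vertex_map to_fock_vac ffield_Nil to_fock_zero)
next
  fix u p assume u: "u \<in> carrier V"
  show "p < 0 \<Longrightarrow> vertex_map u p vac = \<zero>\<^bsub>V\<^esub>"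
    using u by (simp add: V_eq_iff V_closed vertex_map_closed to_fock_vertex_map to_fock_vac fvertex_vac to_fock_basis_span to_fock_zero)
  show "vertex_map u 0 vac = u"
    using u by (simp add: V_eq_iff V_closed vertex_map_closed to_fock_vertex_map to_fock_vac fvertex_vac to_fock_basis_span to_fock_zero)
next
  fix u v p assume uv: "u \<in> carrier V" "v \<in> carrier V"
  show "fderiv V (\<lambda>p. vertex_map u p v) p = vertex_map (D_op V vertex_map vac u) p v"
    using uv by (simp add: V_eq_iff V_closed vertex_map_closed fderiv_def D_op_to_fock to_fock_smult to_fock_vertex_map D_fvertex_left)
  show "fderiv V (\<lambda>p. vertex_map u p v) p = D_op V vertex_map vac (vertex_map u p v) \<ominus>\<^bsub>V\<^esub> vertex_map u p (D_op V vertex_map vac v)"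
    using uv by (simp add: V_eq_iff V_closed vertex_map_closed fderiv_def D_op_to_fock to_fock_smult to_fock_vertex_map V.minus_closed to_fock_diff D_fvertex)
next
  fix us v \<phi> assume us: "set us \<subseteq> carrier V" "v \<in> carrier V" and phi: "\<phi> \<in> graded_dual V V_grade"
  obtain f where f: "product_limit (\<lambda>m. \<phi> (of_fock m)) (map to_fock us) (to_fock v) f" using product_limit_exists[OF graded_dual_bounded_linfun[OF phi]] by blast
  show "converges_to_rational (length us) (\<lambda>zs. sorted_wrt (\<lambda>z w. norm z > norm w) zs \<and> (\<forall>z\<in>set zs. norm z > 0))
    {ks. length ks = length us} (product_term vertex_map \<phi> us v)"
  proof (rule converges_to_rationalI)
    show "rational_on (length us) f" using f by (simp add: product_limit_def)
    fix zs :: "complex list" assume "length zs = length us" "sorted_wrt (\<lambda>z w. norm z > norm w) zs \<and> (\<forall>z\<in>set zs. norm z > 0)"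
    then have zs: "product_region (length us) zs" by (simp add: product_region_def)
    show "admissible (length us) zs" by (rule product_region_admissible[OF zs])
    have "(product_term fvertex (\<lambda>m. \<phi> (of_fock m)) (map to_fock us) (to_fock v) zs has_sum f zs) {ks. length ks = length us}"
      using f zs by (simp add: product_limit_def)
    then show "(product_term vertex_map \<phi> us v zs has_sum f zs) {ks. length ks = length us}"
      by (rule has_sum_cong[THEN iffD1, rotated]) (simp add: product_term_to_fock[OF us])
  qed
next
  fix u1 u2 v \<phi> assume u: "u1 \<in> carrier V" "u2 \<in> carrier V" and v: "v \<in> carrier V" and phi: "\<phi> \<in> graded_dual V V_grade"
  obtain f where f: "iterate_limit (\<lambda>m. \<phi> (of_fock m)) (to_fock u1) (to_fock u2) (to_fock v) f"
    using iterate_limit_exists[OF graded_dual_bounded_linfun[OF phi] to_fock_basis_span[OF u(2)]] by blast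
  show "converges_to_rational 2 (\<lambda>zs. norm (zs ! 1) > norm (zs ! 0 - zs ! 1) \<and> norm (zs ! 0 - zs ! 1) > 0)
        UNIV (\<lambda>zs. iterate_term vertex_map \<phi> u1 u2 v (zs ! 0) (zs ! 1))"
  proof (rule converges_to_rationalI)
    show "rational_on 2 f" using f by (simp add: iterate_limit_def product_limit_def numeral_2_eq_2)
    fix zs :: "complex list" assume l: "length zs = 2" and R: "norm (zs ! 1) > norm (zs ! 0 - zs ! 1) \<and> norm (zs ! 0 - zs ! 1) > 0"
    obtain z1 z2 where zs: "zs = [z1, z2]" using length_2_list[OF l] by blast
    show "admissible 2 zs" using R by (auto simp: admissible_def zs)
    show "(iterate_term vertex_map \<phi> u1 u2 v (zs ! 0) (zs ! 1) has_sum f zs) UNIV"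
      unfolding iterate_term_to_fock[OF u v] using f l R by (simp add: iterate_limit_def iterate_region_def)
  qed
next
  fix u1 u2 v \<phi> and z1 z2 :: complex
  assume u: "u1 \<in> carrier V" "u2 \<in> carrier V" and v: "v \<in> carrier V" and phi: "\<phi> \<in> graded_dual V V_grade"
    and z: "norm z1 > norm z2" "norm z2 > norm (z1 - z2)" "norm (z1 - z2) > 0"
  obtain f where f: "iterate_limit (\<lambda>m. \<phi> (of_fock m)) (to_fock u1) (to_fock u2) (to_fock v) f"
    using iterate_limit_exists[OF graded_dual_bounded_linfun[OF phi] to_fock_basis_span[OF u(2)]] by blast
  \<comment> \<open>The pair lies in both regions, so both series converge to the same value
    \<open>f [z1, z2]\<close>.\<close>
  have R: "product_region 2 [z1, z2]" "iterate_region [z1, z2]" using z by (auto simp: product_region_def iterate_region_def)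
  have us: "set [u1, u2] \<subseteq> carrier V" using u by simp
  have "(product_term fvertex (\<lambda>m. \<phi> (of_fock m)) (map to_fock [u1, u2]) (to_fock v) [z1, z2] has_sum f [z1, z2]) {ks. length ks = 2}"
    using f R(1) by (simp add: iterate_limit_def product_limit_def numeral_2_eq_2)
  then have "(product_term vertex_map \<phi> [u1, u2] v [z1, z2] has_sum f [z1, z2]) {ks. length ks = 2}"
    by (rule has_sum_cong[THEN iffD1, rotated]) (simp add: product_term_to_fock[OF us v])
  moreover have "(iterate_term vertex_map \<phi> u1 u2 v z1 z2 has_sum f [z1, z2]) UNIV"
  proof -
    have "(iterate_term fvertex (\<lambda>m. \<phi> (of_fock m)) (to_fock u1) (to_fock u2) (to_fock v) ([z1, z2] ! 0) ([z1, z2] ! 1) has_sum f [z1, z2]) UNIV"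
      using f R(2) unfolding iterate_limit_def by blast
    then show ?thesis unfolding iterate_term_to_fock[OF u v] by simp
  qed
  ultimately show "infsum (product_term vertex_map \<phi> [u1, u2] v [z1, z2]) {ks. length ks = 2} =
        infsum (iterate_term vertex_map \<phi> u1 u2 v z1 z2) UNIV"
    by (simp add: infsumI)
\<comment> \<open>What remains is closure and bilinearity of the vertex operator map.\<close>
qed (simp_all add: V_eq_iff V_closed vertex_map_closed to_fock_vertex_map to_fock_add to_fock_smult linmap_add[OF linmap_fvertex_left'] linmap_smul[OF linmap_fvertex_left']
    linmap_add[OF linmap_fvertex_right'] linmap_smul[OF linmap_fvertex_right'])

end

theorem theorem3p5:
  fixes scale :: "complex \<Rightarrow> 'h :: ab_group_add \<Rightarrow> 'h" and Basis :: "'h set"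
    and form :: "'h \<Rightarrow> 'h \<Rightarrow> complex" and lB lF :: complex
  assumes "bilinear_form_space scale Basis form lB lF"
  shows "graded_mosva
    (bilinear_form_space.V scale form lB lF)
    (bilinear_form_space.V_grade scale form lB lF)
    (bilinear_form_space.vertex_map scale form lB lF)
    (bilinear_form_space.vac scale form lB lF)"
  by (rule bilinear_form_space.graded_mosva_V[OF assms])

end
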